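(* Let $\mathcal C$ be an additive, closed (strict) monoidal category with unit object $I$, let $(L,\lambda,\Lambda)$ be a YB-Lie algebra and $(C,\gamma,\Upsilon)$ a YB-Lie coalgebra in $\mathcal C$. Let $\mathrm{Dual}(L,C)$ be the set of dualities between $L$ and $C$. (i) There are maps $\alpha:\mathrm{Dual}(L,C)\to\mathrm{Hom}(\mathsf{Mnd}(L),\mathsf{Mnd}'(C))$ and $\beta:\mathrm{Hom}(\mathsf{Mnd}(L),\mathsf{Mnd}'(C))\to\mathrm{Dual}(L,C)$ such that $\beta\circ\alpha$ is the identity on $\mathrm{Dual}(L,C)$, where $\mathrm{Hom}$ denotes the set of Lie monad morphisms. Moreover, if $I$ is a regular generator, then $\alpha\circ\beta$ is the identity on $\mathrm{Hom}(\mathsf{Mnd}(L),\mathsf{Mnd}'(C))$. (ii) There are maps $\alpha':\mathrm{Dual}(L,C)\to\mathrm{Hom}(\mathsf{CMnd}(C),\mathsf{CMnd}'(L))$ and $\beta':\mathrm{Hom}(\mathsf{CMnd}(C),\mathsf{CMnd}'(L))\to\mathrm{Dual}(L,C)$ such that $\beta'\circ\alpha'$ is the identity on $\mathrm{Dual}(L,C)$, where $\mathrm{Hom}$ denotes the set of Lie comonad morphisms. Moreover, if $I$ is a regular generator, then $\alpha'\circ\beta'$ is the identity on $\mathrm{Hom}(\mathsf{CMnd}(C),\mathsf{CMnd}'(L))$.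
   Context: Conventions: the tensor product is additive in each variable; an object also denotes its identity morphism. Closed means: each $-\otimes X$ has a right adjoint $\mathsf H(X,-)$, and each $X\otimes-$ has a right adjoint $\mathsf H'(X,-)$. $\mathsf H(-,Y)$ and $\mathsf H'(-,Y)$ are contravariant functors in the usual way. There are canonical natural isomorphisms $\Pi^X_{Y,Z}:\mathsf H(Y\otimes X,Z)\cong\mathsf H(Y,\mathsf H(X,Z))$ and $\Pi'^{X}_{Y,Z}:\mathsf H'(X\otimes Y,Z)\cong\mathsf H'(Y,\mathsf H'(X,Z))$ induced by the adjunctions. For $c:V\otimes V\to V\otimes V$ put $t_c=(c\otimes V)(V\otimes c)$, $w_c=(V\otimes c)(c\otimes V)$. A symmetric Yang-Baxter operator on $V$ is $c:V\otimes V\to V\otimes V$ with $c\circ c=1$ and $(c\otimes V)(V\otimes c)(c\otimes V)=(V\otimes c)(c\otimes V)(V\otimes c)$. A YB-Lie algebra is $(L,\lambda,\Lambda)$ with $\lambda$ a symmetric Yang-Baxter operator on $L$ and $\Lambda:L\otimes L\to L$ with $\Lambda(1+\lambda)=0$, $\Lambda(L\otimes\Lambda)(1+t_\lambda+w_\lambda)=0$, $\lambda(\Lambda\otimes L)=(L\otimes\Lambda)t_\lambda$. A YB-Lie coalgebra is $(C,\gamma,\Upsilon)$ with $\gamma$ a symmetric Yang-Baxter operator on $C$ and $\Upsilon:C\to C\otimes C$ with $\Upsilon+\gamma\Upsilon=0$, $(1+w_\gamma+t_\gamma)(C\otimes\Upsilon)\Upsilon=0$, $(\Upsilon\otimes C)\gamma=w_\gamma(C\otimes\Upsilon)$.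 A duality between $L$ and $C$ is a morphism $\mathrm{ev}:L\otimes C\to I$ such that, with $\mathrm{ev}^2=\mathrm{ev}\circ(L\otimes\mathrm{ev}\otimes C):L\otimes L\otimes C\otimes C\to I$, one has $\mathrm{ev}\circ(\Lambda\otimes C)=\mathrm{ev}^2\circ(L\otimes L\otimes\Upsilon)$ and $\mathrm{ev}^2\circ(\lambda\otimes C\otimes C)=\mathrm{ev}^2\circ(L\otimes L\otimes\gamma)$. A Lie monad on $\mathcal C$ is $(\mathbf L,\boldsymbol\lambda,\boldsymbol\Lambda)$ with $\mathbf L$ an additive endofunctor and natural transformations $\boldsymbol\lambda:\mathbf L\mathbf L\to\mathbf L\mathbf L$, $\boldsymbol\Lambda:\mathbf L\mathbf L\to\mathbf L$ such that, with $(\boldsymbol\lambda\mathbf L)_X=\boldsymbol\lambda_{\mathbf LX}$, $(\mathbf L\boldsymbol\lambda)_X=\mathbf L(\boldsymbol\lambda_X)$ etc., $t=(\mathbf L\boldsymbol\lambda)(\boldsymbol\lambda\mathbf L)$, $w=(\boldsymbol\lambda\mathbf L)(\mathbf L\boldsymbol\lambda)$: $\boldsymbol\lambda^2=1$, $(\mathbf L\boldsymbol\lambda)(\boldsymbol\lambda\mathbf L)(\mathbf L\boldsymbol\lambda)=(\boldsymbol\lambda\mathbf L)(\mathbf L\boldsymbol\lambda)(\boldsymbol\lambda\mathbf L)$, $\boldsymbol\Lambda(1+\boldsymbol\lambda)=0$, $\boldsymbol\Lambda(\boldsymbol\Lambda\mathbf L)(1+t+w)=0$, $\boldsymbol\lambda(\mathbf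 L\boldsymbol\Lambda)=(\boldsymbol\Lambda\mathbf L)t$. A Lie monad morphism $\zeta:\mathbf L\to\mathbf L'$ is a natural transformation with $\boldsymbol\Lambda'\circ(\zeta*\zeta)=\zeta\circ\boldsymbol\Lambda$ and $\boldsymbol\lambda'\circ(\zeta*\zeta)=(\zeta*\zeta)\circ\boldsymbol\lambda$ ($*$ is horizontal composition). Dually, a Lie comonad is $(\mathbf D,\boldsymbol\gamma,\boldsymbol\Upsilon)$ with $\mathbf D$ an additive endofunctor, $\boldsymbol\gamma:\mathbf D\mathbf D\to\mathbf D\mathbf D$ involutive and satisfying the Yang-Baxter equation, and $\boldsymbol\Upsilon:\mathbf D\to\mathbf D\mathbf D$ such that, with $w=(\mathbf D\boldsymbol\gamma)(\boldsymbol\gamma\mathbf D)$ and $t=(\boldsymbol\gamma\mathbf D)(\mathbf D\boldsymbol\gamma)$, $\boldsymbol\Upsilon+\boldsymbol\gamma\boldsymbol\Upsilon=0$, $(1+w+t)(\mathbf D\boldsymbol\Upsilon)\boldsymbol\Upsilon=0$, $(\boldsymbol\Upsilon\mathbf D)\boldsymbol\gamma=w(\mathbf D\boldsymbol\Upsilon)$; Lie comonad morphisms are natural transformations $\theta:\mathbf D\to\mathbf D'$ with $\boldsymbol\Upsilon'\theta=(\theta*\theta)\boldsymbol\Upsilon$ and $\boldsymbol\gamma'(\theta*\theta)=(\theta*\theta)\boldsymbol\gamma$. $\mathsf{Mnd}(L)$ is the Lie monad $-\otimes L$ with structure $M\otimes\lambda$, $M\otimes\Lambda$ at $M$. $\mathsf{Mnd}'(C)$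 is the Lie monad $\mathsf H(C,-)$ with structure at $M$ given by $\Pi^C_{C,M}\circ\mathsf H(\gamma,M)\circ(\Pi^C_{C,M})^{-1}$ and $\mathsf H(\Upsilon,M)\circ(\Pi^C_{C,M})^{-1}$. $\mathsf{CMnd}(C)$ is the Lie comonad $C\otimes-$ with structure $\gamma\otimes M$, $\Upsilon\otimes M$ at $M$. $\mathsf{CMnd}'(L)$ is the Lie comonad $\mathsf H'(L,-)$ with structure $\Pi'^L_{L,M}\circ\mathsf H'(\lambda,M)\circ(\Pi'^L_{L,M})^{-1}$ and $\Pi'^L_{L,M}\circ\mathsf H'(\Lambda,M)$ at $M$. An object $G$ (in a category having the coproducts below) is a regular generator if for every object $X$ the fork $\coprod_{(g,h)}G\rightrightarrows H=\coprod_{f:G\to X}G\xrightarrow{f_X}X$ is a coequalizer, where $f_X$ has component $f$ at index $f$, the first coproduct runs over all pairs $g,h:G\to H$ with $f_Xg=f_Xh$, and the parallel arrows have components $g$ and $h$. *)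

theory Defs
  imports "HOL-Algebra.Group"
begin

section \<open>Additive strict monoidal categories\<close>

record ('o, 'a) category_data =
  Obj :: "'o set"
  Arr :: "'a set"
  Dom :: "'a \<Rightarrow> 'o"
  Cod :: "'a \<Rightarrow> 'o"
  Idt :: "'o \<Rightarrow> 'a"
  Comp :: "'a \<Rightarrow> 'a \<Rightarrow> 'a"  (infixl "\<cdot>\<index>" 70)

text \<open>\<open>g \<cdot> f\<close> is \<open>f\<close> followed by \<open>g\<close>. All laws are required for composable arrows only.\<close>

definition Hom :: "('o, 'a, 'x) category_data_scheme \<Rightarrow> 'o \<Rightarrow> 'o \<Rightarrow> 'a set" where
  "Hom \<C> A B = {f \<in> Arr \<C>. Dom \<C> f = A \<and> Cod \<C> f = B}"

locale category =
  fixes \<C> :: "('o, 'a, 'x) category_data_scheme" (structure)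
  assumes Dom_Obj: "f \<in> Arr \<C> \<Longrightarrow> Dom \<C> f \<in> Obj \<C>"
    and Cod_Obj: "f \<in> Arr \<C> \<Longrightarrow> Cod \<C> f \<in> Obj \<C>"
    and Idt_Hom: "A \<in> Obj \<C> \<Longrightarrow> Idt \<C> A \<in> Hom \<C> A A"
    and Comp_Hom: "\<lbrakk>f \<in> Hom \<C> A B; g \<in> Hom \<C> B D\<rbrakk> \<Longrightarrow> g \<cdot> f \<in> Hom \<C> A D"
    and Comp_Idt_left: "f \<in> Hom \<C> A B \<Longrightarrow> Idt \<C> B \<cdot> f = f"
    and Comp_Idt_right: "f \<in> Hom \<C> A B \<Longrightarrow> f \<cdot> Idt \<C> A = f"
    and Comp_assoc: "\<lbrakk>f \<in> Hom \<C> A B; g \<in> Hom \<C> B D; h \<in> Hom \<C> D E\<rbrakk>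
          \<Longrightarrow> h \<cdot> g \<cdot> f = h \<cdot> (g \<cdot> f)"

text \<open>The inverse of an isomorphism; only meaningful if \<open>f\<close> is invertible.\<close>

definition inv_arr :: "('o, 'a, 'x) category_data_scheme \<Rightarrow> 'a \<Rightarrow> 'a" where
  "inv_arr \<C> f = (THE g. g \<in> Hom \<C> (Cod \<C> f) (Dom \<C> f) \<and>
     g \<cdot>\<^bsub>\<C>\<^esub> f = Idt \<C> (Dom \<C> f) \<and> f \<cdot>\<^bsub>\<C>\<^esub> g = Idt \<C> (Cod \<C> f))"

record ('o, 'a) additive_category_data = "('o, 'a) category_data" +
  Plus :: "'a \<Rightarrow> 'a \<Rightarrow> 'a"  (infixl "\<oplus>\<index>" 65)
  Zero :: "'o \<Rightarrow> 'o \<Rightarrow> 'a"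

locale additive_category = category \<C>
  for \<C> :: "('o, 'a, 'x) additive_category_data_scheme" (structure) +
  assumes Hom_comm_group: "\<lbrakk>A \<in> Obj \<C>; B \<in> Obj \<C>\<rbrakk> \<Longrightarrow>
      comm_group \<lparr>carrier = Hom \<C> A B, monoid.mult = Plus \<C>, one = Zero \<C> A B\<rparr>"
    and Comp_Plus_left: "\<lbrakk>f \<in> Hom \<C> A B; g \<in> Hom \<C> B D; h \<in> Hom \<C> B D\<rbrakk>
      \<Longrightarrow> (g \<oplus> h) \<cdot> f = g \<cdot> f \<oplus> h \<cdot> f"
    and Comp_Plus_right: "\<lbrakk>f \<in> Hom \<C> A B; g \<in> Hom \<C> A B; h \<in> Hom \<C> B D\<rbrakk>
      \<Longrightarrow> h \<cdot> (f \<oplus> g) = h \<cdot> f \<oplus> h \<cdot> g"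
    and zero_object: "\<exists>Z\<in>Obj \<C>. \<forall>A\<in>Obj \<C>. (\<exists>!f. f \<in> Hom \<C> A Z) \<and> (\<exists>!f. f \<in> Hom \<C> Z A)"
    and biproducts: "\<lbrakk>A \<in> Obj \<C>; B \<in> Obj \<C>\<rbrakk> \<Longrightarrow>
      \<exists>S\<in>Obj \<C>. \<exists>i\<in>Hom \<C> A S. \<exists>j\<in>Hom \<C> B S. \<exists>p\<in>Hom \<C> S A. \<exists>q\<in>Hom \<C> S B.
        p \<cdot> i = Idt \<C> A \<and> q \<cdot> j = Idt \<C> B \<and> p \<cdot> j = Zero \<C> B A \<and> q \<cdot> i = Zero \<C> A B \<and>
        i \<cdot> p \<oplus> j \<cdot> q = Idt \<C> S"

record ('o, 'a) monoidal_category_data = "('o, 'a) additive_category_data" +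
  TensObj :: "'o \<Rightarrow> 'o \<Rightarrow> 'o"  (infixl "\<otimes>\<^sub>o\<index>" 75)
  TensArr :: "'a \<Rightarrow> 'a \<Rightarrow> 'a"  (infixl "\<otimes>\<^sub>a\<index>" 75)
  UnitObj :: "'o"

locale additive_strict_monoidal_category = additive_category \<C>
  for \<C> :: "('o, 'a, 'x) monoidal_category_data_scheme" (structure) +
  assumes TensObj_Obj: "\<lbrakk>A \<in> Obj \<C>; B \<in> Obj \<C>\<rbrakk> \<Longrightarrow> A \<otimes>\<^sub>o B \<in> Obj \<C>"
    and UnitObj_Obj: "UnitObj \<C> \<in> Obj \<C>"
    and TensArr_Hom: "\<lbrakk>f \<in> Hom \<C> A B; g \<in> Hom \<C> D E\<rbrakk>
      \<Longrightarrow> f \<otimes>\<^sub>a g \<in> Hom \<C> (A \<otimes>\<^sub>o D) (B \<otimes>\<^sub>o E)"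
    and TensArr_Idt: "\<lbrakk>A \<in> Obj \<C>; B \<in> Obj \<C>\<rbrakk>
      \<Longrightarrow> Idt \<C> A \<otimes>\<^sub>a Idt \<C> B = Idt \<C> (A \<otimes>\<^sub>o B)"
    and TensArr_Comp: "\<lbrakk>f \<in> Hom \<C> A B; f' \<in> Hom \<C> B B'; g \<in> Hom \<C> D E; g' \<in> Hom \<C> E E'\<rbrakk>
      \<Longrightarrow> (f' \<cdot> f) \<otimes>\<^sub>a (g' \<cdot> g) = (f' \<otimes>\<^sub>a g') \<cdot> (f \<otimes>\<^sub>a g)"
    and TensObj_assoc: "\<lbrakk>A \<in> Obj \<C>; B \<in> Obj \<C>; D \<in> Obj \<C>\<rbrakk>
      \<Longrightarrow> A \<otimes>\<^sub>o B \<otimes>\<^sub>o D = A \<otimes>\<^sub>o (B \<otimes>\<^sub>o D)"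
    and TensArr_assoc: "\<lbrakk>f \<in> Arr \<C>; g \<in> Arr \<C>; h \<in> Arr \<C>\<rbrakk>
      \<Longrightarrow> f \<otimes>\<^sub>a g \<otimes>\<^sub>a h = f \<otimes>\<^sub>a (g \<otimes>\<^sub>a h)"
    and TensObj_unit: "A \<in> Obj \<C> \<Longrightarrow> UnitObj \<C> \<otimes>\<^sub>o A = A" "A \<in> Obj \<C> \<Longrightarrow> A \<otimes>\<^sub>o UnitObj \<C> = A"
    and TensArr_unit: "f \<in> Arr \<C> \<Longrightarrow> Idt \<C> (UnitObj \<C>) \<otimes>\<^sub>a f = f"
      "f \<in> Arr \<C> \<Longrightarrow> f \<otimes>\<^sub>a Idt \<C> (UnitObj \<C>) = f"
    and TensArr_Plus_left: "\<lbrakk>f \<in> Hom \<C> A B; g \<in> Hom \<C> A B; h \<in> Arr \<C>\<rbrakk>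
      \<Longrightarrow> (f \<oplus> g) \<otimes>\<^sub>a h = f \<otimes>\<^sub>a h \<oplus> g \<otimes>\<^sub>a h"
    and TensArr_Plus_right: "\<lbrakk>f \<in> Hom \<C> A B; g \<in> Hom \<C> A B; h \<in> Arr \<C>\<rbrakk>
      \<Longrightarrow> h \<otimes>\<^sub>a (f \<oplus> g) = h \<otimes>\<^sub>a f \<oplus> h \<otimes>\<^sub>a g"


section \<open>Endofunctors, natural transformations, adjunctions\<close>

record ('o, 'a) functor_data =
  fobj :: "'o \<Rightarrow> 'o"
  fmap :: "'a \<Rightarrow> 'a"

definition endofunctor ::
    "('o, 'a, 'x) category_data_scheme \<Rightarrow> ('o, 'a, 'y) functor_data_scheme \<Rightarrow> bool" where
  "endofunctor \<C> F \<longleftrightarrow>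
     (\<forall>X\<in>Obj \<C>. fobj F X \<in> Obj \<C> \<and> fmap F (Idt \<C> X) = Idt \<C> (fobj F X)) \<and>
     (\<forall>X Y. \<forall>f\<in>Hom \<C> X Y. fmap F f \<in> Hom \<C> (fobj F X) (fobj F Y)) \<and>
     (\<forall>X Y Z. \<forall>f\<in>Hom \<C> X Y. \<forall>g\<in>Hom \<C> Y Z. fmap F (g \<cdot>\<^bsub>\<C>\<^esub> f) = fmap F g \<cdot>\<^bsub>\<C>\<^esub> fmap F f)"

definition additive_endofunctor ::
    "('o, 'a, 'x) additive_category_data_scheme \<Rightarrow> ('o, 'a, 'y) functor_data_scheme \<Rightarrow> bool" where
  "additive_endofunctor \<C> F \<longleftrightarrow> endofunctor \<C> F \<and>
     (\<forall>X Y. \<forall>f\<in>Hom \<C> X Y. \<forall>g\<in>Hom \<C> X Y. fmap F (f \<oplus>\<^bsub>\<C>\<^esub> g) = fmap F f \<oplus>\<^bsub>\<C>\<^esub> fmap F g)"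

definition fcomp ::
    "('o, 'a, 'x) functor_data_scheme \<Rightarrow> ('o, 'a, 'y) functor_data_scheme \<Rightarrow> ('o, 'a) functor_data" where
  "fcomp F G = \<lparr>fobj = fobj F \<circ> fobj G, fmap = fmap F \<circ> fmap G\<rparr>"

definition nat_transf ::
    "('o, 'a, 'x) category_data_scheme \<Rightarrow> ('o, 'a, 'y) functor_data_scheme \<Rightarrow>
     ('o, 'a, 'z) functor_data_scheme \<Rightarrow> ('o \<Rightarrow> 'a) \<Rightarrow> bool" where
  "nat_transf \<C> F G \<tau> \<longleftrightarrow>
     (\<forall>X\<in>Obj \<C>. \<tau> X \<in> Hom \<C> (fobj F X) (fobj G X)) \<and>
     (\<forall>X Y. \<forall>f\<in>Hom \<C> X Y. \<tau> Y \<cdot>\<^bsub>\<C>\<^esub> fmap F f = fmap G f \<cdot>\<^bsub>\<C>\<^esub> \<tau> X)"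

text \<open>Horizontal composition \<open>\<zeta> * \<zeta> : FF \<rightarrow> GG\<close> of \<open>\<zeta> : F \<rightarrow> G\<close> with itself; for natural \<open>\<zeta>\<close>
  this is also \<open>G(\<zeta>\<^sub>X) \<cdot> \<zeta>\<close> at \<open>F X\<close>.\<close>

definition hsquare ::
    "('o, 'a, 'x) category_data_scheme \<Rightarrow> ('o, 'a, 'y) functor_data_scheme \<Rightarrow>
     ('o, 'a, 'z) functor_data_scheme \<Rightarrow> ('o \<Rightarrow> 'a) \<Rightarrow> 'o \<Rightarrow> 'a" where
  "hsquare \<C> F G \<zeta> X = \<zeta> (fobj G X) \<cdot>\<^bsub>\<C>\<^esub> fmap F (\<zeta> X)"

definition whisker_right ::
    "('o \<Rightarrow> 'a) \<Rightarrow> ('o, 'a, 'y) functor_data_scheme \<Rightarrow> 'o \<Rightarrow> 'a" where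
  "whisker_right \<tau> F X = \<tau> (fobj F X)"

definition whisker_left ::
    "('o, 'a, 'y) functor_data_scheme \<Rightarrow> ('o \<Rightarrow> 'a) \<Rightarrow> 'o \<Rightarrow> 'a" where
  "whisker_left F \<tau> X = fmap F (\<tau> X)"

definition adjunction ::
    "('o, 'a, 'x) category_data_scheme \<Rightarrow> ('o, 'a, 'y) functor_data_scheme \<Rightarrow>
     ('o, 'a, 'z) functor_data_scheme \<Rightarrow> ('o \<Rightarrow> 'o \<Rightarrow> 'a \<Rightarrow> 'a) \<Rightarrow> bool" where
  "adjunction \<C> F G \<phi> \<longleftrightarrow> endofunctor \<C> F \<and> endofunctor \<C> G \<and>
     (\<forall>A\<in>Obj \<C>. \<forall>Y\<in>Obj \<C>. bij_betw (\<phi> A Y) (Hom \<C> (fobj F A) Y) (Hom \<C> A (fobj G Y))) \<and>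
     (\<forall>A A' Y Y'. \<forall>a\<in>Hom \<C> A' A. \<forall>y\<in>Hom \<C> Y Y'. \<forall>f\<in>Hom \<C> (fobj F A) Y.
        \<phi> A' Y' (y \<cdot>\<^bsub>\<C>\<^esub> f \<cdot>\<^bsub>\<C>\<^esub> fmap F a) = fmap G y \<cdot>\<^bsub>\<C>\<^esub> \<phi> A Y f \<cdot>\<^bsub>\<C>\<^esub> a)"


section \<open>Closed structure\<close>

definition tensor_right ::
    "('o, 'a, 'x) monoidal_category_data_scheme \<Rightarrow> 'o \<Rightarrow> ('o, 'a) functor_data" where
  "tensor_right \<C> X = \<lparr>fobj = (\<lambda>A. A \<otimes>\<^sub>o\<^bsub>\<C>\<^esub> X), fmap = (\<lambda>f. f \<otimes>\<^sub>a\<^bsub>\<C>\<^esub> Idt \<C> X)\<rparr>"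

definition tensor_left ::
    "('o, 'a, 'x) monoidal_category_data_scheme \<Rightarrow> 'o \<Rightarrow> ('o, 'a) functor_data" where
  "tensor_left \<C> X = \<lparr>fobj = (\<lambda>A. X \<otimes>\<^sub>o\<^bsub>\<C>\<^esub> A), fmap = (\<lambda>f. Idt \<C> X \<otimes>\<^sub>a\<^bsub>\<C>\<^esub> f)\<rparr>"

text \<open>
  \<open>RHom X\<close> is the functor \<open>H(X,-)\<close>, right adjoint to \<open>- \<otimes> X\<close>, with adjunction bijections
  \<open>RCur X A Y : Hom(A \<otimes> X, Y) \<rightarrow> Hom(A, H(X,Y))\<close>; \<open>LHom X\<close> is the functor \<open>H'(X,-)\<close>, right
  adjoint to \<open>X \<otimes> -\<close>, with adjunction bijections
  \<open>LCur X A Y : Hom(X \<otimes> A, Y) \<rightarrow> Hom(A, H'(X,Y))\<close>.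
\<close>

record ('o, 'a) closed_category_data = "('o, 'a) monoidal_category_data" +
  RHom :: "'o \<Rightarrow> ('o, 'a) functor_data"
  RCur :: "'o \<Rightarrow> 'o \<Rightarrow> 'o \<Rightarrow> 'a \<Rightarrow> 'a"
  LHom :: "'o \<Rightarrow> ('o, 'a) functor_data"
  LCur :: "'o \<Rightarrow> 'o \<Rightarrow> 'o \<Rightarrow> 'a \<Rightarrow> 'a"

locale additive_closed_strict_monoidal_category = additive_strict_monoidal_category \<C>
  for \<C> :: "('o, 'a, 'x) closed_category_data_scheme" (structure) +
  assumes right_closed: "X \<in> Obj \<C> \<Longrightarrow> adjunction \<C> (tensor_right \<C> X) (RHom \<C> X) (RCur \<C> X)"
    and left_closed: "X \<in> Obj \<C> \<Longrightarrow> adjunction \<C> (tensor_left \<C> X) (LHom \<C> X) (LCur \<C> X)"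

context
  fixes \<C> :: "('o, 'a, 'x) closed_category_data_scheme" (structure)
begin

text \<open>The counits \<open>H(X,Y) \<otimes> X \<rightarrow> Y\<close> and \<open>X \<otimes> H'(X,Y) \<rightarrow> Y\<close>.\<close>

definition REval :: "'o \<Rightarrow> 'o \<Rightarrow> 'a" where
  "REval X Y = inv_into (Hom \<C> (fobj (RHom \<C> X) Y \<otimes>\<^sub>o X) Y) (RCur \<C> X (fobj (RHom \<C> X) Y) Y)
     (Idt \<C> (fobj (RHom \<C> X) Y))"

definition LEval :: "'o \<Rightarrow> 'o \<Rightarrow> 'a" where
  "LEval X Y = inv_into (Hom \<C> (X \<otimes>\<^sub>o fobj (LHom \<C> X) Y) Y) (LCur \<C> X (fobj (LHom \<C> X) Y) Y)
     (Idt \<C> (fobj (LHom \<C> X) Y))"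

text \<open>For \<open>f : X \<rightarrow> X'\<close>, the contravariant actions \<open>H(f,Y) : H(X',Y) \<rightarrow> H(X,Y)\<close> and
  \<open>H'(f,Y) : H'(X',Y) \<rightarrow> H'(X,Y)\<close>: the transposes of
  \<open>H(X',Y) \<otimes> X \<rightarrow> H(X',Y) \<otimes> X' \<rightarrow> Y\<close> and \<open>X \<otimes> H'(X',Y) \<rightarrow> X' \<otimes> H'(X',Y) \<rightarrow> Y\<close>.\<close>

definition RContra :: "'a \<Rightarrow> 'o \<Rightarrow> 'a" where
  "RContra f Y = (let X = Dom \<C> f; X' = Cod \<C> f; B = fobj (RHom \<C> X') Y in
     RCur \<C> X B Y (REval X' Y \<cdot> (Idt \<C> B \<otimes>\<^sub>a f)))"

definition LContra :: "'a \<Rightarrow> 'o \<Rightarrow> 'a" where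
  "LContra f Y = (let X = Dom \<C> f; X' = Cod \<C> f; B = fobj (LHom \<C> X') Y in
     LCur \<C> X B Y (LEval X' Y \<cdot> (f \<otimes>\<^sub>a Idt \<C> B)))"

text \<open>The canonical isomorphisms \<open>H(Y \<otimes> X, Z) \<rightarrow> H(Y, H(X,Z))\<close> and
  \<open>H'(X \<otimes> Y, Z) \<rightarrow> H'(Y, H'(X,Z))\<close>. They represent the composite bijections
  \<open>Hom(A, H(Y \<otimes> X, Z)) \<cong> Hom(A \<otimes> Y \<otimes> X, Z) \<cong> Hom(A \<otimes> Y, H(X,Z)) \<cong> Hom(A, H(Y, H(X,Z)))\<close>
  (and their mirror images), evaluated at the identity of \<open>A = H(Y \<otimes> X, Z)\<close>.\<close>

definition RPi :: "'o \<Rightarrow> 'o \<Rightarrow> 'o \<Rightarrow> 'a" where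
  "RPi X Y Z = (let A = fobj (RHom \<C> (Y \<otimes>\<^sub>o X)) Z in
     RCur \<C> Y A (fobj (RHom \<C> X) Z) (RCur \<C> X (A \<otimes>\<^sub>o Y) Z (REval (Y \<otimes>\<^sub>o X) Z)))"

definition LPi :: "'o \<Rightarrow> 'o \<Rightarrow> 'o \<Rightarrow> 'a" where
  "LPi X Y Z = (let A = fobj (LHom \<C> (X \<otimes>\<^sub>o Y)) Z in
     LCur \<C> Y A (fobj (LHom \<C> X) Z) (LCur \<C> X (Y \<otimes>\<^sub>o A) Z (LEval (X \<otimes>\<^sub>o Y) Z)))"

end


section \<open>YB-Lie algebras, YB-Lie coalgebras and dualities\<close>

context
  fixes \<C> :: "('o, 'a, 'x) monoidal_category_data_scheme" (structure)
begin

definition yb_t :: "'o \<Rightarrow> 'a \<Rightarrow> 'a" where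
  "yb_t V c = (c \<otimes>\<^sub>a Idt \<C> V) \<cdot> (Idt \<C> V \<otimes>\<^sub>a c)"

definition yb_w :: "'o \<Rightarrow> 'a \<Rightarrow> 'a" where
  "yb_w V c = (Idt \<C> V \<otimes>\<^sub>a c) \<cdot> (c \<otimes>\<^sub>a Idt \<C> V)"

definition symmetric_yb_operator :: "'o \<Rightarrow> 'a \<Rightarrow> bool" where
  "symmetric_yb_operator V c \<longleftrightarrow> V \<in> Obj \<C> \<and> c \<in> Hom \<C> (V \<otimes>\<^sub>o V) (V \<otimes>\<^sub>o V) \<and>
     c \<cdot> c = Idt \<C> (V \<otimes>\<^sub>o V) \<and>
     (c \<otimes>\<^sub>a Idt \<C> V) \<cdot> (Idt \<C> V \<otimes>\<^sub>a c) \<cdot> (c \<otimes>\<^sub>a Idt \<C> V) =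
     (Idt \<C> V \<otimes>\<^sub>a c) \<cdot> (c \<otimes>\<^sub>a Idt \<C> V) \<cdot> (Idt \<C> V \<otimes>\<^sub>a c)"

definition yb_lie_algebra :: "'o \<Rightarrow> 'a \<Rightarrow> 'a \<Rightarrow> bool" where
  "yb_lie_algebra L l b \<longleftrightarrow> symmetric_yb_operator L l \<and> b \<in> Hom \<C> (L \<otimes>\<^sub>o L) L \<and>
     b \<cdot> (Idt \<C> (L \<otimes>\<^sub>o L) \<oplus> l) = Zero \<C> (L \<otimes>\<^sub>o L) L \<and>
     b \<cdot> (Idt \<C> L \<otimes>\<^sub>a b) \<cdot> (Idt \<C> (L \<otimes>\<^sub>o L \<otimes>\<^sub>o L) \<oplus> yb_t L l \<oplus> yb_w L l) =
       Zero \<C> (L \<otimes>\<^sub>o L \<otimes>\<^sub>o L) L \<and>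
     l \<cdot> (b \<otimes>\<^sub>a Idt \<C> L) = (Idt \<C> L \<otimes>\<^sub>a b) \<cdot> yb_t L l"

definition yb_lie_coalgebra :: "'o \<Rightarrow> 'a \<Rightarrow> 'a \<Rightarrow> bool" where
  "yb_lie_coalgebra C g u \<longleftrightarrow> symmetric_yb_operator C g \<and> u \<in> Hom \<C> C (C \<otimes>\<^sub>o C) \<and>
     u \<oplus> g \<cdot> u = Zero \<C> C (C \<otimes>\<^sub>o C) \<and>
     (Idt \<C> (C \<otimes>\<^sub>o C \<otimes>\<^sub>o C) \<oplus> yb_w C g \<oplus> yb_t C g) \<cdot> (Idt \<C> C \<otimes>\<^sub>a u) \<cdot> u =
       Zero \<C> C (C \<otimes>\<^sub>o C \<otimes>\<^sub>o C) \<and>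
     (u \<otimes>\<^sub>a Idt \<C> C) \<cdot> g = yb_w C g \<cdot> (Idt \<C> C \<otimes>\<^sub>a u)"

definition ev_square :: "'o \<Rightarrow> 'o \<Rightarrow> 'a \<Rightarrow> 'a" where
  "ev_square L C ev = ev \<cdot> (Idt \<C> L \<otimes>\<^sub>a ev \<otimes>\<^sub>a Idt \<C> C)"

definition Dual :: "'o \<Rightarrow> 'a \<Rightarrow> 'a \<Rightarrow> 'o \<Rightarrow> 'a \<Rightarrow> 'a \<Rightarrow> 'a set" where
  "Dual L l b C g u = {ev \<in> Hom \<C> (L \<otimes>\<^sub>o C) (UnitObj \<C>).
     ev \<cdot> (b \<otimes>\<^sub>a Idt \<C> C) = ev_square L C ev \<cdot> (Idt \<C> L \<otimes>\<^sub>a Idt \<C> L \<otimes>\<^sub>a u) \<and>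
     ev_square L C ev \<cdot> (l \<otimes>\<^sub>a Idt \<C> C \<otimes>\<^sub>a Idt \<C> C) =
       ev_square L C ev \<cdot> (Idt \<C> L \<otimes>\<^sub>a Idt \<C> L \<otimes>\<^sub>a g)}"

end


section \<open>Lie monads and Lie comonads\<close>

record ('o, 'a) lie_monad_data = "('o, 'a) functor_data" +
  twist :: "'o \<Rightarrow> 'a"
  bracket :: "'o \<Rightarrow> 'a"

record ('o, 'a) lie_comonad_data = "('o, 'a) functor_data" +
  cotwist :: "'o \<Rightarrow> 'a"
  cobracket :: "'o \<Rightarrow> 'a"

context
  fixes \<C> :: "('o, 'a, 'x) additive_category_data_scheme" (structure)
begin

definition lie_monad :: "('o, 'a) lie_monad_data \<Rightarrow> bool" where
  "lie_monad L \<longleftrightarrow> additive_endofunctor \<C> L \<and>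
     nat_transf \<C> (fcomp L L) (fcomp L L) (twist L) \<and>
     nat_transf \<C> (fcomp L L) L (bracket L) \<and>
     (\<forall>X\<in>Obj \<C>.
       let LX = fobj L X; LLX = fobj L LX; LLLX = fobj L LLX;
           l = twist L X; lL = whisker_right (twist L) L X; Ll = whisker_left L (twist L) X;
           b = bracket L X; bL = whisker_right (bracket L) L X; Lb = whisker_left L (bracket L) X;
           t = Ll \<cdot> lL; w = lL \<cdot> Ll
       in l \<cdot> l = Idt \<C> LLX \<and>
          Ll \<cdot> lL \<cdot> Ll = lL \<cdot> Ll \<cdot> lL \<and>
          b \<cdot> (Idt \<C> LLX \<oplus> l) = Zero \<C> LLX LX \<and>
          b \<cdot> bL \<cdot> (Idt \<C> LLLX \<oplus> t \<oplus> w) = Zero \<C> LLLX LX \<and>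
          l \<cdot> Lb = bL \<cdot> t)"

definition lie_comonad :: "('o, 'a) lie_comonad_data \<Rightarrow> bool" where
  "lie_comonad D \<longleftrightarrow> additive_endofunctor \<C> D \<and>
     nat_transf \<C> (fcomp D D) (fcomp D D) (cotwist D) \<and>
     nat_transf \<C> D (fcomp D D) (cobracket D) \<and>
     (\<forall>X\<in>Obj \<C>.
       let DX = fobj D X; DDX = fobj D DX; DDDX = fobj D DDX;
           g = cotwist D X; gD = whisker_right (cotwist D) D X; Dg = whisker_left D (cotwist D) X;
           u = cobracket D X; uD = whisker_right (cobracket D) D X;
           Du = whisker_left D (cobracket D) X;
           w = Dg \<cdot> gD; t = gD \<cdot> Dg
       in g \<cdot> g = Idt \<C> DDX \<and>
          Dg \<cdot> gD \<cdot> Dg = gD \<cdot> Dg \<cdot> gD \<and>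
          u \<oplus> g \<cdot> u = Zero \<C> DX DDX \<and>
          (Idt \<C> DDDX \<oplus> w \<oplus> t) \<cdot> Du \<cdot> u = Zero \<C> DX DDDX \<and>
          uD \<cdot> g = w \<cdot> Du)"

text \<open>Morphisms are families indexed by the objects; \<open>extensional\<close> makes equality of families
  mean equality at all objects. Being an element of these sets includes the assertion that source
  and target are Lie (co)monads.\<close>

definition LieMonadHom :: "('o, 'a) lie_monad_data \<Rightarrow> ('o, 'a) lie_monad_data \<Rightarrow> ('o \<Rightarrow> 'a) set" where
  "LieMonadHom L L' = {\<zeta> \<in> extensional (Obj \<C>).
     lie_monad L \<and> lie_monad L' \<and> nat_transf \<C> L L' \<zeta> \<and>
     (\<forall>X\<in>Obj \<C>.
        bracket L' X \<cdot> hsquare \<C> L L' \<zeta> X = \<zeta> X \<cdot> bracket L X \<and>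
        twist L' X \<cdot> hsquare \<C> L L' \<zeta> X = hsquare \<C> L L' \<zeta> X \<cdot> twist L X)}"

definition LieComonadHom ::
    "('o, 'a) lie_comonad_data \<Rightarrow> ('o, 'a) lie_comonad_data \<Rightarrow> ('o \<Rightarrow> 'a) set" where
  "LieComonadHom D D' = {\<theta> \<in> extensional (Obj \<C>).
     lie_comonad D \<and> lie_comonad D' \<and> nat_transf \<C> D D' \<theta> \<and>
     (\<forall>X\<in>Obj \<C>.
        cobracket D' X \<cdot> \<theta> X = hsquare \<C> D D' \<theta> X \<cdot> cobracket D X \<and>
        cotwist D' X \<cdot> hsquare \<C> D D' \<theta> X = hsquare \<C> D D' \<theta> X \<cdot> cotwist D X)}"

end

context
  fixes \<C> :: "('o, 'a, 'x) closed_category_data_scheme" (structure)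
begin

definition Mnd :: "'o \<Rightarrow> 'a \<Rightarrow> 'a \<Rightarrow> ('o, 'a) lie_monad_data" where
  "Mnd L l b =
     \<lparr>fobj = fobj (tensor_right \<C> L), fmap = fmap (tensor_right \<C> L),
      twist = (\<lambda>M. Idt \<C> M \<otimes>\<^sub>a l), bracket = (\<lambda>M. Idt \<C> M \<otimes>\<^sub>a b)\<rparr>"

definition Mnd' :: "'o \<Rightarrow> 'a \<Rightarrow> 'a \<Rightarrow> ('o, 'a) lie_monad_data" where
  "Mnd' C g u =
     \<lparr>fobj = fobj (RHom \<C> C), fmap = fmap (RHom \<C> C),
      twist = (\<lambda>M. RPi \<C> C C M \<cdot> RContra \<C> g M \<cdot> inv_arr \<C> (RPi \<C> C C M)),
      bracket = (\<lambda>M. RContra \<C> u M \<cdot> inv_arr \<C> (RPi \<C> C C M))\<rparr>"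

definition CMnd :: "'o \<Rightarrow> 'a \<Rightarrow> 'a \<Rightarrow> ('o, 'a) lie_comonad_data" where
  "CMnd C g u =
     \<lparr>fobj = fobj (tensor_left \<C> C), fmap = fmap (tensor_left \<C> C),
      cotwist = (\<lambda>M. g \<otimes>\<^sub>a Idt \<C> M), cobracket = (\<lambda>M. u \<otimes>\<^sub>a Idt \<C> M)\<rparr>"

definition CMnd' :: "'o \<Rightarrow> 'a \<Rightarrow> 'a \<Rightarrow> ('o, 'a) lie_comonad_data" where
  "CMnd' L l b =
     \<lparr>fobj = fobj (LHom \<C> L), fmap = fmap (LHom \<C> L),
      cotwist = (\<lambda>M. LPi \<C> L L M \<cdot> LContra \<C> l M \<cdot> inv_arr \<C> (LPi \<C> L L M)),
      cobracket = (\<lambda>M. LPi \<C> L L M \<cdot> LContra \<C> b M)\<rparr>"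

end


section \<open>Regular generators\<close>

context
  fixes \<C> :: "('o, 'a, 'x) category_data_scheme" (structure)
begin

definition is_copower :: "'j set \<Rightarrow> 'o \<Rightarrow> 'o \<Rightarrow> ('j \<Rightarrow> 'a) \<Rightarrow> bool" where
  "is_copower J G S \<iota> \<longleftrightarrow> S \<in> Obj \<C> \<and> (\<forall>j\<in>J. \<iota> j \<in> Hom \<C> G S) \<and>
     (\<forall>Y\<in>Obj \<C>. \<forall>u. (\<forall>j\<in>J. u j \<in> Hom \<C> G Y) \<longrightarrow>
        (\<exists>!v. v \<in> Hom \<C> S Y \<and> (\<forall>j\<in>J. v \<cdot> \<iota> j = u j)))"

definition is_coequalizer :: "'o \<Rightarrow> 'o \<Rightarrow> 'o \<Rightarrow> 'a \<Rightarrow> 'a \<Rightarrow> 'a \<Rightarrow> bool" where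
  "is_coequalizer K H X a b q \<longleftrightarrow>
     a \<in> Hom \<C> K H \<and> b \<in> Hom \<C> K H \<and> q \<in> Hom \<C> H X \<and> q \<cdot> a = q \<cdot> b \<and>
     (\<forall>Y\<in>Obj \<C>. \<forall>u\<in>Hom \<C> H Y. u \<cdot> a = u \<cdot> b \<longrightarrow> (\<exists>!v. v \<in> Hom \<C> X Y \<and> v \<cdot> q = u))"

text \<open>The coproducts are unique up to isomorphism, so it does not matter which ones are taken;
  their existence is part of the definition.\<close>

definition regular_generator :: "'o \<Rightarrow> bool" where
  "regular_generator G \<longleftrightarrow> G \<in> Obj \<C> \<and>
     (\<forall>X\<in>Obj \<C>. \<exists>H \<iota> fX K \<kappa> a b.
        is_copower (Hom \<C> G X) G H \<iota> \<and>
        fX \<in> Hom \<C> H X \<and> (\<forall>f\<in>Hom \<C> G X. fX \<cdot> \<iota> f = f) \<and>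
        is_copower {(g, h). g \<in> Hom \<C> G H \<and> h \<in> Hom \<C> G H \<and> fX \<cdot> g = fX \<cdot> h} G K \<kappa> \<and>
        a \<in> Hom \<C> K H \<and> b \<in> Hom \<C> K H \<and>
        (\<forall>g\<in>Hom \<C> G H. \<forall>h\<in>Hom \<C> G H. fX \<cdot> g = fX \<cdot> h \<longrightarrow>
           a \<cdot> \<kappa> (g, h) = g \<and> b \<cdot> \<kappa> (g, h) = h) \<and>
        is_coequalizer K H X a b fX)"

end

end

theory Submission
  imports Defs
begin

text \<open>
  If \<open>F\<close> is left adjoint to \<open>G\<close>, then transposition turns a Lie comonad structure on \<open>F\<close> into a Lie
  monad structure on \<open>G\<close>, and a Lie monad structure on \<open>F\<close> into a Lie comonad structure on \<open>G\<close>; for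
  \<open>F = - \<otimes> C\<close> and \<open>F = L \<otimes> -\<close> these are the structures on \<open>H(C,-)\<close> and \<open>H'(L,-)\<close>.
  A pairing \<open>ev : L \<otimes> C \<rightarrow> I\<close> gives the natural transformation \<open>- \<otimes> L \<rightarrow> H(C,-)\<close> whose component at \<open>X\<close>
  is the transpose of \<open>X \<otimes> ev\<close>. The transpose of its horizontal square is \<open>X \<otimes> ev\<^sup>2\<close>, so it is a
  morphism of Lie monads exactly if \<open>ev\<close> is a duality. The component at \<open>I\<close> recovers \<open>ev\<close>. If \<open>I\<close> is
  a regular generator, the morphisms \<open>f \<otimes> Z\<close> with \<open>f : I \<rightarrow> X\<close> are jointly epic, because \<open>- \<otimes> Z\<close> has
  a right adjoint; hence every natural transformation \<open>- \<otimes> L \<rightarrow> H(C,-)\<close> comes from a pairing.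
  The comonad statement is treated in the same way in the category with the reversed tensor product.
\<close>

section \<open>Calculus in additive monoidal categories\<close>

context category
begin

text \<open>Membership in a hom-set is always unfolded into its three conditions, so that the
  simplifier settles composability by computing \<open>Dom\<close> and \<open>Cod\<close>. This is
  what the \<open>_simps\<close> lemmas after each operation are for.\<close>

lemma in_Hom [simp]: "f \<in> Hom \<C> A B \<longleftrightarrow> f \<in> Arr \<C> \<and> Dom \<C> f = A \<and> Cod \<C> f = B"
  by (simp add: Hom_def)

declare Dom_Obj [simp] Cod_Obj [simp]

lemma Idt_simps [simp]:
  assumes "A \<in> Obj \<C>"
  shows "Idt \<C> A \<in> Arr \<C>" "Dom \<C> (Idt \<C> A) = A" "Cod \<C> (Idt \<C> A) = A"
  using Idt_Hom[OF assms] by auto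

lemma Comp_simps [simp]:
  assumes "f \<in> Arr \<C>" "g \<in> Arr \<C>" "Dom \<C> g = Cod \<C> f"
  shows "g \<cdot> f \<in> Arr \<C>" "Dom \<C> (g \<cdot> f) = Dom \<C> f" "Cod \<C> (g \<cdot> f) = Cod \<C> g"
  using Comp_Hom[of f "Dom \<C> f" "Cod \<C> f" g "Cod \<C> g"] assms by auto

lemma Comp_Idt [simp]:
  assumes "f \<in> Arr \<C>"
  shows "Cod \<C> f = B \<Longrightarrow> Idt \<C> B \<cdot> f = f" "Dom \<C> f = B \<Longrightarrow> f \<cdot> Idt \<C> B = f"
  using assms Comp_Idt_left[of f "Dom \<C> f" B] Comp_Idt_right[of f B "Cod \<C> f"] by auto

text \<open>Composites are normalised to nest to the right; equations meant for rewriting are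
  brought into this form later.\<close>

lemma Comp_assoc' [simp]:
  assumes "f \<in> Arr \<C>" "g \<in> Arr \<C>" "h \<in> Arr \<C>" "Dom \<C> g = Cod \<C> f" "Dom \<C> h = Cod \<C> g"
  shows "h \<cdot> g \<cdot> f = h \<cdot> (g \<cdot> f)"
  using Comp_assoc[of f "Dom \<C> f" "Cod \<C> f" g "Cod \<C> g" h "Cod \<C> h"] assms by auto

text \<open>Two-sided inverses are unique, so the definite description in \<open>inv_arr\<close> can
  be evaluated by exhibiting one.\<close>

lemma inv_arr_eqI:
  assumes "f \<in> Hom \<C> A B" "g \<in> Hom \<C> B A" "g \<cdot> f = Idt \<C> A" "f \<cdot> g = Idt \<C> B"
  shows "inv_arr \<C> f = g"
  unfolding inv_arr_def
proof (rule the_equality)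
  show "g \<in> Hom \<C> (Cod \<C> f) (Dom \<C> f) \<and> g \<cdot> f = Idt \<C> (Dom \<C> f) \<and> f \<cdot> g = Idt \<C> (Cod \<C> f)"
    using assms by auto
next
  fix k assume k: "k \<in> Hom \<C> (Cod \<C> f) (Dom \<C> f) \<and> k \<cdot> f = Idt \<C> (Dom \<C> f) \<and>
    f \<cdot> k = Idt \<C> (Cod \<C> f)"
  have "k \<cdot> f \<cdot> g = k \<cdot> (f \<cdot> g)"
    using assms k by (intro Comp_assoc') auto
  with k assms show "k = g" by auto
qed

end

section \<open>Hom-sets as abelian groups\<close>

context additive_category
begin

lemma Plus_simps [simp]:
  assumes "f \<in> Arr \<C>" "g \<in> Arr \<C>" "Dom \<C> g = Dom \<C> f" "Cod \<C> g = Cod \<C> f"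
  shows "f \<oplus> g \<in> Arr \<C>" "Dom \<C> (f \<oplus> g) = Dom \<C> f" "Cod \<C> (f \<oplus> g) = Cod \<C> f"
proof -
  interpret comm_group "\<lparr>carrier = Hom \<C> (Dom \<C> f) (Cod \<C> f), monoid.mult = Plus \<C>,
      one = Zero \<C> (Dom \<C> f) (Cod \<C> f)\<rparr>"
    using assms by (intro Hom_comm_group) auto
  show "f \<oplus> g \<in> Arr \<C>" "Dom \<C> (f \<oplus> g) = Dom \<C> f" "Cod \<C> (f \<oplus> g) = Cod \<C> f"
    using m_closed[of f g] assms by auto
qed

lemma Zero_simps [simp]:
  assumes "A \<in> Obj \<C>" "B \<in> Obj \<C>"
  shows "Zero \<C> A B \<in> Arr \<C>" "Dom \<C> (Zero \<C> A B) = A" "Cod \<C> (Zero \<C> A B) = B"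
proof -
  interpret comm_group "\<lparr>carrier = Hom \<C> A B, monoid.mult = Plus \<C>, one = Zero \<C> A B\<rparr>"
    using assms by (rule Hom_comm_group)
  show "Zero \<C> A B \<in> Arr \<C>" "Dom \<C> (Zero \<C> A B) = A" "Cod \<C> (Zero \<C> A B) = B"
    using one_closed by auto
qed

lemma Plus_assoc:
  assumes "f \<in> Arr \<C>" "g \<in> Arr \<C>" "h \<in> Arr \<C>" "Dom \<C> g = Dom \<C> f" "Cod \<C> g = Cod \<C> f"
    "Dom \<C> h = Dom \<C> f" "Cod \<C> h = Cod \<C> f"
  shows "f \<oplus> g \<oplus> h = f \<oplus> (g \<oplus> h)"
proof -
  interpret comm_group "\<lparr>carrier = Hom \<C> (Dom \<C> f) (Cod \<C> f), monoid.mult = Plus \<C>,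
      one = Zero \<C> (Dom \<C> f) (Cod \<C> f)\<rparr>"
    using assms by (intro Hom_comm_group) auto
  show ?thesis using m_assoc[of f g h] assms by auto
qed

lemma Plus_comm:
  assumes "f \<in> Arr \<C>" "g \<in> Arr \<C>" "Dom \<C> g = Dom \<C> f" "Cod \<C> g = Cod \<C> f"
  shows "f \<oplus> g = g \<oplus> f"
proof -
  interpret comm_group "\<lparr>carrier = Hom \<C> (Dom \<C> f) (Cod \<C> f), monoid.mult = Plus \<C>,
      one = Zero \<C> (Dom \<C> f) (Cod \<C> f)\<rparr>"
    using assms by (intro Hom_comm_group) auto
  show ?thesis using m_comm[of f g] assms by auto
qed

lemma Plus_Zero [simp]:
  assumes "f \<in> Arr \<C>" "Dom \<C> f = A" "Cod \<C> f = B"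
  shows "f \<oplus> Zero \<C> A B = f" "Zero \<C> A B \<oplus> f = f"
proof -
  interpret comm_group "\<lparr>carrier = Hom \<C> A B, monoid.mult = Plus \<C>, one = Zero \<C> A B\<rparr>"
    using assms by (intro Hom_comm_group) auto
  show "f \<oplus> Zero \<C> A B = f" "Zero \<C> A B \<oplus> f = f"
    using r_one[of f] l_one[of f] assms by auto
qed

text \<open>Cancellation in the hom-group. An operation that preserves sums sends zero to an
  idempotent; this is how \<open>Comp_Zero\<close>, \<open>TensArr_Zero\<close> and
  \<open>flat_Zero\<close> follow from additivity.\<close>

lemma Plus_idem_imp_Zero:
  assumes "f \<in> Arr \<C>" "f \<oplus> f = f" "Dom \<C> f = A" "Cod \<C> f = B"
  shows "f = Zero \<C> A B"
proof -
  interpret comm_group "\<lparr>carrier = Hom \<C> A B, monoid.mult = Plus \<C>, one = Zero \<C> A B\<rparr>"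
    using assms by (intro Hom_comm_group) auto
  show ?thesis using r_cancel_one[of f f] assms by auto
qed

lemma Comp_Plus:
  assumes "f \<in> Arr \<C>" "g \<in> Arr \<C>" "h \<in> Arr \<C>"
  shows "\<lbrakk>Dom \<C> g = Cod \<C> f; Dom \<C> h = Cod \<C> f; Cod \<C> h = Cod \<C> g\<rbrakk>
      \<Longrightarrow> (g \<oplus> h) \<cdot> f = g \<cdot> f \<oplus> h \<cdot> f"
    and "\<lbrakk>Dom \<C> g = Dom \<C> f; Cod \<C> g = Cod \<C> f; Dom \<C> h = Cod \<C> f\<rbrakk>
      \<Longrightarrow> h \<cdot> (f \<oplus> g) = h \<cdot> f \<oplus> h \<cdot> g"
  using assms Comp_Plus_left[of f "Dom \<C> f" "Cod \<C> f" g "Cod \<C> g" h]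
    Comp_Plus_right[of f "Dom \<C> f" "Cod \<C> f" g h "Cod \<C> h"] by auto

lemma Comp_Zero [simp]:
  assumes "f \<in> Arr \<C>" "A \<in> Obj \<C>"
  shows "Dom \<C> f = B \<Longrightarrow> f \<cdot> Zero \<C> A B = Zero \<C> A (Cod \<C> f)"
    and "Cod \<C> f = B \<Longrightarrow> Zero \<C> B A \<cdot> f = Zero \<C> (Dom \<C> f) A"
proof -
  show "f \<cdot> Zero \<C> A B = Zero \<C> A (Cod \<C> f)" if "Dom \<C> f = B"
    using assms that Comp_Plus(2)[of "Zero \<C> A B" "Zero \<C> A B" f, symmetric]
    by (intro Plus_idem_imp_Zero) auto
  show "Zero \<C> B A \<cdot> f = Zero \<C> (Dom \<C> f) A" if "Cod \<C> f = B"
    using assms that Comp_Plus(1)[of f "Zero \<C> B A" "Zero \<C> B A", symmetric]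
    by (intro Plus_idem_imp_Zero) auto
qed

end

section \<open>Strict tensor product and the interchange law\<close>

context additive_strict_monoidal_category
begin

declare TensObj_Obj [simp] UnitObj_Obj [simp] TensObj_assoc [simp] TensObj_unit [simp]
  TensArr_assoc [simp] TensArr_unit [simp]

lemma TensArr_simps [simp]:
  assumes "f \<in> Arr \<C>" "g \<in> Arr \<C>"
  shows "f \<otimes>\<^sub>a g \<in> Arr \<C>" "Dom \<C> (f \<otimes>\<^sub>a g) = Dom \<C> f \<otimes>\<^sub>o Dom \<C> g"
    "Cod \<C> (f \<otimes>\<^sub>a g) = Cod \<C> f \<otimes>\<^sub>o Cod \<C> g"
  using assms TensArr_Hom[of f "Dom \<C> f" "Cod \<C> f" g "Dom \<C> g" "Cod \<C> g"] by auto

lemma Idt_TensObj: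
  "\<lbrakk>A \<in> Obj \<C>; B \<in> Obj \<C>\<rbrakk> \<Longrightarrow> Idt \<C> (A \<otimes>\<^sub>o B) = Idt \<C> A \<otimes>\<^sub>a Idt \<C> B"
  by (simp add: TensArr_Idt)

lemma interchange:
  assumes "f \<in> Arr \<C>" "g \<in> Arr \<C>" "f' \<in> Arr \<C>" "g' \<in> Arr \<C>"
    "Dom \<C> f' = Cod \<C> f" "Dom \<C> g' = Cod \<C> g"
  shows "(f' \<otimes>\<^sub>a g') \<cdot> (f \<otimes>\<^sub>a g) = (f' \<cdot> f) \<otimes>\<^sub>a (g' \<cdot> g)"
  using assms TensArr_Comp[of f "Dom \<C> f" "Cod \<C> f" f' "Cod \<C> f'" g "Dom \<C> g" "Cod \<C> g" g' "Cod \<C> g'"]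
  by auto

lemma TensArr_Plus:
  assumes "f \<in> Arr \<C>" "g \<in> Arr \<C>" "h \<in> Arr \<C>" "Dom \<C> g = Dom \<C> f" "Cod \<C> g = Cod \<C> f"
  shows "(f \<oplus> g) \<otimes>\<^sub>a h = f \<otimes>\<^sub>a h \<oplus> g \<otimes>\<^sub>a h" "h \<otimes>\<^sub>a (f \<oplus> g) = h \<otimes>\<^sub>a f \<oplus> h \<otimes>\<^sub>a g"
  using assms TensArr_Plus_left[of f "Dom \<C> f" "Cod \<C> f" g h]
    TensArr_Plus_right[of f "Dom \<C> f" "Cod \<C> f" g h] by auto

lemma TensArr_Zero [simp]:
  assumes "f \<in> Arr \<C>" "A \<in> Obj \<C>" "B \<in> Obj \<C>"
  shows "f \<otimes>\<^sub>a Zero \<C> A B = Zero \<C> (Dom \<C> f \<otimes>\<^sub>o A) (Cod \<C> f \<otimes>\<^sub>o B)"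
    "Zero \<C> A B \<otimes>\<^sub>a f = Zero \<C> (A \<otimes>\<^sub>o Dom \<C> f) (B \<otimes>\<^sub>o Cod \<C> f)"
  using assms TensArr_Plus[of "Zero \<C> A B" "Zero \<C> A B" f, symmetric]
  by (auto intro!: Plus_idem_imp_Zero)

end

section \<open>Transport of Lie structures along an adjunction\<close>

text \<open>\<open>flat Y h\<close> is the transpose \<open>F A \<rightarrow> Y\<close> of \<open>h : A \<rightarrow> G Y\<close>; taking it in this form spares
  the argument \<open>A\<close>.\<close>

locale additive_adjunction = additive_category \<C>
  for \<C> :: "('o, 'a, 'x) additive_category_data_scheme" (structure) +
  fixes F :: "('o, 'a) functor_data" and G :: "('o, 'a) functor_data"
    and \<phi> :: "'o \<Rightarrow> 'o \<Rightarrow> 'a \<Rightarrow> 'a"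
  assumes adj: "adjunction \<C> F G \<phi>"
    and F_additive: "additive_endofunctor \<C> F"
begin

text \<open>For tensoring and internal hom this unfolds to the same term as
  \<open>REval\<close>.\<close>

definition counit :: "'o \<Rightarrow> 'a" where
  "counit Y = inv_into (Hom \<C> (fobj F (fobj G Y)) Y) (\<phi> (fobj G Y) Y) (Idt \<C> (fobj G Y))"

definition flat :: "'o \<Rightarrow> 'a \<Rightarrow> 'a" where
  "flat Y h = counit Y \<cdot> fmap F h"

text \<open>Twofold transpose \<open>F (F A) \<rightarrow> Y\<close> of a morphism
  \<open>A \<rightarrow> G (G Y)\<close>; it compares structure maps on \<open>G G\<close> with
  those on \<open>F F\<close>.\<close>

definition flat2 :: "'o \<Rightarrow> 'a \<Rightarrow> 'a" where
  "flat2 Y h = flat Y (flat (fobj G Y) h)"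

lemma functors: "endofunctor \<C> F" "endofunctor \<C> G"
  using adj by (auto simp: adjunction_def)

lemma fobj_simps [simp]:
  assumes "X \<in> Obj \<C>"
  shows "fobj F X \<in> Obj \<C>" "fobj G X \<in> Obj \<C>"
    "fmap F (Idt \<C> X) = Idt \<C> (fobj F X)" "fmap G (Idt \<C> X) = Idt \<C> (fobj G X)"
  using functors assms by (auto simp: endofunctor_def)

lemma fmap_simps [simp]:
  assumes "f \<in> Arr \<C>"
  shows "fmap F f \<in> Arr \<C>" "Dom \<C> (fmap F f) = fobj F (Dom \<C> f)"
    "Cod \<C> (fmap F f) = fobj F (Cod \<C> f)"
    "fmap G f \<in> Arr \<C>" "Dom \<C> (fmap G f) = fobj G (Dom \<C> f)"
    "Cod \<C> (fmap G f) = fobj G (Cod \<C> f)"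
  using functors assms by (auto simp: endofunctor_def)

lemma fmap_Comp [simp]:
  assumes "f \<in> Arr \<C>" "g \<in> Arr \<C>" "Dom \<C> g = Cod \<C> f"
  shows "fmap F (g \<cdot> f) = fmap F g \<cdot> fmap F f" "fmap G (g \<cdot> f) = fmap G g \<cdot> fmap G f"
  using functors assms by (auto simp: endofunctor_def)

lemma fmap_F_Plus [simp]:
  assumes "f \<in> Arr \<C>" "g \<in> Arr \<C>" "Dom \<C> g = Dom \<C> f" "Cod \<C> g = Cod \<C> f"
  shows "fmap F (f \<oplus> g) = fmap F f \<oplus> fmap F g"
  using F_additive assms by (auto simp: additive_endofunctor_def)

lemma phi_natural:
  assumes "a \<in> Arr \<C>" "y \<in> Arr \<C>" "f \<in> Hom \<C> (fobj F (Cod \<C> a)) (Dom \<C> y)"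
  shows "\<phi> (Dom \<C> a) (Cod \<C> y) (y \<cdot> f \<cdot> fmap F a) = fmap G y \<cdot> \<phi> (Cod \<C> a) (Dom \<C> y) f \<cdot> a"
  using adj assms unfolding adjunction_def by auto

lemma phi_simps [simp]:
  assumes "f \<in> Arr \<C>" "Dom \<C> f = fobj F A" "Cod \<C> f = Y" "A \<in> Obj \<C>"
  shows "\<phi> A Y f \<in> Arr \<C>" "Dom \<C> (\<phi> A Y f) = A" "Cod \<C> (\<phi> A Y f) = fobj G Y"
proof -
  have "bij_betw (\<phi> A Y) (Hom \<C> (fobj F A) Y) (Hom \<C> A (fobj G Y))"
    using adj assms unfolding adjunction_def by auto
  then have "\<phi> A Y f \<in> Hom \<C> A (fobj G Y)"
    using assms by (auto dest: bij_betwE)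
  then show "\<phi> A Y f \<in> Arr \<C>" "Dom \<C> (\<phi> A Y f) = A" "Cod \<C> (\<phi> A Y f) = fobj G Y"
    by auto
qed

lemma counit_props:
  assumes "Y \<in> Obj \<C>"
  shows "counit Y \<in> Hom \<C> (fobj F (fobj G Y)) Y"
    "\<phi> (fobj G Y) Y (counit Y) = Idt \<C> (fobj G Y)"
proof -
  have "bij_betw (\<phi> (fobj G Y) Y) (Hom \<C> (fobj F (fobj G Y)) Y) (Hom \<C> (fobj G Y) (fobj G Y))"
    using adj assms unfolding adjunction_def by auto
  then have img: "Idt \<C> (fobj G Y) \<in> \<phi> (fobj G Y) Y ` Hom \<C> (fobj F (fobj G Y)) Y"
    using assms by (auto simp: bij_betw_def)
  show "counit Y \<in> Hom \<C> (fobj F (fobj G Y)) Y"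
    using inv_into_into[OF img] by (simp only: counit_def)
  show "\<phi> (fobj G Y) Y (counit Y) = Idt \<C> (fobj G Y)"
    using f_inv_into_f[OF img] by (simp only: counit_def)
qed

lemma counit_simps [simp]:
  assumes "Y \<in> Obj \<C>"
  shows "counit Y \<in> Arr \<C>" "Dom \<C> (counit Y) = fobj F (fobj G Y)" "Cod \<C> (counit Y) = Y"
  using counit_props(1)[OF assms] by auto

text \<open>Naturality of \<open>\<phi>\<close> along \<open>h\<close>, applied to the counit, whose
  transpose is an identity.\<close>

lemma phi_flat:
  assumes "h \<in> Hom \<C> A (fobj G Y)" "Y \<in> Obj \<C>"
  shows "\<phi> A Y (flat Y h) = h"
  using phi_natural[of h "Idt \<C> Y" "counit Y"] counit_props[of Y] assms
  by (auto simp: flat_def)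

lemma flat_simps [simp]:
  assumes "h \<in> Arr \<C>" "Cod \<C> h = fobj G Y" "Y \<in> Obj \<C>"
  shows "flat Y h \<in> Arr \<C>" "Dom \<C> (flat Y h) = fobj F (Dom \<C> h)" "Cod \<C> (flat Y h) = Y"
  using assms by (auto simp: flat_def)

text \<open>By \<open>phi_flat\<close>, \<open>flat\<close> is a right inverse of
  \<open>\<phi>\<close>; injectivity of \<open>\<phi>\<close> makes it a left inverse too.\<close>

lemma flat_phi [simp]:
  assumes "f \<in> Arr \<C>" "Dom \<C> f = fobj F A" "Cod \<C> f = Y" "A \<in> Obj \<C>"
  shows "flat Y (\<phi> A Y f) = f"
proof -
  have "inj_on (\<phi> A Y) (Hom \<C> (fobj F A) Y)"
    using adj assms unfolding adjunction_def by (auto simp: bij_betw_def)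
  moreover have "\<phi> A Y (flat Y (\<phi> A Y f)) = \<phi> A Y f"
    using assms by (intro phi_flat) auto
  ultimately show ?thesis
    using assms by (auto dest!: inj_onD)
qed

text \<open>Equations between morphisms into \<open>G Y\<close> are proved by comparing transposes;
  \<open>flat2_eqD\<close> and \<open>flat3_eqD\<close> iterate this.\<close>

lemma flat_eqD:
  assumes "flat Y h = flat Y k" "h \<in> Arr \<C>" "k \<in> Arr \<C>" "Dom \<C> h = Dom \<C> k"
    "Cod \<C> h = fobj G Y" "Cod \<C> k = fobj G Y" "Y \<in> Obj \<C>"
  shows "h = k"
proof -
  have "h = \<phi> (Dom \<C> h) Y (flat Y h)"
    by (rule phi_flat[symmetric]) (simp_all add: assms(2,5,7))
  also have "\<dots> = \<phi> (Dom \<C> k) Y (flat Y k)"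
    by (simp only: assms(1,4))
  also have "\<dots> = k"
    by (rule phi_flat) (simp_all add: assms(3,6,7))
  finally show ?thesis .
qed

lemma flat_Comp:
  assumes "h \<in> Arr \<C>" "k \<in> Arr \<C>" "Cod \<C> h = fobj G Y" "Y \<in> Obj \<C>" "Dom \<C> h = Cod \<C> k"
  shows "flat Y (h \<cdot> k) = flat Y h \<cdot> fmap F k"
  using assms by (auto simp: flat_def)

lemma flat_fmap:
  assumes "h \<in> Arr \<C>" "y \<in> Arr \<C>" "Cod \<C> h = fobj G (Dom \<C> y)" "Cod \<C> y = Y"
  shows "flat Y (fmap G y \<cdot> h) = y \<cdot> flat (Dom \<C> y) h"
proof -
  have "fmap G y \<cdot> h = \<phi> (Dom \<C> h) Y (y \<cdot> flat (Dom \<C> y) h)"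
    using phi_natural[of h y "counit (Dom \<C> y)"] counit_props[of "Dom \<C> y"] assms
    by (auto simp: flat_def)
  then show ?thesis
    using assms by simp
qed

lemma flat_Plus:
  assumes "h \<in> Arr \<C>" "k \<in> Arr \<C>" "Cod \<C> h = fobj G Y" "Cod \<C> k = fobj G Y" "Y \<in> Obj \<C>"
    "Dom \<C> h = Dom \<C> k"
  shows "flat Y (h \<oplus> k) = flat Y h \<oplus> flat Y k"
  using assms by (auto simp: flat_def Comp_Plus)

lemma flat_Zero:
  assumes "A \<in> Obj \<C>" "Y \<in> Obj \<C>"
  shows "flat Y (Zero \<C> A (fobj G Y)) = Zero \<C> (fobj F A) Y"
  using assms flat_Plus[of "Zero \<C> A (fobj G Y)" "Zero \<C> A (fobj G Y)" Y]
  by (intro Plus_idem_imp_Zero) auto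

lemma flat2_simps [simp]:
  assumes "h \<in> Arr \<C>" "Cod \<C> h = fobj G (fobj G Y)" "Y \<in> Obj \<C>"
  shows "flat2 Y h \<in> Arr \<C>" "Dom \<C> (flat2 Y h) = fobj F (fobj F (Dom \<C> h))" "Cod \<C> (flat2 Y h) = Y"
  using assms by (auto simp: flat2_def)

lemma flat2_Comp:
  assumes "h \<in> Arr \<C>" "k \<in> Arr \<C>" "Cod \<C> h = fobj G (fobj G Y)" "Y \<in> Obj \<C>" "Dom \<C> h = Cod \<C> k"
  shows "flat2 Y (h \<cdot> k) = flat2 Y h \<cdot> fmap F (fmap F k)"
  using assms by (auto simp: flat2_def flat_Comp)

lemma flat2_fmap:
  assumes "h \<in> Arr \<C>" "y \<in> Arr \<C>" "Cod \<C> h = fobj G (fobj G (Dom \<C> y))" "Cod \<C> y = Y"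
  shows "flat2 Y (fmap G (fmap G y) \<cdot> h) = y \<cdot> flat2 (Dom \<C> y) h"
  using assms by (auto simp: flat2_def flat_fmap)

lemma flat2_eqD:
  assumes "flat2 Y h = flat2 Y k" "h \<in> Arr \<C>" "k \<in> Arr \<C>" "Dom \<C> h = Dom \<C> k"
    "Cod \<C> h = fobj G (fobj G Y)" "Cod \<C> k = fobj G (fobj G Y)" "Y \<in> Obj \<C>"
  shows "h = k"
proof (rule flat_eqD[of "fobj G Y"])
  show "flat (fobj G Y) h = flat (fobj G Y) k"
    using assms(1) unfolding flat2_def by (rule flat_eqD) (simp_all add: assms(2-))
qed (simp_all add: assms(2-))

text \<open>The transpose of \<open>G f\<close> is \<open>f\<close> after the counit, which is
  additive in \<open>f\<close>, and transposition is additive because \<open>F\<close> is.\<close>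

lemma G_additive: "additive_endofunctor \<C> G"
  unfolding additive_endofunctor_def
proof (intro conjI allI ballI)
  show "endofunctor \<C> G" by (rule functors)
  fix X Y f g assume "f \<in> Hom \<C> X Y" and "g \<in> Hom \<C> X Y"
  then have f: "f \<in> Arr \<C>" "Dom \<C> f = X" "Cod \<C> f = Y"
    and g: "g \<in> Arr \<C>" "Dom \<C> g = X" "Cod \<C> g = Y"
    by simp_all
  then have X: "X \<in> Obj \<C>" and Y: "Y \<in> Obj \<C>"
    by auto
  have eq: "flat Y (fmap G h) = h \<cdot> counit X" if "h \<in> Arr \<C>" "Dom \<C> h = X" "Cod \<C> h = Y" for h
    using flat_fmap[of "Idt \<C> (fobj G X)" h Y] that X by (simp add: flat_def)
  show "fmap G (f \<oplus> g) = fmap G f \<oplus> fmap G g"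
  proof (rule flat_eqD[of Y])
    show "flat Y (fmap G (f \<oplus> g)) = flat Y (fmap G f \<oplus> fmap G g)"
      using f g X Y by (simp add: flat_Plus Comp_Plus eq)
  qed (use f g X Y in simp_all)
qed

definition flat3 :: "'o \<Rightarrow> 'a \<Rightarrow> 'a" where
  "flat3 Y h = flat Y (flat2 (fobj G Y) h)"

lemma flat3_simps [simp]:
  assumes "h \<in> Arr \<C>" "Cod \<C> h = fobj G (fobj G (fobj G Y))" "Y \<in> Obj \<C>"
  shows "flat3 Y h \<in> Arr \<C>" "Dom \<C> (flat3 Y h) = fobj F (fobj F (fobj F (Dom \<C> h)))"
    "Cod \<C> (flat3 Y h) = Y"
  using assms by (auto simp: flat3_def)

lemma flat3_eqD:
  assumes "flat3 Y h = flat3 Y k" "h \<in> Arr \<C>" "k \<in> Arr \<C>" "Dom \<C> h = Dom \<C> k"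
    "Cod \<C> h = fobj G (fobj G (fobj G Y))" "Cod \<C> k = fobj G (fobj G (fobj G Y))" "Y \<in> Obj \<C>"
  shows "h = k"
proof (rule flat2_eqD[of "fobj G Y"])
  show "flat2 (fobj G Y) h = flat2 (fobj G Y) k"
    using assms(1) unfolding flat3_def by (rule flat_eqD) (simp_all add: assms(2-))
qed (simp_all add: assms(2-))

lemma flat2_Plus:
  assumes "h \<in> Arr \<C>" "k \<in> Arr \<C>" "Cod \<C> h = fobj G (fobj G Y)" "Cod \<C> k = fobj G (fobj G Y)"
    "Y \<in> Obj \<C>" "Dom \<C> h = Dom \<C> k"
  shows "flat2 Y (h \<oplus> k) = flat2 Y h \<oplus> flat2 Y k"
  using assms by (simp add: flat2_def flat_Plus)

lemma flat3_Plus: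
  assumes "h \<in> Arr \<C>" "k \<in> Arr \<C>" "Cod \<C> h = fobj G (fobj G (fobj G Y))"
    "Cod \<C> k = fobj G (fobj G (fobj G Y))" "Y \<in> Obj \<C>" "Dom \<C> h = Dom \<C> k"
  shows "flat3 Y (h \<oplus> k) = flat3 Y h \<oplus> flat3 Y k"
  using assms by (simp add: flat3_def flat2_Plus flat_Plus)

text \<open>The other grouping of the three transpositions: removing the outermost \<open>G\<close>
  first pulls a structure map out of \<open>fmap G\<close> before \<open>flat2\<close> meets
  it.\<close>

lemma flat_flat3:
  assumes "Y \<in> Obj \<C>" "h \<in> Arr \<C>" "Cod \<C> h = fobj G (fobj G (fobj G Y))"
  shows "flat3 Y h = flat2 Y (flat (fobj G (fobj G Y)) h)"
  by (simp add: flat3_def flat2_def)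

text \<open>The mate hypotheses say that composing with \<open>l\<close> or \<open>b\<close> after
  \<open>h\<close> amounts, on transposes, to composing with \<open>\<gamma>\<close> or
  \<open>u\<close> before. Transposition thus reverses the order of composition and turns each
  comonad axiom for \<open>F\<close> into the monad axiom for \<open>G\<close>. The arbitrary
  \<open>h\<close> lets a chain of structure maps be transposed one factor at a time.\<close>

lemma right_adjoint_of_lie_comonad:
  assumes D: "lie_comonad \<C> \<lparr>fobj = fobj F, fmap = fmap F, cotwist = \<gamma>, cobracket = u\<rparr>"
    and l: "\<And>X. X \<in> Obj \<C> \<Longrightarrow> l X \<in> Hom \<C> (fobj G (fobj G X)) (fobj G (fobj G X))"
    and l_mate: "\<And>X h. \<lbrakk>X \<in> Obj \<C>; h \<in> Arr \<C>; Cod \<C> h = fobj G (fobj G X)\<rbrakk>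
      \<Longrightarrow> flat2 X (l X \<cdot> h) = flat2 X h \<cdot> \<gamma> (Dom \<C> h)"
    and b: "\<And>X. X \<in> Obj \<C> \<Longrightarrow> b X \<in> Hom \<C> (fobj G (fobj G X)) (fobj G X)"
    and b_mate: "\<And>X h. \<lbrakk>X \<in> Obj \<C>; h \<in> Arr \<C>; Cod \<C> h = fobj G (fobj G X)\<rbrakk>
      \<Longrightarrow> flat X (b X \<cdot> h) = flat2 X h \<cdot> u (Dom \<C> h)"
  shows "lie_monad \<C> \<lparr>fobj = fobj G, fmap = fmap G, twist = l, bracket = b\<rparr>"
proof -
  have nat: "nat_transf \<C> (fcomp F F) (fcomp F F) \<gamma>" "nat_transf \<C> F (fcomp F F) u"
    using D by (simp_all add: lie_comonad_def nat_transf_def fcomp_def)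
  have \<gamma> [simp]: "\<gamma> A \<in> Arr \<C>" "Dom \<C> (\<gamma> A) = fobj F (fobj F A)" "Cod \<C> (\<gamma> A) = fobj F (fobj F A)"
    and u [simp]: "u A \<in> Arr \<C>" "Dom \<C> (u A) = fobj F A" "Cod \<C> (u A) = fobj F (fobj F A)"
    if "A \<in> Obj \<C>" for A
    using nat that by (simp_all add: nat_transf_def fcomp_def)
  have axioms:
    "\<gamma> A \<cdot> \<gamma> A = Idt \<C> (fobj F (fobj F A))"
    "fmap F (\<gamma> A) \<cdot> (\<gamma> (fobj F A) \<cdot> fmap F (\<gamma> A)) = \<gamma> (fobj F A) \<cdot> (fmap F (\<gamma> A) \<cdot> \<gamma> (fobj F A))"
    "u A \<oplus> \<gamma> A \<cdot> u A = Zero \<C> (fobj F A) (fobj F (fobj F A))"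
    "(Idt \<C> (fobj F (fobj F (fobj F A))) \<oplus> fmap F (\<gamma> A) \<cdot> \<gamma> (fobj F A) \<oplus> \<gamma> (fobj F A) \<cdot> fmap F (\<gamma> A)) \<cdot>
      (fmap F (u A) \<cdot> u A) = Zero \<C> (fobj F A) (fobj F (fobj F (fobj F A)))"
    "u (fobj F A) \<cdot> \<gamma> A = fmap F (\<gamma> A) \<cdot> (\<gamma> (fobj F A) \<cdot> fmap F (u A))"
    if "A \<in> Obj \<C>" for A
    using D that by (simp_all add: lie_comonad_def Let_def whisker_left_def whisker_right_def)
  have l' [simp]: "l X \<in> Arr \<C>" "Dom \<C> (l X) = fobj G (fobj G X)" "Cod \<C> (l X) = fobj G (fobj G X)"
    and b' [simp]: "b X \<in> Arr \<C>" "Dom \<C> (b X) = fobj G (fobj G X)" "Cod \<C> (b X) = fobj G X"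
    if "X \<in> Obj \<C>" for X
    using l[OF that] b[OF that] by auto
  \<comment> \<open>Under transposition the two whiskerings trade places: \<open>l\<close> at
    \<open>G X\<close> corresponds to \<open>F\<close> applied to \<open>\<gamma>\<close>, and
    \<open>G\<close> applied to \<open>l\<close> to \<open>\<gamma>\<close> at an object
    \<open>F A\<close>; likewise for the brackets.\<close>
  have lG: "flat3 X (l (fobj G X) \<cdot> h) = flat3 X h \<cdot> fmap F (\<gamma> (Dom \<C> h))"
    and Gl: "flat3 X (fmap G (l X) \<cdot> h) = flat3 X h \<cdot> \<gamma> (fobj F (Dom \<C> h))"
    and bG: "flat2 X (b (fobj G X) \<cdot> h) = flat3 X h \<cdot> fmap F (u (Dom \<C> h))"
    and Gb: "flat2 X (fmap G (b X) \<cdot> h) = flat3 X h \<cdot> u (fobj F (Dom \<C> h))"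
    if "X \<in> Obj \<C>" "h \<in> Arr \<C>" "Cod \<C> h = fobj G (fobj G (fobj G X))" for X h
  proof -
    show "flat3 X (l (fobj G X) \<cdot> h) = flat3 X h \<cdot> fmap F (\<gamma> (Dom \<C> h))"
      using that by (simp add: flat3_def l_mate flat_Comp)
    show "flat3 X (fmap G (l X) \<cdot> h) = flat3 X h \<cdot> \<gamma> (fobj F (Dom \<C> h))"
      using that by (simp add: flat_flat3 l_mate flat_fmap)
    show "flat2 X (b (fobj G X) \<cdot> h) = flat3 X h \<cdot> fmap F (u (Dom \<C> h))"
      using that by (simp add: flat2_def[of X] flat3_def b_mate) (simp add: flat_Comp)
    show "flat2 X (fmap G (b X) \<cdot> h) = flat3 X h \<cdot> u (fobj F (Dom \<C> h))"
      using that by (simp add: flat2_def flat3_def b_mate flat_fmap)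
  qed
  note mates = l_mate b_mate lG Gl bG Gb
  \<comment> \<open>The instances at an identity serve the last factor of a chain, where
    normalisation has left no \<open>h\<close>.\<close>
  have mates_Idt:
      "flat2 X (l X) = flat2 X (Idt \<C> (fobj G (fobj G X))) \<cdot> \<gamma> (fobj G (fobj G X))"
      "flat X (b X) = flat2 X (Idt \<C> (fobj G (fobj G X))) \<cdot> u (fobj G (fobj G X))"
      "flat3 X (l (fobj G X)) = flat3 X (Idt \<C> (fobj G (fobj G (fobj G X)))) \<cdot> fmap F (\<gamma> (fobj G (fobj G (fobj G X))))"
      "flat3 X (fmap G (l X)) = flat3 X (Idt \<C> (fobj G (fobj G (fobj G X)))) \<cdot> \<gamma> (fobj F (fobj G (fobj G (fobj G X))))"
      "flat2 X (b (fobj G X)) = flat3 X (Idt \<C> (fobj G (fobj G (fobj G X)))) \<cdot> fmap F (u (fobj G (fobj G (fobj G X))))"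
      "flat2 X (fmap G (b X)) = flat3 X (Idt \<C> (fobj G (fobj G (fobj G X)))) \<cdot> u (fobj F (fobj G (fobj G (fobj G X))))"
    if "X \<in> Obj \<C>" for X
    using that mates[of X "Idt \<C> (fobj G (fobj G X))"]
      mates[of X "Idt \<C> (fobj G (fobj G (fobj G X)))"] by simp_all
  \<comment> \<open>After transposition \<open>f\<close> acts on the left and the comonad structure
    on the right, at the same object on both sides of the equation.\<close>
  have l_nat: "l Y \<cdot> fmap G (fmap G f) = fmap G (fmap G f) \<cdot> l X"
    and b_nat: "b Y \<cdot> fmap G (fmap G f) = fmap G f \<cdot> b X"
    if "f \<in> Arr \<C>" "Dom \<C> f = X" "Cod \<C> f = Y" for f X Y
  proof -
    have XY: "X \<in> Obj \<C>" "Y \<in> Obj \<C>" using that by auto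
    have eq: "flat2 Y (fmap G (fmap G f)) = f \<cdot> flat2 X (Idt \<C> (fobj G (fobj G X)))"
      using flat2_fmap[of "Idt \<C> (fobj G (fobj G X))" f Y] that XY by simp
    show "l Y \<cdot> fmap G (fmap G f) = fmap G (fmap G f) \<cdot> l X"
      by (rule flat2_eqD[of Y]) (use that XY in \<open>simp_all add: mates mates_Idt flat2_fmap eq\<close>)
    show "b Y \<cdot> fmap G (fmap G f) = fmap G f \<cdot> b X"
      by (rule flat_eqD[of Y]) (use that XY in \<open>simp_all add: mates mates_Idt flat_fmap eq\<close>)
  qed
  have "l X \<cdot> l X = Idt \<C> (fobj G (fobj G X))" if X: "X \<in> Obj \<C>" for X
    by (rule flat2_eqD[of X]) (use X in \<open>simp_all add: mates mates_Idt axioms\<close>)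
  moreover have "fmap G (l X) \<cdot> (l (fobj G X) \<cdot> fmap G (l X)) = l (fobj G X) \<cdot> (fmap G (l X) \<cdot> l (fobj G X))"
    if X: "X \<in> Obj \<C>" for X
    by (rule flat3_eqD[of X]) (use X in \<open>simp_all add: mates mates_Idt axioms\<close>)
  moreover have "b X \<cdot> (Idt \<C> (fobj G (fobj G X)) \<oplus> l X) = Zero \<C> (fobj G (fobj G X)) (fobj G X)"
    if X: "X \<in> Obj \<C>" for X
  proof (rule flat_eqD[of X])
    let ?A = "fobj G (fobj G X)"
    have "flat X (b X \<cdot> (Idt \<C> ?A \<oplus> l X)) = flat2 X (Idt \<C> ?A) \<cdot> (u ?A \<oplus> \<gamma> ?A \<cdot> u ?A)"
      using X by (simp add: mates mates_Idt flat_Plus Comp_Plus)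
    then show "flat X (b X \<cdot> (Idt \<C> ?A \<oplus> l X)) = flat X (Zero \<C> ?A (fobj G X))"
      using X by (simp add: axioms flat_Zero)
  qed (use X in simp_all)
  moreover have "b X \<cdot> (b (fobj G X) \<cdot> (Idt \<C> (fobj G (fobj G (fobj G X))) \<oplus>
        fmap G (l X) \<cdot> l (fobj G X) \<oplus> l (fobj G X) \<cdot> fmap G (l X))) =
      Zero \<C> (fobj G (fobj G (fobj G X))) (fobj G X)" if X: "X \<in> Obj \<C>" for X
  proof (rule flat_eqD[of X])
    \<comment> \<open>The Jacobi sum transposes to the threefold counit \<open>?E\<close> after the
      Jacobi expression of the comonad at \<open>?A\<close>, which vanishes.\<close>
    let ?A = "fobj G (fobj G (fobj G X))"
    let ?E = "flat3 X (Idt \<C> ?A)"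
    have "flat X (b X \<cdot> (b (fobj G X) \<cdot> (Idt \<C> ?A \<oplus>
        fmap G (l X) \<cdot> l (fobj G X) \<oplus> l (fobj G X) \<cdot> fmap G (l X)))) =
      ?E \<cdot> ((Idt \<C> (fobj F (fobj F (fobj F ?A))) \<oplus> fmap F (\<gamma> ?A) \<cdot> \<gamma> (fobj F ?A) \<oplus>
        \<gamma> (fobj F ?A) \<cdot> fmap F (\<gamma> ?A)) \<cdot> (fmap F (u ?A) \<cdot> u ?A))"
      using X by (simp add: mates mates_Idt flat_Plus Comp_Plus)
    also have "\<dots> = flat X (Zero \<C> ?A (fobj G X))"
      using X by (simp only: axioms fobj_simps) (simp add: flat_Zero)
    finally show "flat X (b X \<cdot> (b (fobj G X) \<cdot> (Idt \<C> ?A \<oplus>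
        fmap G (l X) \<cdot> l (fobj G X) \<oplus> l (fobj G X) \<cdot> fmap G (l X)))) = 
       flat X (Zero \<C> ?A (fobj G X))" .
  qed (use X in simp_all)
  moreover have "l X \<cdot> fmap G (b X) = b (fobj G X) \<cdot> (fmap G (l X) \<cdot> l (fobj G X))"
    if X: "X \<in> Obj \<C>" for X
    by (rule flat2_eqD[of X]) (use X in \<open>simp_all add: mates mates_Idt axioms\<close>)
  moreover have "additive_endofunctor \<C> \<lparr>fobj = fobj G, fmap = fmap G, twist = l, bracket = b\<rparr>"
    using G_additive by (simp add: additive_endofunctor_def endofunctor_def)
  ultimately show ?thesis
    by (simp add: lie_monad_def nat_transf_def fcomp_def Let_def whisker_left_def whisker_right_def
        l_nat b_nat)
qed

text \<open>The same reversal for the other variance. Since \<open>u\<close> introduces one more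
  \<open>G\<close>, transposing \<open>u X \<cdot> h\<close> takes one transposition more than
  transposing \<open>h\<close>, and \<open>b\<close> makes up for it.\<close>

lemma right_adjoint_of_lie_monad:
  assumes M: "lie_monad \<C> \<lparr>fobj = fobj F, fmap = fmap F, twist = l, bracket = b\<rparr>"
    and \<gamma>: "\<And>X. X \<in> Obj \<C> \<Longrightarrow> \<gamma> X \<in> Hom \<C> (fobj G (fobj G X)) (fobj G (fobj G X))"
    and \<gamma>_mate: "\<And>X h. \<lbrakk>X \<in> Obj \<C>; h \<in> Arr \<C>; Cod \<C> h = fobj G (fobj G X)\<rbrakk>
      \<Longrightarrow> flat2 X (\<gamma> X \<cdot> h) = flat2 X h \<cdot> l (Dom \<C> h)"
    and u: "\<And>X. X \<in> Obj \<C> \<Longrightarrow> u X \<in> Hom \<C> (fobj G X) (fobj G (fobj G X))"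
    and u_mate: "\<And>X h. \<lbrakk>X \<in> Obj \<C>; h \<in> Arr \<C>; Cod \<C> h = fobj G X\<rbrakk>
      \<Longrightarrow> flat2 X (u X \<cdot> h) = flat X h \<cdot> b (Dom \<C> h)"
  shows "lie_comonad \<C> \<lparr>fobj = fobj G, fmap = fmap G, cotwist = \<gamma>, cobracket = u\<rparr>"
proof -
  have nat: "nat_transf \<C> (fcomp F F) (fcomp F F) l" "nat_transf \<C> (fcomp F F) F b"
    using M by (simp_all add: lie_monad_def nat_transf_def fcomp_def)
  have l [simp]: "l A \<in> Arr \<C>" "Dom \<C> (l A) = fobj F (fobj F A)" "Cod \<C> (l A) = fobj F (fobj F A)"
    and b [simp]: "b A \<in> Arr \<C>" "Dom \<C> (b A) = fobj F (fobj F A)" "Cod \<C> (b A) = fobj F A"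
    if "A \<in> Obj \<C>" for A
    using nat that by (simp_all add: nat_transf_def fcomp_def)
  have axioms:
    "l A \<cdot> l A = Idt \<C> (fobj F (fobj F A))"
    "fmap F (l A) \<cdot> (l (fobj F A) \<cdot> fmap F (l A)) = l (fobj F A) \<cdot> (fmap F (l A) \<cdot> l (fobj F A))"
    "b A \<cdot> (Idt \<C> (fobj F (fobj F A)) \<oplus> l A) = Zero \<C> (fobj F (fobj F A)) (fobj F A)"
    "b A \<cdot> (b (fobj F A) \<cdot> (Idt \<C> (fobj F (fobj F (fobj F A))) \<oplus> fmap F (l A) \<cdot> l (fobj F A) \<oplus>
      l (fobj F A) \<cdot> fmap F (l A))) = Zero \<C> (fobj F (fobj F (fobj F A))) (fobj F A)"
    "l A \<cdot> fmap F (b A) = b (fobj F A) \<cdot> (fmap F (l A) \<cdot> l (fobj F A))"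
    if "A \<in> Obj \<C>" for A
    using M that by (simp_all add: lie_monad_def Let_def whisker_left_def whisker_right_def)
  have \<gamma>' [simp]: "\<gamma> X \<in> Arr \<C>" "Dom \<C> (\<gamma> X) = fobj G (fobj G X)" "Cod \<C> (\<gamma> X) = fobj G (fobj G X)"
    and u' [simp]: "u X \<in> Arr \<C>" "Dom \<C> (u X) = fobj G X" "Cod \<C> (u X) = fobj G (fobj G X)"
    if "X \<in> Obj \<C>" for X
    using \<gamma>[OF that] u[OF that] by auto
  have \<gamma>G: "flat3 X (\<gamma> (fobj G X) \<cdot> h) = flat3 X h \<cdot> fmap F (l (Dom \<C> h))"
    and G\<gamma>: "flat3 X (fmap G (\<gamma> X) \<cdot> h) = flat3 X h \<cdot> l (fobj F (Dom \<C> h))"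
    if "X \<in> Obj \<C>" "h \<in> Arr \<C>" "Cod \<C> h = fobj G (fobj G (fobj G X))" for X h
  proof -
    show "flat3 X (\<gamma> (fobj G X) \<cdot> h) = flat3 X h \<cdot> fmap F (l (Dom \<C> h))"
      using that by (simp add: flat3_def \<gamma>_mate flat_Comp)
    show "flat3 X (fmap G (\<gamma> X) \<cdot> h) = flat3 X h \<cdot> l (fobj F (Dom \<C> h))"
      using that by (simp add: flat_flat3 \<gamma>_mate flat_fmap)
  qed
  have uG: "flat3 X (u (fobj G X) \<cdot> h) = flat2 X h \<cdot> fmap F (b (Dom \<C> h))"
    and Gu: "flat3 X (fmap G (u X) \<cdot> h) = flat2 X h \<cdot> b (fobj F (Dom \<C> h))"
    if "X \<in> Obj \<C>" "h \<in> Arr \<C>" "Cod \<C> h = fobj G (fobj G X)" for X h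
  proof -
    show "flat3 X (u (fobj G X) \<cdot> h) = flat2 X h \<cdot> fmap F (b (Dom \<C> h))"
      using that by (simp add: flat3_def u_mate flat_Comp flat2_def[of X])
    show "flat3 X (fmap G (u X) \<cdot> h) = flat2 X h \<cdot> b (fobj F (Dom \<C> h))"
      using that by (simp add: flat_flat3 flat_fmap u_mate) (simp add: flat2_def)
  qed
  note mates = \<gamma>_mate u_mate \<gamma>G G\<gamma> uG Gu
  have mates_Idt:
      "flat2 X (\<gamma> X) = flat2 X (Idt \<C> (fobj G (fobj G X))) \<cdot> l (fobj G (fobj G X))"
      "flat2 X (u X) = flat X (Idt \<C> (fobj G X)) \<cdot> b (fobj G X)"
      "flat3 X (fmap G (u X)) = flat2 X (Idt \<C> (fobj G (fobj G X))) \<cdot> b (fobj F (fobj G (fobj G X)))"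
      "flat3 X (\<gamma> (fobj G X)) = flat3 X (Idt \<C> (fobj G (fobj G (fobj G X)))) \<cdot> fmap F (l (fobj G (fobj G (fobj G X))))"
      "flat3 X (fmap G (\<gamma> X)) = flat3 X (Idt \<C> (fobj G (fobj G (fobj G X)))) \<cdot> l (fobj F (fobj G (fobj G (fobj G X))))"
    if "X \<in> Obj \<C>" for X
    using that mates[of X "Idt \<C> (fobj G X)"] mates[of X "Idt \<C> (fobj G (fobj G X))"]
      mates[of X "Idt \<C> (fobj G (fobj G (fobj G X)))"] by simp_all
  have \<gamma>_nat: "\<gamma> Y \<cdot> fmap G (fmap G f) = fmap G (fmap G f) \<cdot> \<gamma> X"
    and u_nat: "u Y \<cdot> fmap G f = fmap G (fmap G f) \<cdot> u X"
    if "f \<in> Arr \<C>" "Dom \<C> f = X" "Cod \<C> f = Y" for f X Y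
  proof -
    have XY: "X \<in> Obj \<C>" "Y \<in> Obj \<C>" using that by auto
    have eq: "flat2 Y (fmap G (fmap G f)) = f \<cdot> flat2 X (Idt \<C> (fobj G (fobj G X)))"
      "flat Y (fmap G f) = f \<cdot> flat X (Idt \<C> (fobj G X))"
      using flat2_fmap[of "Idt \<C> (fobj G (fobj G X))" f Y] flat_fmap[of "Idt \<C> (fobj G X)" f Y] that XY
      by simp_all
    show "\<gamma> Y \<cdot> fmap G (fmap G f) = fmap G (fmap G f) \<cdot> \<gamma> X"
      by (rule flat2_eqD[of Y]) (use that XY in \<open>simp_all add: mates mates_Idt flat2_fmap eq\<close>)
    show "u Y \<cdot> fmap G f = fmap G (fmap G f) \<cdot> u X"
      by (rule flat2_eqD[of Y]) (use that XY in \<open>simp_all add: mates mates_Idt flat2_fmap eq\<close>)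
  qed
  have "\<gamma> X \<cdot> \<gamma> X = Idt \<C> (fobj G (fobj G X))" if X: "X \<in> Obj \<C>" for X
    by (rule flat2_eqD[of X]) (use X in \<open>simp_all add: mates mates_Idt axioms\<close>)
  moreover have "fmap G (\<gamma> X) \<cdot> (\<gamma> (fobj G X) \<cdot> fmap G (\<gamma> X)) = \<gamma> (fobj G X) \<cdot> (fmap G (\<gamma> X) \<cdot> \<gamma> (fobj G X))"
    if X: "X \<in> Obj \<C>" for X
    by (rule flat3_eqD[of X]) (use X in \<open>simp_all add: mates mates_Idt axioms\<close>)
  moreover have "u X \<oplus> \<gamma> X \<cdot> u X = Zero \<C> (fobj G X) (fobj G (fobj G X))"
    if X: "X \<in> Obj \<C>" for X
  proof (rule flat2_eqD[of X])
    have "flat2 X (u X \<oplus> \<gamma> X \<cdot> u X) =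
      flat X (Idt \<C> (fobj G X)) \<cdot> (b (fobj G X) \<cdot> (Idt \<C> (fobj F (fobj F (fobj G X))) \<oplus> l (fobj G X)))"
      using X by (simp add: mates mates_Idt flat2_Plus Comp_Plus)
    then show "flat2 X (u X \<oplus> \<gamma> X \<cdot> u X) = flat2 X (Zero \<C> (fobj G X) (fobj G (fobj G X)))"
      using X by (simp add: axioms flat2_def flat_Zero)
  qed (use X in simp_all)
  moreover have "(Idt \<C> (fobj G (fobj G (fobj G X))) \<oplus> fmap G (\<gamma> X) \<cdot> \<gamma> (fobj G X) \<oplus>
      \<gamma> (fobj G X) \<cdot> fmap G (\<gamma> X)) \<cdot> (fmap G (u X) \<cdot> u X) =
      Zero \<C> (fobj G X) (fobj G (fobj G (fobj G X)))" if X: "X \<in> Obj \<C>" for X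
  proof (rule flat3_eqD[of X])
    let ?A = "fobj G X"
    let ?S = "Idt \<C> (fobj F (fobj F (fobj F ?A))) \<oplus> fmap F (l ?A) \<cdot> l (fobj F ?A) \<oplus>
        l (fobj F ?A) \<cdot> fmap F (l ?A)"
    have "flat3 X ((Idt \<C> (fobj G (fobj G (fobj G X))) \<oplus> fmap G (\<gamma> X) \<cdot> \<gamma> (fobj G X) \<oplus>
      \<gamma> (fobj G X) \<cdot> fmap G (\<gamma> X)) \<cdot> (fmap G (u X) \<cdot> u X)) =
      flat X (Idt \<C> ?A) \<cdot> (b ?A \<cdot> (b (fobj F ?A) \<cdot> ?S))"
      using X by (simp add: mates mates_Idt flat3_Plus Comp_Plus)
    also have "\<dots> = flat3 X (Zero \<C> (fobj G X) (fobj G (fobj G (fobj G X))))"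
      using X by (simp only: axioms fobj_simps) (simp add: flat3_def flat2_def flat_Zero)
    finally show "flat3 X ((Idt \<C> (fobj G (fobj G (fobj G X))) \<oplus> fmap G (\<gamma> X) \<cdot> \<gamma> (fobj G X) \<oplus>
      \<gamma> (fobj G X) \<cdot> fmap G (\<gamma> X)) \<cdot> (fmap G (u X) \<cdot> u X)) = 
      flat3 X (Zero \<C> (fobj G X) (fobj G (fobj G (fobj G X))))" .
  qed (use X in simp_all)
  moreover have "u (fobj G X) \<cdot> \<gamma> X = fmap G (\<gamma> X) \<cdot> (\<gamma> (fobj G X) \<cdot> fmap G (u X))"
    if X: "X \<in> Obj \<C>" for X
    by (rule flat3_eqD[of X]) (use X in \<open>simp_all add: mates mates_Idt axioms\<close>)
  moreover have "additive_endofunctor \<C> \<lparr>fobj = fobj G, fmap = fmap G, cotwist = \<gamma>, cobracket = u\<rparr>"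
    using G_additive by (simp add: additive_endofunctor_def endofunctor_def)
  ultimately show ?thesis
    by (simp add: lie_comonad_def nat_transf_def fcomp_def Let_def whisker_left_def whisker_right_def
        \<gamma>_nat u_nat)
qed

end

section \<open>The internal hom functors\<close>

lemma tensor_functor_simps [simp]:
  "fobj (tensor_right \<C> X) A = A \<otimes>\<^sub>o\<^bsub>\<C>\<^esub> X" "fmap (tensor_right \<C> X) f = f \<otimes>\<^sub>a\<^bsub>\<C>\<^esub> Idt \<C> X"
  "fobj (tensor_left \<C> X) A = X \<otimes>\<^sub>o\<^bsub>\<C>\<^esub> A" "fmap (tensor_left \<C> X) f = Idt \<C> X \<otimes>\<^sub>a\<^bsub>\<C>\<^esub> f"
  by (simp_all add: tensor_right_def tensor_left_def)

context additive_strict_monoidal_category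
begin

lemma tensor_right_additive: "X \<in> Obj \<C> \<Longrightarrow> additive_endofunctor \<C> (tensor_right \<C> X)"
  by (simp add: additive_endofunctor_def endofunctor_def TensArr_Idt interchange TensArr_Plus)

lemma whisker_Comp:
  assumes "X \<in> Obj \<C>" "f \<in> Arr \<C>" "g \<in> Arr \<C>" "Dom \<C> g = Cod \<C> f"
  shows "(Idt \<C> X \<otimes>\<^sub>a g) \<cdot> (Idt \<C> X \<otimes>\<^sub>a f) = Idt \<C> X \<otimes>\<^sub>a (g \<cdot> f)"
    "(g \<otimes>\<^sub>a Idt \<C> X) \<cdot> (f \<otimes>\<^sub>a Idt \<C> X) = (g \<cdot> f) \<otimes>\<^sub>a Idt \<C> X"
  using assms by (simp_all add: interchange)

text \<open>Passing from one factorisation to the other commutes morphisms that act on different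
  tensor factors.\<close>

lemma whisker_exchange:
  assumes "f \<in> Arr \<C>" "g \<in> Arr \<C>"
  shows "Dom \<C> f = A \<Longrightarrow> Cod \<C> g = D \<Longrightarrow> (f \<otimes>\<^sub>a Idt \<C> D) \<cdot> (Idt \<C> A \<otimes>\<^sub>a g) = f \<otimes>\<^sub>a g"
    "Cod \<C> f = B \<Longrightarrow> Dom \<C> g = E \<Longrightarrow> (Idt \<C> B \<otimes>\<^sub>a g) \<cdot> (f \<otimes>\<^sub>a Idt \<C> E) = f \<otimes>\<^sub>a g"
  using assms by (auto simp: interchange)

end

section \<open>The tensor-hom adjunction for a fixed exponent \<open>W\<close>\<close>

locale right_hom = additive_closed_strict_monoidal_category \<C>
  for \<C> :: "('o, 'a, 'x) closed_category_data_scheme" (structure) +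
  fixes W :: 'o
  assumes W [simp]: "W \<in> Obj \<C>"

sublocale right_hom \<subseteq> additive_adjunction \<C> "tensor_right \<C> W" "RHom \<C> W" "RCur \<C> W"
  by unfold_locales (simp_all add: right_closed tensor_right_additive)

context additive_closed_strict_monoidal_category
begin

lemma right_hom: "W \<in> Obj \<C> \<Longrightarrow> right_hom \<C> W"
  by unfold_locales

text \<open>A form of \<open>flat\<close> with the exponent as an argument: the contravariant action
  and \<open>RPi\<close> relate transposes for different exponents.\<close>

abbreviation uncur :: "'o \<Rightarrow> 'o \<Rightarrow> 'a \<Rightarrow> 'a" where
  "uncur X \<equiv> additive_adjunction.flat \<C> (tensor_right \<C> X) (RHom \<C> X) (RCur \<C> X)"

lemma RContra_flat:
  assumes f: "f \<in> Arr \<C>" and Y: "Y \<in> Obj \<C>"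
  shows "RContra \<C> f Y \<in> Hom \<C> (fobj (RHom \<C> (Cod \<C> f)) Y) (fobj (RHom \<C> (Dom \<C> f)) Y)"
    and "uncur (Dom \<C> f) Y (RContra \<C> f Y) =
      REval \<C> (Cod \<C> f) Y \<cdot> (Idt \<C> (fobj (RHom \<C> (Cod \<C> f)) Y) \<otimes>\<^sub>a f)"
proof -
  interpret V: right_hom \<C> "Dom \<C> f" using f by (intro right_hom) simp
  interpret W: right_hom \<C> "Cod \<C> f" using f by (intro right_hom) simp
  let ?B = "fobj (RHom \<C> (Cod \<C> f)) Y"
  have eval: "REval \<C> (Cod \<C> f) Y = W.counit Y"
    by (simp add: REval_def W.counit_def)
  have B: "?B \<in> Obj \<C>" using Y by simp
  have C: "RContra \<C> f Y = RCur \<C> (Dom \<C> f) ?B Y (W.counit Y \<cdot> (Idt \<C> ?B \<otimes>\<^sub>a f))"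
    by (simp add: RContra_def Let_def eval)
  show "RContra \<C> f Y \<in> Hom \<C> ?B (fobj (RHom \<C> (Dom \<C> f)) Y)"
    using f Y B unfolding C by simp
  show "V.flat Y (RContra \<C> f Y) = REval \<C> (Cod \<C> f) Y \<cdot> (Idt \<C> ?B \<otimes>\<^sub>a f)"
    unfolding C eval using f Y B by (subst V.flat_phi) simp_all
qed

text \<open>\<open>H(f, Y)\<close> is the transpose of evaluation after
  \<open>H(W, Y) \<otimes> f\<close>. By interchange \<open>f\<close> moves past \<open>h\<close>,
  so on transposes the contravariant action is precomposition with \<open>f\<close>.\<close>

lemma RContra_mate:
  assumes f: "f \<in> Hom \<C> V W" and Y: "Y \<in> Obj \<C>"
    and h: "h \<in> Arr \<C>" "Cod \<C> h = fobj (RHom \<C> W) Y"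
  shows "uncur V Y (RContra \<C> f Y \<cdot> h) = uncur W Y h \<cdot> (Idt \<C> (Dom \<C> h) \<otimes>\<^sub>a f)"
proof -
  have f': "f \<in> Arr \<C>" "Dom \<C> f = V" "Cod \<C> f = W" using f by simp_all
  interpret V: right_hom \<C> V using f' by (intro right_hom) auto
  interpret W: right_hom \<C> W using f' by (intro right_hom) auto
  let ?B = "fobj (RHom \<C> W) Y"
  have eval: "REval \<C> W Y = W.counit Y"
    by (simp add: REval_def W.counit_def)
  have B: "?B \<in> Obj \<C>" using Y by simp
  note contra = RContra_flat[OF f'(1) Y, unfolded f'(2,3) eval]
  have "V.flat Y (RContra \<C> f Y \<cdot> h) = W.counit Y \<cdot> ((Idt \<C> ?B \<otimes>\<^sub>a f) \<cdot> (h \<otimes>\<^sub>a Idt \<C> V))"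
    using f' Y h B contra by (simp add: V.flat_Comp)
  also have "(Idt \<C> ?B \<otimes>\<^sub>a f) \<cdot> (h \<otimes>\<^sub>a Idt \<C> V) = (h \<otimes>\<^sub>a Idt \<C> W) \<cdot> (Idt \<C> (Dom \<C> h) \<otimes>\<^sub>a f)"
    using f' h by (simp add: whisker_exchange)
  finally show "V.flat Y (RContra \<C> f Y \<cdot> h) = W.flat Y h \<cdot> (Idt \<C> (Dom \<C> h) \<otimes>\<^sub>a f)"
    using f' h Y by (simp add: W.flat_def)
qed

text \<open>The transposes \<open>P\<close> and \<open>Q\<close> start at \<open>X\<close> alone and
  agree on all morphisms from \<open>I\<close> to \<open>X\<close>. By the universal property of the
  copower they agree after the coequalizer \<open>e\<close>, and \<open>e\<close> is epic.\<close>

lemma generator_jointly_epi: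
  assumes gen: "regular_generator \<C> (UnitObj \<C>)" and [simp]: "X \<in> Obj \<C>" "Z \<in> Obj \<C>"
    and p: "p \<in> Arr \<C>" "Dom \<C> p = X \<otimes>\<^sub>o Z" "Cod \<C> p = Y"
    and q: "q \<in> Arr \<C>" "Dom \<C> q = X \<otimes>\<^sub>o Z" "Cod \<C> q = Y"
    and eq: "\<And>f. \<lbrakk>f \<in> Arr \<C>; Dom \<C> f = UnitObj \<C>; Cod \<C> f = X\<rbrakk>
      \<Longrightarrow> p \<cdot> (f \<otimes>\<^sub>a Idt \<C> Z) = q \<cdot> (f \<otimes>\<^sub>a Idt \<C> Z)"
  shows "p = q"
proof -
  interpret Z: right_hom \<C> Z by (intro right_hom) simp
  let ?I = "UnitObj \<C>"
  have Y [simp]: "Y \<in> Obj \<C>" using p by auto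
  obtain H \<iota> e K a b where copower: "is_copower \<C> (Hom \<C> ?I X) ?I H \<iota>"
    and e: "e \<in> Hom \<C> H X" "\<forall>f\<in>Hom \<C> ?I X. e \<cdot> \<iota> f = f"
    and coeq: "is_coequalizer \<C> K H X a b e"
    using gen unfolding regular_generator_def by (meson assms(2))
  define P where "P = RCur \<C> Z X Y p"
  define Q where "Q = RCur \<C> Z X Y q"
  have P: "P \<in> Arr \<C>" "Dom \<C> P = X" "Cod \<C> P = fobj (RHom \<C> Z) Y"
    and Q: "Q \<in> Arr \<C>" "Dom \<C> Q = X" "Cod \<C> Q = fobj (RHom \<C> Z) Y"
    using p q by (simp_all add: P_def Q_def)
  have flat: "Z.flat Y P = p" "Z.flat Y Q = q"
    using p q by (simp_all add: P_def Q_def)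
  have PQ: "P \<cdot> f = Q \<cdot> f" if f: "f \<in> Hom \<C> ?I X" for f
  proof (rule Z.flat_eqD[of Y])
    show "Z.flat Y (P \<cdot> f) = Z.flat Y (Q \<cdot> f)"
      using f P Q eq[of f] by (simp add: Z.flat_Comp flat)
  qed (use f P Q in simp_all)
  have e': "e \<in> Arr \<C>" "Dom \<C> e = H" "Cod \<C> e = X"
    using e by auto
  have \<iota>: "\<iota> f \<in> Arr \<C>" "Dom \<C> (\<iota> f) = ?I" "Cod \<C> (\<iota> f) = H" if "f \<in> Hom \<C> ?I X" for f
    using copower that by (auto simp: is_copower_def)
  \<comment> \<open>Both composites restrict to one family on the copower; uniqueness of the induced
    morphism gives \<open>Pe\<close>.\<close>
  have "(P \<cdot> e) \<cdot> \<iota> f = P \<cdot> f" "(Q \<cdot> e) \<cdot> \<iota> f = P \<cdot> f" if f: "f \<in> Hom \<C> ?I X" for f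
    using PQ[OF f] \<iota>[OF f] e(2) e' P Q f by simp_all
  moreover have "\<exists>!v. v \<in> Hom \<C> H (fobj (RHom \<C> Z) Y) \<and> (\<forall>f\<in>Hom \<C> ?I X. v \<cdot> \<iota> f = P \<cdot> f)"
  proof -
    have "\<forall>f\<in>Hom \<C> ?I X. P \<cdot> f \<in> Hom \<C> ?I (fobj (RHom \<C> Z) Y)"
      using P by simp
    moreover have "fobj (RHom \<C> Z) Y \<in> Obj \<C>" by simp
    ultimately show ?thesis
      using copower unfolding is_copower_def by blast
  qed
  moreover have "P \<cdot> e \<in> Hom \<C> H (fobj (RHom \<C> Z) Y)" "Q \<cdot> e \<in> Hom \<C> H (fobj (RHom \<C> Z) Y)"
    using P Q e' by simp_all
  ultimately have Pe: "P \<cdot> e = Q \<cdot> e"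
    by blast
  have ab: "a \<in> Hom \<C> K H" "b \<in> Hom \<C> K H" "e \<cdot> a = e \<cdot> b"
    using coeq by (simp_all only: is_coequalizer_def)
  have "(P \<cdot> e) \<cdot> a = (P \<cdot> e) \<cdot> b"
    using ab P e' by simp
  moreover have "P \<cdot> e \<in> Hom \<C> H (fobj (RHom \<C> Z) Y)"
    using P e' by simp
  moreover have "fobj (RHom \<C> Z) Y \<in> Obj \<C>" by simp
  \<comment> \<open>Both \<open>P\<close> and \<open>Q\<close> factor \<open>P \<cdot> e\<close>
    through the coequalizer, hence they are equal.\<close>
  ultimately have "\<exists>!v. v \<in> Hom \<C> X (fobj (RHom \<C> Z) Y) \<and> v \<cdot> e = P \<cdot> e"
    using coeq unfolding is_coequalizer_def by blast
  then have "P = Q"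
    using P Q Pe by auto
  then show "p = q"
    using flat by simp
qed

end

section \<open>The canonical isomorphism \<open>RPi\<close> in terms of transposes\<close>

context right_hom
begin

text \<open>The last two clauses carry the content: \<open>RPi\<close> identifies one transposition
  along \<open>W \<otimes> W\<close> with two along \<open>W\<close>, so it never has to be unfolded
  again.\<close>

lemma RPi_props:
  assumes [simp]: "X \<in> Obj \<C>"
  shows "RPi \<C> W W X \<in> Hom \<C> (fobj (RHom \<C> (W \<otimes>\<^sub>o W)) X) (fobj (RHom \<C> W) (fobj (RHom \<C> W) X))"
    and "inv_arr \<C> (RPi \<C> W W X) \<in>
      Hom \<C> (fobj (RHom \<C> W) (fobj (RHom \<C> W) X)) (fobj (RHom \<C> (W \<otimes>\<^sub>o W)) X)"
    and "\<lbrakk>h \<in> Arr \<C>; Cod \<C> h = fobj (RHom \<C> (W \<otimes>\<^sub>o W)) X\<rbrakk>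
      \<Longrightarrow> flat2 X (RPi \<C> W W X \<cdot> h) = uncur (W \<otimes>\<^sub>o W) X h"
    and "\<lbrakk>h \<in> Arr \<C>; Cod \<C> h = fobj (RHom \<C> W) (fobj (RHom \<C> W) X)\<rbrakk>
      \<Longrightarrow> uncur (W \<otimes>\<^sub>o W) X (inv_arr \<C> (RPi \<C> W W X) \<cdot> h) = flat2 X h"
proof -
  interpret WW: right_hom \<C> "W \<otimes>\<^sub>o W" by (intro right_hom) simp
  let ?A = "fobj (RHom \<C> (W \<otimes>\<^sub>o W)) X"
  let ?GG = "fobj (RHom \<C> W) (fobj (RHom \<C> W) X)"
  have A [simp]: "?A \<in> Obj \<C>" by simp
  have Pi: "RPi \<C> W W X = RCur \<C> W ?A (fobj (RHom \<C> W) X) (RCur \<C> W (?A \<otimes>\<^sub>o W) X (WW.counit X))"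
    by (simp add: RPi_def Let_def REval_def WW.counit_def)
  show Pi_Hom: "RPi \<C> W W X \<in> Hom \<C> ?A ?GG"
    unfolding Pi by simp
  have flat2_Pi: "flat2 X (RPi \<C> W W X) = WW.counit X"
    unfolding Pi flat2_def by simp
  show flat2_Pi_Comp: "flat2 X (RPi \<C> W W X \<cdot> h) = WW.flat X h" if "h \<in> Arr \<C>" "Cod \<C> h = ?A" for h
    using that Pi_Hom by (simp add: flat2_Comp flat2_Pi WW.flat_def Idt_TensObj)
  \<comment> \<open>The inverse is the morphism whose single transpose along
    \<open>W \<otimes> W\<close> is the twofold counit along \<open>W\<close>.\<close>
  define J where "J = RCur \<C> (W \<otimes>\<^sub>o W) ?GG X (flat2 X (Idt \<C> ?GG))"
  have J: "J \<in> Arr \<C>" "Dom \<C> J = ?GG" "Cod \<C> J = ?A"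
    by (simp_all add: J_def)
  have flat_J: "WW.flat X J = flat2 X (Idt \<C> ?GG)"
    unfolding J_def by (rule WW.flat_phi) simp_all
  have flat_J_Comp: "WW.flat X (J \<cdot> h) = flat2 X h" if "h \<in> Arr \<C>" "Cod \<C> h = ?GG" for h
  proof -
    have "WW.flat X (J \<cdot> h) = flat2 X (Idt \<C> ?GG) \<cdot> (h \<otimes>\<^sub>a Idt \<C> (W \<otimes>\<^sub>o W))"
      using that J by (simp add: WW.flat_Comp flat_J)
    also have "\<dots> = flat2 X (Idt \<C> ?GG \<cdot> h)"
      using that by (subst flat2_Comp) (simp_all add: Idt_TensObj)
    finally show ?thesis using that by simp
  qed
  have "J \<cdot> RPi \<C> W W X = Idt \<C> ?A"
  proof (rule WW.flat_eqD[of X])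
    show "WW.flat X (J \<cdot> RPi \<C> W W X) = WW.flat X (Idt \<C> ?A)"
      using Pi_Hom by (simp add: flat_J_Comp flat2_Pi) (simp add: WW.flat_def TensArr_Idt)
  qed (use J Pi_Hom in simp_all)
  moreover have "RPi \<C> W W X \<cdot> J = Idt \<C> ?GG"
  proof (rule flat2_eqD[of X])
    show "flat2 X (RPi \<C> W W X \<cdot> J) = flat2 X (Idt \<C> ?GG)"
      using J by (simp add: flat2_Pi_Comp flat_J)
  qed (use J Pi_Hom in simp_all)
  ultimately have inv: "inv_arr \<C> (RPi \<C> W W X) = J"
    using J Pi_Hom by (intro inv_arr_eqI) simp_all
  show "inv_arr \<C> (RPi \<C> W W X) \<in> Hom \<C> ?GG ?A"
    using J by (simp add: inv)
  show "WW.flat X (inv_arr \<C> (RPi \<C> W W X) \<cdot> h) = flat2 X h" if "h \<in> Arr \<C>" "Cod \<C> h = ?GG"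
    using that by (simp add: inv flat_J_Comp)
qed

end

section \<open>Reversal of the tensor product\<close>

text \<open>Swapping the hom data together with the tensor product makes this an involution and
  turns results about \<open>H(W,-)\<close> into results about \<open>H'(W,-)\<close>.\<close>

definition reverse ::
    "('o, 'a, 'x) closed_category_data_scheme \<Rightarrow> ('o, 'a, 'x) closed_category_data_scheme" where
  "reverse \<C> = \<C>\<lparr>TensObj := \<lambda>A B. TensObj \<C> B A, TensArr := \<lambda>f g. TensArr \<C> g f,
     RHom := LHom \<C>, RCur := LCur \<C>, LHom := RHom \<C>, LCur := RCur \<C>\<rparr>"

lemma reverse_simps [simp]:
  "Obj (reverse \<C>) = Obj \<C>" "Arr (reverse \<C>) = Arr \<C>" "Dom (reverse \<C>) = Dom \<C>"
  "Cod (reverse \<C>) = Cod \<C>" "Idt (reverse \<C>) = Idt \<C>" "Comp (reverse \<C>) = Comp \<C>"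
  "Plus (reverse \<C>) = Plus \<C>" "Zero (reverse \<C>) = Zero \<C>" "UnitObj (reverse \<C>) = UnitObj \<C>"
  "TensObj (reverse \<C>) = (\<lambda>A B. TensObj \<C> B A)" "TensArr (reverse \<C>) = (\<lambda>f g. TensArr \<C> g f)"
  "RHom (reverse \<C>) = LHom \<C>" "RCur (reverse \<C>) = LCur \<C>"
  "LHom (reverse \<C>) = RHom \<C>" "LCur (reverse \<C>) = RCur \<C>"
  by (simp_all add: reverse_def)

lemma reverse_reverse [simp]: "reverse (reverse \<C>) = \<C>"
  by (simp add: reverse_def)

lemma reverse_tensor [simp]:
  "tensor_right (reverse \<C>) = tensor_left \<C>" "tensor_left (reverse \<C>) = tensor_right \<C>"
  by (simp_all add: fun_eq_iff tensor_right_def tensor_left_def)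

lemma reverse_Hom [simp]: "Hom (reverse \<C>) = Hom \<C>"
  by (simp add: fun_eq_iff Hom_def)

text \<open>None of these notions refers to the tensor product or to internal homs.\<close>

lemma reverse_additive_notions:
  "adjunction (reverse \<C>) F G = adjunction \<C> F G"
  "nat_transf (reverse \<C>) F G = nat_transf \<C> F G"
  "inv_arr (reverse \<C>) = inv_arr \<C>"
  "lie_comonad (reverse \<C>) = lie_comonad \<C>"
  "regular_generator (reverse \<C>) = regular_generator \<C>"
  by (simp_all add: fun_eq_iff adjunction_def endofunctor_def nat_transf_def inv_arr_def
      lie_comonad_def additive_endofunctor_def is_copower_def is_coequalizer_def regular_generator_def)

lemma reverse_LieComonadHom: "LieComonadHom (reverse \<C>) = LieComonadHom \<C>"
  by (simp add: fun_eq_iff LieComonadHom_def hsquare_def reverse_additive_notions)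

text \<open>The axioms of a strict tensor product are stable under reading from right to left; the
  two closedness axioms are interchanged.\<close>

lemma (in additive_closed_strict_monoidal_category) closed_reverse:
  "additive_closed_strict_monoidal_category (reverse \<C>)"
proof -
  have "category (reverse \<C>)"
    using category_axioms unfolding category_def by simp
  then have "additive_category (reverse \<C>)"
    using additive_category_axioms
    unfolding additive_category_def additive_category_axioms_def by simp
  moreover have "additive_strict_monoidal_category_axioms (reverse \<C>)"
    unfolding additive_strict_monoidal_category_axioms_def
    by (simp add: TensArr_Idt interchange TensArr_Plus)
  ultimately show ?thesis
    unfolding additive_closed_strict_monoidal_category_def
      additive_closed_strict_monoidal_category_axioms_def additive_strict_monoidal_category_def
    by (simp add: reverse_additive_notions left_closed right_closed)
qed

context additive_category
begin

text \<open>Passing to the reversed tensor product trades \<open>C \<otimes> \<Upsilon>\<close> for \<open>\<Upsilon> \<otimes> C\<close> and \<open>L \<otimes> \<Lambda>\<close> for \<open>\<Lambda> \<otimes> L\<close>: with \<open>G\<^sub>1\<close> and \<open>G\<^sub>2\<close>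
  the two extensions of the braiding, \<open>t = G\<^sub>1 G\<^sub>2\<close> and \<open>w = G\<^sub>2 G\<^sub>1\<close> satisfy \<open>t w = 1\<close>, \<open>w\<^sup>2 = t\<close>
  and \<open>t\<^sup>2 = w\<close>, so \<open>1 + t + w\<close> absorbs \<open>t\<close> and \<open>w\<close>.\<close>

lemma braid_relations:
  assumes G: "G1 \<in> Hom \<C> T T" "G2 \<in> Hom \<C> T T" "G1 \<cdot> G1 = Idt \<C> T" "G2 \<cdot> G2 = Idt \<C> T"
    and braid: "G1 \<cdot> (G2 \<cdot> G1) = G2 \<cdot> (G1 \<cdot> G2)"
  shows "G1 \<cdot> G2 \<cdot> (G2 \<cdot> G1) = Idt \<C> T" "G2 \<cdot> G1 \<cdot> (G1 \<cdot> G2) = Idt \<C> T"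
    "G2 \<cdot> G1 \<cdot> (G2 \<cdot> G1) = G1 \<cdot> G2" "G1 \<cdot> G2 \<cdot> (G1 \<cdot> G2) = G2 \<cdot> G1"
proof -
  have cancel: "G1 \<cdot> (G1 \<cdot> h) = h" "G2 \<cdot> (G2 \<cdot> h) = h" if "h \<in> Arr \<C>" "Cod \<C> h = T" for h
    using G that Comp_assoc'[of h G1 G1] Comp_assoc'[of h G2 G2] by simp_all
  show "G1 \<cdot> G2 \<cdot> (G2 \<cdot> G1) = Idt \<C> T" "G2 \<cdot> G1 \<cdot> (G1 \<cdot> G2) = Idt \<C> T"
    using G by (simp_all add: cancel)
  show "G2 \<cdot> G1 \<cdot> (G2 \<cdot> G1) = G1 \<cdot> G2"
    using G by (simp add: braid cancel)
  show "G1 \<cdot> G2 \<cdot> (G1 \<cdot> G2) = G2 \<cdot> G1"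
    using G by (simp add: braid[symmetric] cancel)
qed

text \<open>In the application \<open>G1\<close> is \<open>g \<otimes> C\<close>, \<open>G2\<close>
  is \<open>C \<otimes> g\<close>, \<open>U1\<close> is \<open>u \<otimes> C\<close> and
  \<open>U2\<close> is \<open>C \<otimes> u\<close>. With \<open>S\<close> the sum 1 + t + w,
  antisymmetry and absorption give S U1 u = - S U1 g u = - S w U2 u = - S U2 u = 0.\<close>

lemma coalgebra_flip:
  assumes G: "G1 \<in> Hom \<C> T T" "G2 \<in> Hom \<C> T T" "G1 \<cdot> G1 = Idt \<C> T" "G2 \<cdot> G2 = Idt \<C> T"
    "G1 \<cdot> (G2 \<cdot> G1) = G2 \<cdot> (G1 \<cdot> G2)"
    and g: "g \<in> Hom \<C> P P" "g \<cdot> g = Idt \<C> P"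
    and u: "u \<in> Hom \<C> C P" "u \<oplus> g \<cdot> u = Zero \<C> C P"
    and U: "U1 \<in> Hom \<C> P T" "U2 \<in> Hom \<C> P T"
    and jacobi: "(Idt \<C> T \<oplus> G2 \<cdot> G1 \<oplus> G1 \<cdot> G2) \<cdot> (U2 \<cdot> u) = Zero \<C> C T"
    and compat: "U1 \<cdot> g = G2 \<cdot> G1 \<cdot> U2"
  shows "(Idt \<C> T \<oplus> G1 \<cdot> G2 \<oplus> G2 \<cdot> G1) \<cdot> (U1 \<cdot> u) = Zero \<C> C T" "U2 \<cdot> g = G1 \<cdot> G2 \<cdot> U1"
proof -
  define t where "t = G1 \<cdot> G2"
  define w where "w = G2 \<cdot> G1"
  note rel = braid_relations[OF G, folded t_def w_def]
  have tw: "t \<in> Arr \<C>" "Dom \<C> t = T" "Cod \<C> t = T" "w \<in> Arr \<C>" "Dom \<C> w = T" "Cod \<C> w = T"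
    using G by (simp_all add: t_def w_def)
  have [simp]: "T \<in> Obj \<C>" "C \<in> Obj \<C>" "P \<in> Obj \<C>" using G u by auto
  \<comment> \<open>Insert the identity as \<open>t \<cdot> w\<close>, trade
    \<open>w \<cdot> U2\<close> for \<open>U1 \<cdot> g\<close> by compatibility, and cancel
    \<open>g \<cdot> g\<close>.\<close>
  have "U2 \<cdot> g = (t \<cdot> w) \<cdot> (U2 \<cdot> g)"
    using rel U g by simp
  also have "\<dots> = t \<cdot> ((w \<cdot> U2) \<cdot> g)"
    using tw U g by simp
  also have "\<dots> = t \<cdot> (U1 \<cdot> (g \<cdot> g))"
    using tw U g by (simp add: compat[folded w_def, symmetric])
  also have "\<dots> = t \<cdot> U1"
    using U g by simp
  finally show "U2 \<cdot> g = G1 \<cdot> G2 \<cdot> U1"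
    by (simp only: t_def)
  define S where "S = Idt \<C> T \<oplus> t \<oplus> w"
  have S: "S \<in> Arr \<C>" "Dom \<C> S = T" "Cod \<C> S = T"
    using tw by (simp_all add: S_def)
  have S_eq: "S = Idt \<C> T \<oplus> w \<oplus> t"
    using tw by (simp add: S_def Plus_assoc Plus_comm[of t w])
  have "S \<cdot> w = w \<oplus> (Idt \<C> T \<oplus> t)"
    using tw rel by (simp add: S_def Comp_Plus Plus_assoc)
  also have "\<dots> = S"
    using tw by (simp add: S_def Plus_comm[of w])
  finally have Sw: "S \<cdot> w = S" .
  have "S \<cdot> (U1 \<cdot> u) \<oplus> S \<cdot> (w \<cdot> U2 \<cdot> u) = S \<cdot> (U1 \<cdot> (u \<oplus> g \<cdot> u))"
    using S U u(1) g tw Comp_assoc'[of u g U1]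
    by (simp add: Comp_Plus compat[folded w_def])
  also have "\<dots> = Zero \<C> C T"
    using S U u by simp
  also have "S \<cdot> (w \<cdot> U2 \<cdot> u) = S \<cdot> w \<cdot> (U2 \<cdot> u)"
    using S U u tw by simp
  also have "\<dots> = Zero \<C> C T"
    unfolding Sw using jacobi by (simp only: S_eq t_def w_def)
  finally show "(Idt \<C> T \<oplus> G1 \<cdot> G2 \<oplus> G2 \<cdot> G1) \<cdot> (U1 \<cdot> u) = Zero \<C> C T"
    using S U u by (simp add: S_def t_def w_def)
qed

text \<open>The dual computation: b B1 S = - b l B1 S = - b B2 t S = - b B2 S = 0, with
  \<open>t\<close> now absorbed from the left of \<open>S\<close>.\<close>

lemma algebra_flip:
  assumes G: "G1 \<in> Hom \<C> T T" "G2 \<in> Hom \<C> T T" "G1 \<cdot> G1 = Idt \<C> T" "G2 \<cdot> G2 = Idt \<C> T"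
    "G1 \<cdot> (G2 \<cdot> G1) = G2 \<cdot> (G1 \<cdot> G2)"
    and l: "l \<in> Hom \<C> P P" "l \<cdot> l = Idt \<C> P"
    and b: "b \<in> Hom \<C> P L" "b \<cdot> (Idt \<C> P \<oplus> l) = Zero \<C> P L"
    and B: "B1 \<in> Hom \<C> T P" "B2 \<in> Hom \<C> T P"
    and jacobi: "b \<cdot> (B2 \<cdot> (Idt \<C> T \<oplus> G1 \<cdot> G2 \<oplus> G2 \<cdot> G1)) = Zero \<C> T L"
    and compat: "l \<cdot> B1 = B2 \<cdot> (G1 \<cdot> G2)"
  shows "b \<cdot> (B1 \<cdot> (Idt \<C> T \<oplus> G2 \<cdot> G1 \<oplus> G1 \<cdot> G2)) = Zero \<C> T L" "l \<cdot> B2 = B1 \<cdot> (G2 \<cdot> G1)"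
proof -
  define t where "t = G1 \<cdot> G2"
  define w where "w = G2 \<cdot> G1"
  note rel = braid_relations[OF G, folded t_def w_def]
  have tw: "t \<in> Arr \<C>" "Dom \<C> t = T" "Cod \<C> t = T" "w \<in> Arr \<C>" "Dom \<C> w = T" "Cod \<C> w = T"
    using G by (simp_all add: t_def w_def)
  have [simp]: "T \<in> Obj \<C>" "L \<in> Obj \<C>" "P \<in> Obj \<C>" using G b by auto
  have "l \<cdot> B2 = l \<cdot> ((B2 \<cdot> t) \<cdot> w)"
    using rel B l tw by simp
  also have "\<dots> = l \<cdot> l \<cdot> B1 \<cdot> w"
    using tw B l(1) by (simp add: compat[folded t_def, symmetric])
  also have "\<dots> = B1 \<cdot> w"
    using B l by simp
  finally show "l \<cdot> B2 = B1 \<cdot> (G2 \<cdot> G1)"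
    by (simp only: w_def)
  define S where "S = Idt \<C> T \<oplus> w \<oplus> t"
  have S: "S \<in> Arr \<C>" "Dom \<C> S = T" "Cod \<C> S = T"
    using tw by (simp_all add: S_def)
  have S_eq: "S = Idt \<C> T \<oplus> t \<oplus> w"
    using tw by (simp add: S_def Plus_assoc Plus_comm[of t w])
  have "t \<cdot> S = t \<oplus> (Idt \<C> T \<oplus> w)"
    using tw rel by (simp add: S_def Comp_Plus Plus_assoc)
  also have "\<dots> = S"
    using tw by (simp add: S_def Plus_comm[of t])
  finally have tS: "t \<cdot> S = S" .
  have "b \<cdot> (B1 \<cdot> S) \<oplus> b \<cdot> (B2 \<cdot> t \<cdot> S) = b \<cdot> (Idt \<C> P \<oplus> l) \<cdot> (B1 \<cdot> S)"
    using S B b(1) l tw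
    by (simp add: Comp_Plus compat[folded t_def, symmetric])
  also have "\<dots> = Zero \<C> T L"
    using S B b by simp
  also have "b \<cdot> (B2 \<cdot> t \<cdot> S) = b \<cdot> (B2 \<cdot> (t \<cdot> S))"
    using S B b(1) tw by simp
  also have "\<dots> = Zero \<C> T L"
    unfolding tS using jacobi by (simp only: S_eq t_def w_def)
  finally show "b \<cdot> (B1 \<cdot> (Idt \<C> T \<oplus> G2 \<cdot> G1 \<oplus> G1 \<cdot> G2)) = Zero \<C> T L"
    using S B b(1) by (simp add: S_def t_def w_def)
qed

end

section \<open>YB-Lie structures in the reversed category\<close>

context additive_closed_strict_monoidal_category
begin

text \<open>Reversal preserves the Yang-Baxter equation and antisymmetry; the Jacobi and
  compatibility axioms with \<open>u \<otimes> C\<close> in place of \<open>C \<otimes> u\<close>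
  come from \<open>coalgebra_flip\<close>.\<close>

lemma yb_lie_coalgebra_reverse:
  assumes "yb_lie_coalgebra \<C> C g u"
  shows "yb_lie_coalgebra (reverse \<C>) C g u"
proof -
  have C [simp]: "C \<in> Obj \<C>"
    and g: "g \<in> Hom \<C> (C \<otimes>\<^sub>o C) (C \<otimes>\<^sub>o C)" "g \<cdot> g = Idt \<C> (C \<otimes>\<^sub>o C)"
    and u: "u \<in> Hom \<C> C (C \<otimes>\<^sub>o C)" "u \<oplus> g \<cdot> u = Zero \<C> C (C \<otimes>\<^sub>o C)"
    using assms by (simp_all add: yb_lie_coalgebra_def symmetric_yb_operator_def)
  have ax: "(g \<otimes>\<^sub>a Idt \<C> C) \<cdot> (Idt \<C> C \<otimes>\<^sub>a g) \<cdot> (g \<otimes>\<^sub>a Idt \<C> C) =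
     (Idt \<C> C \<otimes>\<^sub>a g) \<cdot> (g \<otimes>\<^sub>a Idt \<C> C) \<cdot> (Idt \<C> C \<otimes>\<^sub>a g)"
    "(Idt \<C> (C \<otimes>\<^sub>o C \<otimes>\<^sub>o C) \<oplus> yb_w \<C> C g \<oplus> yb_t \<C> C g) \<cdot> (Idt \<C> C \<otimes>\<^sub>a u) \<cdot> u =
      Zero \<C> C (C \<otimes>\<^sub>o C \<otimes>\<^sub>o C)"
    "(u \<otimes>\<^sub>a Idt \<C> C) \<cdot> g = yb_w \<C> C g \<cdot> (Idt \<C> C \<otimes>\<^sub>a u)"
    using assms unfolding yb_lie_coalgebra_def symmetric_yb_operator_def by blast+
  note ax = ax[unfolded yb_w_def yb_t_def]
  let ?T = "C \<otimes>\<^sub>o (C \<otimes>\<^sub>o C)"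
  let ?G1 = "g \<otimes>\<^sub>a Idt \<C> C" and ?G2 = "Idt \<C> C \<otimes>\<^sub>a g"
  have G: "?G1 \<in> Hom \<C> ?T ?T" "?G2 \<in> Hom \<C> ?T ?T" "?G1 \<cdot> ?G1 = Idt \<C> ?T" "?G2 \<cdot> ?G2 = Idt \<C> ?T"
    using g by (simp_all add: whisker_Comp TensArr_Idt)
  have braid: "?G1 \<cdot> (?G2 \<cdot> ?G1) = ?G2 \<cdot> (?G1 \<cdot> ?G2)"
    using ax(1) g by simp
  have U: "u \<otimes>\<^sub>a Idt \<C> C \<in> Hom \<C> (C \<otimes>\<^sub>o C) ?T" "Idt \<C> C \<otimes>\<^sub>a u \<in> Hom \<C> (C \<otimes>\<^sub>o C) ?T"
    using u by simp_all
  have jacobi: "(Idt \<C> ?T \<oplus> ?G2 \<cdot> ?G1 \<oplus> ?G1 \<cdot> ?G2) \<cdot> ((Idt \<C> C \<otimes>\<^sub>a u) \<cdot> u) = Zero \<C> C ?T"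
    and compat: "(u \<otimes>\<^sub>a Idt \<C> C) \<cdot> g = ?G2 \<cdot> ?G1 \<cdot> (Idt \<C> C \<otimes>\<^sub>a u)"
    using ax(2,3) g u(1) by simp_all
  note flip = coalgebra_flip[OF G braid g u U jacobi compat]
  show ?thesis
    using flip g u braid
    by (simp add: yb_lie_coalgebra_def symmetric_yb_operator_def yb_w_def yb_t_def)
qed

lemma yb_lie_algebra_reverse:
  assumes "yb_lie_algebra \<C> L l b"
  shows "yb_lie_algebra (reverse \<C>) L l b"
proof -
  have L [simp]: "L \<in> Obj \<C>"
    and l: "l \<in> Hom \<C> (L \<otimes>\<^sub>o L) (L \<otimes>\<^sub>o L)" "l \<cdot> l = Idt \<C> (L \<otimes>\<^sub>o L)"
    and b: "b \<in> Hom \<C> (L \<otimes>\<^sub>o L) L" "b \<cdot> (Idt \<C> (L \<otimes>\<^sub>o L) \<oplus> l) = Zero \<C> (L \<otimes>\<^sub>o L) L"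
    using assms by (simp_all add: yb_lie_algebra_def symmetric_yb_operator_def)
  have ax: "(l \<otimes>\<^sub>a Idt \<C> L) \<cdot> (Idt \<C> L \<otimes>\<^sub>a l) \<cdot> (l \<otimes>\<^sub>a Idt \<C> L) =
     (Idt \<C> L \<otimes>\<^sub>a l) \<cdot> (l \<otimes>\<^sub>a Idt \<C> L) \<cdot> (Idt \<C> L \<otimes>\<^sub>a l)"
    "b \<cdot> (Idt \<C> L \<otimes>\<^sub>a b) \<cdot> (Idt \<C> (L \<otimes>\<^sub>o L \<otimes>\<^sub>o L) \<oplus> yb_t \<C> L l \<oplus> yb_w \<C> L l) =
       Zero \<C> (L \<otimes>\<^sub>o L \<otimes>\<^sub>o L) L"
    "l \<cdot> (b \<otimes>\<^sub>a Idt \<C> L) = (Idt \<C> L \<otimes>\<^sub>a b) \<cdot> yb_t \<C> L l"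
    using assms unfolding yb_lie_algebra_def symmetric_yb_operator_def by blast+
  note ax = ax[unfolded yb_w_def yb_t_def]
  let ?T = "L \<otimes>\<^sub>o (L \<otimes>\<^sub>o L)"
  let ?G1 = "l \<otimes>\<^sub>a Idt \<C> L" and ?G2 = "Idt \<C> L \<otimes>\<^sub>a l"
  have G: "?G1 \<in> Hom \<C> ?T ?T" "?G2 \<in> Hom \<C> ?T ?T" "?G1 \<cdot> ?G1 = Idt \<C> ?T" "?G2 \<cdot> ?G2 = Idt \<C> ?T"
    using l by (simp_all add: whisker_Comp TensArr_Idt)
  have braid: "?G1 \<cdot> (?G2 \<cdot> ?G1) = ?G2 \<cdot> (?G1 \<cdot> ?G2)"
    using ax(1) l by simp
  have B: "b \<otimes>\<^sub>a Idt \<C> L \<in> Hom \<C> ?T (L \<otimes>\<^sub>o L)" "Idt \<C> L \<otimes>\<^sub>a b \<in> Hom \<C> ?T (L \<otimes>\<^sub>o L)"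
    using b by simp_all
  have jacobi: "b \<cdot> ((Idt \<C> L \<otimes>\<^sub>a b) \<cdot> (Idt \<C> ?T \<oplus> ?G1 \<cdot> ?G2 \<oplus> ?G2 \<cdot> ?G1)) = Zero \<C> ?T L"
    and compat: "l \<cdot> (b \<otimes>\<^sub>a Idt \<C> L) = (Idt \<C> L \<otimes>\<^sub>a b) \<cdot> (?G1 \<cdot> ?G2)"
    using ax(2,3) l b(1) by simp_all
  note flip = algebra_flip[OF G braid l b B jacobi compat]
  show ?thesis
    using flip l b braid
    by (simp add: yb_lie_algebra_def symmetric_yb_operator_def yb_w_def yb_t_def)
qed

end

section \<open>Lie structures on tensor and hom functors\<close>

text \<open>This is \<open>- \<otimes> C\<close> as a Lie comonad in \<open>\<C>\<close>. Its right
  adjoint carries the Lie monad \<open>Mnd'\<close>, and formed in the reversed category it is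
  \<open>CMnd\<close>.\<close>

definition RCMnd ::
    "('o, 'a, 'x) closed_category_data_scheme \<Rightarrow> 'o \<Rightarrow> 'a \<Rightarrow> 'a \<Rightarrow> ('o, 'a) lie_comonad_data" where
  "RCMnd \<C> C g u = CMnd (reverse \<C>) C g u"

text \<open>\<open>H(L,-)\<close> as a Lie comonad; formed in the reversed category it is
  \<open>CMnd'\<close>.\<close>

definition RCMnd' ::
    "('o, 'a, 'x) closed_category_data_scheme \<Rightarrow> 'o \<Rightarrow> 'a \<Rightarrow> 'a \<Rightarrow> ('o, 'a) lie_comonad_data" where
  "RCMnd' \<C> L l b = CMnd' (reverse \<C>) L l b"

lemma Mnd_simps [simp]:
  "fobj (Mnd \<C> L l b) X = X \<otimes>\<^sub>o\<^bsub>\<C>\<^esub> L" "fmap (Mnd \<C> L l b) f = f \<otimes>\<^sub>a\<^bsub>\<C>\<^esub> Idt \<C> L"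
  "twist (Mnd \<C> L l b) X = Idt \<C> X \<otimes>\<^sub>a\<^bsub>\<C>\<^esub> l" "bracket (Mnd \<C> L l b) X = Idt \<C> X \<otimes>\<^sub>a\<^bsub>\<C>\<^esub> b"
  "fobj (Mnd' \<C> C g u) = fobj (RHom \<C> C)" "fmap (Mnd' \<C> C g u) = fmap (RHom \<C> C)"
  by (simp_all add: Mnd_def Mnd'_def)

lemma RCMnd_eq:
  "RCMnd \<C> C g u = \<lparr>fobj = fobj (tensor_right \<C> C), fmap = fmap (tensor_right \<C> C),
    cotwist = \<lambda>M. Idt \<C> M \<otimes>\<^sub>a\<^bsub>\<C>\<^esub> g, cobracket = \<lambda>M. Idt \<C> M \<otimes>\<^sub>a\<^bsub>\<C>\<^esub> u\<rparr>"
  by (simp add: RCMnd_def CMnd_def)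

lemma reverse_internal_hom:
  "LContra (reverse \<C>) = RContra \<C>" "LPi (reverse \<C>) = RPi \<C>"
  by (simp_all add: fun_eq_iff LContra_def RContra_def LPi_def RPi_def LEval_def REval_def)

lemma RCMnd'_eq:
  "RCMnd' \<C> L l b = \<lparr>fobj = fobj (RHom \<C> L), fmap = fmap (RHom \<C> L),
    cotwist = \<lambda>M. RPi \<C> L L M \<cdot>\<^bsub>\<C>\<^esub> RContra \<C> l M \<cdot>\<^bsub>\<C>\<^esub> inv_arr \<C> (RPi \<C> L L M),
    cobracket = \<lambda>M. RPi \<C> L L M \<cdot>\<^bsub>\<C>\<^esub> RContra \<C> b M\<rparr>"
  by (simp add: RCMnd'_def CMnd'_def reverse_internal_hom reverse_additive_notions)

context additive_closed_strict_monoidal_category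
begin

text \<open>For use from left to right, to collect everything under a single
  \<open>X \<otimes> -\<close>. Then each Lie monad or comonad axiom at \<open>X\<close> is
  \<open>X\<close> tensored with an axiom of the YB-Lie structure.\<close>

lemma
  assumes X: "X \<in> Obj \<C>"
  shows under_Comp: "\<lbrakk>f \<in> Arr \<C>; g \<in> Arr \<C>; Dom \<C> g = Cod \<C> f\<rbrakk>
      \<Longrightarrow> (Idt \<C> X \<otimes>\<^sub>a g) \<cdot> (Idt \<C> X \<otimes>\<^sub>a f) = Idt \<C> X \<otimes>\<^sub>a (g \<cdot> f)"
    and under_Plus: "\<lbrakk>f \<in> Arr \<C>; g \<in> Arr \<C>; Dom \<C> g = Dom \<C> f; Cod \<C> g = Cod \<C> f\<rbrakk>
      \<Longrightarrow> (Idt \<C> X \<otimes>\<^sub>a g) \<oplus> (Idt \<C> X \<otimes>\<^sub>a f) = Idt \<C> X \<otimes>\<^sub>a (g \<oplus> f)"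
    and under_Idt: "A \<in> Obj \<C> \<Longrightarrow> Idt \<C> (X \<otimes>\<^sub>o A) = Idt \<C> X \<otimes>\<^sub>a Idt \<C> A"
    and under_Zero: "\<lbrakk>A \<in> Obj \<C>; B \<in> Obj \<C>\<rbrakk>
      \<Longrightarrow> Zero \<C> (X \<otimes>\<^sub>o A) (X \<otimes>\<^sub>o B) = Idt \<C> X \<otimes>\<^sub>a Zero \<C> A B"
    and under_under: "\<lbrakk>A \<in> Obj \<C>; f \<in> Arr \<C>\<rbrakk>
      \<Longrightarrow> Idt \<C> (X \<otimes>\<^sub>o A) \<otimes>\<^sub>a f = Idt \<C> X \<otimes>\<^sub>a (Idt \<C> A \<otimes>\<^sub>a f)"
  using X by (simp_all add: whisker_Comp TensArr_Plus Idt_TensObj[of X])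

text \<open>The bracket at \<open>X \<otimes> L\<close> is
  \<open>X \<otimes> (L \<otimes> b)\<close>, so the Jacobi axiom of the monad is that of the
  algebra as given.\<close>

lemma lie_monad_Mnd:
  assumes "yb_lie_algebra \<C> L l b"
  shows "lie_monad \<C> (Mnd \<C> L l b)"
proof -
  have L [simp]: "L \<in> Obj \<C>"
    and l: "l \<in> Arr \<C>" "Dom \<C> l = L \<otimes>\<^sub>o L" "Cod \<C> l = L \<otimes>\<^sub>o L"
    and b: "b \<in> Arr \<C>" "Dom \<C> b = L \<otimes>\<^sub>o L" "Cod \<C> b = L"
    using assms by (simp_all add: yb_lie_algebra_def symmetric_yb_operator_def)
  have ax: "l \<cdot> l = Idt \<C> (L \<otimes>\<^sub>o L)"
    "(l \<otimes>\<^sub>a Idt \<C> L) \<cdot> (Idt \<C> L \<otimes>\<^sub>a l) \<cdot> (l \<otimes>\<^sub>a Idt \<C> L) =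
     (Idt \<C> L \<otimes>\<^sub>a l) \<cdot> (l \<otimes>\<^sub>a Idt \<C> L) \<cdot> (Idt \<C> L \<otimes>\<^sub>a l)"
    "b \<cdot> (Idt \<C> (L \<otimes>\<^sub>o L) \<oplus> l) = Zero \<C> (L \<otimes>\<^sub>o L) L"
    "b \<cdot> (Idt \<C> L \<otimes>\<^sub>a b) \<cdot> (Idt \<C> (L \<otimes>\<^sub>o L \<otimes>\<^sub>o L) \<oplus> yb_t \<C> L l \<oplus> yb_w \<C> L l) =
       Zero \<C> (L \<otimes>\<^sub>o L \<otimes>\<^sub>o L) L"
    "l \<cdot> (b \<otimes>\<^sub>a Idt \<C> L) = (Idt \<C> L \<otimes>\<^sub>a b) \<cdot> yb_t \<C> L l"
    using assms unfolding yb_lie_algebra_def symmetric_yb_operator_def by blast+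
  note ax = ax[unfolded yb_w_def yb_t_def]
  have "additive_endofunctor \<C> (Mnd \<C> L l b)"
    using tensor_right_additive[OF L] by (simp add: additive_endofunctor_def endofunctor_def)
  moreover have "nat_transf \<C> (fcomp (Mnd \<C> L l b) (Mnd \<C> L l b)) (fcomp (Mnd \<C> L l b) (Mnd \<C> L l b))
      (twist (Mnd \<C> L l b))"
    using l by (auto simp: nat_transf_def fcomp_def TensArr_Idt whisker_exchange)
  moreover have "nat_transf \<C> (fcomp (Mnd \<C> L l b) (Mnd \<C> L l b)) (Mnd \<C> L l b)
      (bracket (Mnd \<C> L l b))"
    using b by (auto simp: nat_transf_def fcomp_def TensArr_Idt whisker_exchange)
  ultimately show ?thesis
    using ax l b
    \<comment> \<open>\<open>TensArr_Zero\<close> rewrites against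
      \<open>under_Zero\<close>.\<close>
    by (simp add: lie_monad_def Let_def whisker_left_def whisker_right_def under_under under_Idt
        under_Comp under_Plus under_Zero del: TensArr_Zero)
qed

text \<open>The functor applied to the cobracket at \<open>X\<close> is
  \<open>X \<otimes> u \<otimes> C\<close>, whereas the coalgebra axioms in \<open>\<C>\<close> are
  about \<open>C \<otimes> u\<close>; hence the hypothesis in the reversed category.\<close>

lemma lie_comonad_RCMnd:
  assumes "yb_lie_coalgebra (reverse \<C>) C g u"
  shows "lie_comonad \<C> (RCMnd \<C> C g u)"
proof -
  have C [simp]: "C \<in> Obj \<C>"
    and g: "g \<in> Arr \<C>" "Dom \<C> g = C \<otimes>\<^sub>o C" "Cod \<C> g = C \<otimes>\<^sub>o C"
    and u: "u \<in> Arr \<C>" "Dom \<C> u = C" "Cod \<C> u = C \<otimes>\<^sub>o C"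
    using assms by (simp_all add: yb_lie_coalgebra_def symmetric_yb_operator_def)
  have ax: "g \<cdot> g = Idt \<C> (C \<otimes>\<^sub>o C)"
    "(Idt \<C> C \<otimes>\<^sub>a g) \<cdot> (g \<otimes>\<^sub>a Idt \<C> C) \<cdot> (Idt \<C> C \<otimes>\<^sub>a g) =
     (g \<otimes>\<^sub>a Idt \<C> C) \<cdot> (Idt \<C> C \<otimes>\<^sub>a g) \<cdot> (g \<otimes>\<^sub>a Idt \<C> C)"
    "u \<oplus> g \<cdot> u = Zero \<C> C (C \<otimes>\<^sub>o C)"
    "(Idt \<C> (C \<otimes>\<^sub>o (C \<otimes>\<^sub>o C)) \<oplus> (g \<otimes>\<^sub>a Idt \<C> C) \<cdot> (Idt \<C> C \<otimes>\<^sub>a g) \<oplus>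
       (Idt \<C> C \<otimes>\<^sub>a g) \<cdot> (g \<otimes>\<^sub>a Idt \<C> C)) \<cdot> (u \<otimes>\<^sub>a Idt \<C> C) \<cdot> u =
       Zero \<C> C (C \<otimes>\<^sub>o (C \<otimes>\<^sub>o C))"
    "(Idt \<C> C \<otimes>\<^sub>a u) \<cdot> g = (g \<otimes>\<^sub>a Idt \<C> C) \<cdot> (Idt \<C> C \<otimes>\<^sub>a g) \<cdot> (u \<otimes>\<^sub>a Idt \<C> C)"
    using assms
    unfolding yb_lie_coalgebra_def symmetric_yb_operator_def yb_w_def yb_t_def reverse_simps
    by blast+
  have "additive_endofunctor \<C> (RCMnd \<C> C g u)"
    using tensor_right_additive[OF C]
    by (simp add: additive_endofunctor_def endofunctor_def RCMnd_eq)
  moreover have "nat_transf \<C> (fcomp (RCMnd \<C> C g u) (RCMnd \<C> C g u))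
      (fcomp (RCMnd \<C> C g u) (RCMnd \<C> C g u)) (cotwist (RCMnd \<C> C g u))"
    using g by (auto simp: nat_transf_def fcomp_def TensArr_Idt whisker_exchange RCMnd_eq)
  moreover have "nat_transf \<C> (RCMnd \<C> C g u) (fcomp (RCMnd \<C> C g u) (RCMnd \<C> C g u))
      (cobracket (RCMnd \<C> C g u))"
    using u by (auto simp: nat_transf_def fcomp_def TensArr_Idt whisker_exchange RCMnd_eq)
  ultimately show ?thesis
    using ax g u
    by (simp add: lie_comonad_def Let_def whisker_left_def whisker_right_def under_under under_Idt
        under_Comp under_Plus under_Zero RCMnd_eq del: TensArr_Zero)
qed

lemma ev_square_Hom:
  assumes "V \<in> Obj \<C>" "W \<in> Obj \<C>" "ev \<in> Hom \<C> (V \<otimes>\<^sub>o W) (UnitObj \<C>)"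
  shows "ev_square \<C> V W ev \<in> Hom \<C> (V \<otimes>\<^sub>o (V \<otimes>\<^sub>o (W \<otimes>\<^sub>o W))) (UnitObj \<C>)"
  using assms by (simp add: ev_square_def)

text \<open>Supplies the default value of \<open>\<beta>\<close>: both sides of each duality
  condition vanish.\<close>

lemma Zero_in_Dual:
  assumes "yb_lie_algebra \<C> L l b" "yb_lie_coalgebra \<C> C g u"
  shows "Zero \<C> (L \<otimes>\<^sub>o C) (UnitObj \<C>) \<in> Dual \<C> L l b C g u"
  using assms
  by (simp add: Dual_def ev_square_def yb_lie_algebra_def yb_lie_coalgebra_def
      symmetric_yb_operator_def)

end

lemma Mnd'_structure:
  "twist (Mnd' \<C> C g u) X = RPi \<C> C C X \<cdot>\<^bsub>\<C>\<^esub> RContra \<C> g X \<cdot>\<^bsub>\<C>\<^esub> inv_arr \<C> (RPi \<C> C C X)"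
  "bracket (Mnd' \<C> C g u) X = RContra \<C> u X \<cdot>\<^bsub>\<C>\<^esub> inv_arr \<C> (RPi \<C> C C X)"
  by (simp_all add: Mnd'_def)

lemma RCMnd'_structure:
  "cotwist (RCMnd' \<C> L l b) X = RPi \<C> L L X \<cdot>\<^bsub>\<C>\<^esub> RContra \<C> l X \<cdot>\<^bsub>\<C>\<^esub> inv_arr \<C> (RPi \<C> L L X)"
  "cobracket (RCMnd' \<C> L l b) X = RPi \<C> L L X \<cdot>\<^bsub>\<C>\<^esub> RContra \<C> b X"
  by (simp_all add: RCMnd'_eq)

section \<open>Lie structures on \<open>H(W,-)\<close>\<close>

context right_hom
begin

text \<open>These are the mate hypotheses of the two transport results. \<open>RPi\<close> reduces a
  twofold transpose to a single one along \<open>W \<otimes> W\<close>, where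
  \<open>RContra_mate\<close> applies. One statement for \<open>g\<close>, \<open>u\<close> and
  \<open>b\<close> covers the monad and the comonad.\<close>

lemma RContra_RPi_mates:
  assumes X: "X \<in> Obj \<C>" and g: "g \<in> Hom \<C> (W \<otimes>\<^sub>o W) (W \<otimes>\<^sub>o W)"
    and u: "u \<in> Hom \<C> W (W \<otimes>\<^sub>o W)" and b: "b \<in> Hom \<C> (W \<otimes>\<^sub>o W) W"
  shows "RPi \<C> W W X \<cdot> RContra \<C> g X \<cdot> inv_arr \<C> (RPi \<C> W W X) \<in>
      Hom \<C> (fobj (RHom \<C> W) (fobj (RHom \<C> W) X)) (fobj (RHom \<C> W) (fobj (RHom \<C> W) X))"
    and "RContra \<C> u X \<cdot> inv_arr \<C> (RPi \<C> W W X) \<in>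
      Hom \<C> (fobj (RHom \<C> W) (fobj (RHom \<C> W) X)) (fobj (RHom \<C> W) X)"
    and "RPi \<C> W W X \<cdot> RContra \<C> b X \<in>
      Hom \<C> (fobj (RHom \<C> W) X) (fobj (RHom \<C> W) (fobj (RHom \<C> W) X))"
    and "\<And>h. \<lbrakk>h \<in> Arr \<C>; Cod \<C> h = fobj (RHom \<C> W) (fobj (RHom \<C> W) X)\<rbrakk> \<Longrightarrow>
      flat2 X (RPi \<C> W W X \<cdot> RContra \<C> g X \<cdot> inv_arr \<C> (RPi \<C> W W X) \<cdot> h) =
      flat2 X h \<cdot> (Idt \<C> (Dom \<C> h) \<otimes>\<^sub>a g)"
    and "\<And>h. \<lbrakk>h \<in> Arr \<C>; Cod \<C> h = fobj (RHom \<C> W) (fobj (RHom \<C> W) X)\<rbrakk> \<Longrightarrow>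
      flat X (RContra \<C> u X \<cdot> inv_arr \<C> (RPi \<C> W W X) \<cdot> h) = flat2 X h \<cdot> (Idt \<C> (Dom \<C> h) \<otimes>\<^sub>a u)"
    and "\<And>h. \<lbrakk>h \<in> Arr \<C>; Cod \<C> h = fobj (RHom \<C> W) X\<rbrakk> \<Longrightarrow>
      flat2 X (RPi \<C> W W X \<cdot> RContra \<C> b X \<cdot> h) = flat X h \<cdot> (Idt \<C> (Dom \<C> h) \<otimes>\<^sub>a b)"
proof -
  note Pi = RPi_props[OF X]
  have contra:
    "RContra \<C> g X \<in> Hom \<C> (fobj (RHom \<C> (W \<otimes>\<^sub>o W)) X) (fobj (RHom \<C> (W \<otimes>\<^sub>o W)) X)"
    "RContra \<C> u X \<in> Hom \<C> (fobj (RHom \<C> (W \<otimes>\<^sub>o W)) X) (fobj (RHom \<C> W) X)"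
    "RContra \<C> b X \<in> Hom \<C> (fobj (RHom \<C> W) X) (fobj (RHom \<C> (W \<otimes>\<^sub>o W)) X)"
    using RContra_flat(1)[OF _ X, of g] RContra_flat(1)[OF _ X, of u] RContra_flat(1)[OF _ X, of b]
      g u b by simp_all
  note mate = RContra_mate[OF g X] RContra_mate[OF u X] RContra_mate[OF b X]
  show "RPi \<C> W W X \<cdot> RContra \<C> g X \<cdot> inv_arr \<C> (RPi \<C> W W X) \<in>
      Hom \<C> (fobj (RHom \<C> W) (fobj (RHom \<C> W) X)) (fobj (RHom \<C> W) (fobj (RHom \<C> W) X))"
    "RContra \<C> u X \<cdot> inv_arr \<C> (RPi \<C> W W X) \<in>
      Hom \<C> (fobj (RHom \<C> W) (fobj (RHom \<C> W) X)) (fobj (RHom \<C> W) X)"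
    "RPi \<C> W W X \<cdot> RContra \<C> b X \<in>
      Hom \<C> (fobj (RHom \<C> W) X) (fobj (RHom \<C> W) (fobj (RHom \<C> W) X))"
    using contra Pi(1,2) by simp_all
  show "flat2 X (RPi \<C> W W X \<cdot> RContra \<C> g X \<cdot> inv_arr \<C> (RPi \<C> W W X) \<cdot> h) =
      flat2 X h \<cdot> (Idt \<C> (Dom \<C> h) \<otimes>\<^sub>a g)"
    if "h \<in> Arr \<C>" "Cod \<C> h = fobj (RHom \<C> W) (fobj (RHom \<C> W) X)" for h
    using that contra(1) Pi(1,2) by (simp add: Pi(3,4) mate)
  show "flat X (RContra \<C> u X \<cdot> inv_arr \<C> (RPi \<C> W W X) \<cdot> h) =
      flat2 X h \<cdot> (Idt \<C> (Dom \<C> h) \<otimes>\<^sub>a u)"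
    if "h \<in> Arr \<C>" "Cod \<C> h = fobj (RHom \<C> W) (fobj (RHom \<C> W) X)" for h
    using that contra(2) Pi(1,2) by (simp add: Pi(4) mate)
  show "flat2 X (RPi \<C> W W X \<cdot> RContra \<C> b X \<cdot> h) = flat X h \<cdot> (Idt \<C> (Dom \<C> h) \<otimes>\<^sub>a b)"
    if "h \<in> Arr \<C>" "Cod \<C> h = fobj (RHom \<C> W) X" for h
    using that contra(3) Pi(1,2) by (simp add: Pi(3) mate)
qed

lemma lie_monad_Mnd':
  assumes "yb_lie_coalgebra (reverse \<C>) W g u"
  shows "lie_monad \<C> (Mnd' \<C> W g u)"
proof -
  have g: "g \<in> Hom \<C> (W \<otimes>\<^sub>o W) (W \<otimes>\<^sub>o W)" and u: "u \<in> Hom \<C> W (W \<otimes>\<^sub>o W)"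
    using assms by (simp_all add: yb_lie_coalgebra_def symmetric_yb_operator_def)
  \<comment> \<open>The zero morphism fills the place of the bracket in
    \<open>RContra_RPi_mates\<close>.\<close>
  have b: "Zero \<C> (W \<otimes>\<^sub>o W) W \<in> Hom \<C> (W \<otimes>\<^sub>o W) W" by simp
  note mates = RContra_RPi_mates[OF _ g u b]
  show ?thesis
    unfolding Mnd'_def
    by (rule right_adjoint_of_lie_comonad[OF lie_comonad_RCMnd[OF assms, unfolded RCMnd_eq]])
      (simp_all only: mates)
qed

lemma lie_comonad_RCMnd':
  assumes "yb_lie_algebra \<C> W l b"
  shows "lie_comonad \<C> (RCMnd' \<C> W l b)"
proof -
  have l: "l \<in> Hom \<C> (W \<otimes>\<^sub>o W) (W \<otimes>\<^sub>o W)" and b: "b \<in> Hom \<C> (W \<otimes>\<^sub>o W) W"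
    using assms by (simp_all add: yb_lie_algebra_def symmetric_yb_operator_def)
  have u: "Zero \<C> W (W \<otimes>\<^sub>o W) \<in> Hom \<C> W (W \<otimes>\<^sub>o W)" by simp
  note mates = RContra_RPi_mates[OF _ l u b]
  show ?thesis
    unfolding RCMnd'_eq
    by (rule right_adjoint_of_lie_monad[OF lie_monad_Mnd[OF assms, unfolded Mnd_def]])
      (simp_all only: mates)
qed

end

section \<open>Pairings and natural transformations\<close>

context right_hom
begin

text \<open>Restricted to objects because the sets of Lie monad and comonad morphisms consist of
  extensional families.\<close>

definition pairing_transf :: "'o \<Rightarrow> 'a \<Rightarrow> 'o \<Rightarrow> 'a" where
  "pairing_transf V ev = (\<lambda>X\<in>Obj \<C>. RCur \<C> W (X \<otimes>\<^sub>o V) X (Idt \<C> X \<otimes>\<^sub>a ev))"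

lemma pairing_transf_simps [simp]:
  assumes "X \<in> Obj \<C>" "V \<in> Obj \<C>" "ev \<in> Arr \<C>" "Dom \<C> ev = V \<otimes>\<^sub>o W" "Cod \<C> ev = UnitObj \<C>"
  shows "pairing_transf V ev X \<in> Arr \<C>" "Dom \<C> (pairing_transf V ev X) = X \<otimes>\<^sub>o V"
    "Cod \<C> (pairing_transf V ev X) = fobj (RHom \<C> W) X"
    "flat X (pairing_transf V ev X) = Idt \<C> X \<otimes>\<^sub>a ev"
  using assms by (simp_all add: pairing_transf_def)

text \<open>Both sides of the naturality square at \<open>f\<close> have transpose
  \<open>f \<otimes> ev\<close>.\<close>

lemma nat_transf_pairing_transf:
  assumes "V \<in> Obj \<C>" "ev \<in> Hom \<C> (V \<otimes>\<^sub>o W) (UnitObj \<C>)"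
  shows "nat_transf \<C> (tensor_right \<C> V) (RHom \<C> W) (pairing_transf V ev)"
  unfolding nat_transf_def
proof (intro conjI ballI allI)
  fix X assume "X \<in> Obj \<C>"
  then show "pairing_transf V ev X \<in> Hom \<C> (fobj (tensor_right \<C> V) X) (fobj (RHom \<C> W) X)"
    using assms by simp
next
  fix X Y f assume "f \<in> Hom \<C> X Y"
  then have f: "f \<in> Arr \<C>" "Dom \<C> f = X" "Cod \<C> f = Y" by simp_all
  then have XY: "X \<in> Obj \<C>" "Y \<in> Obj \<C>" by auto
  have ev: "ev \<in> Arr \<C>" "Dom \<C> ev = V \<otimes>\<^sub>o W" "Cod \<C> ev = UnitObj \<C>"
    using assms by simp_all
  have "f \<cdot> (Idt \<C> X \<otimes>\<^sub>a ev) = (f \<otimes>\<^sub>a Idt \<C> (UnitObj \<C>)) \<cdot> (Idt \<C> X \<otimes>\<^sub>a ev)"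
    using f by simp
  also have "\<dots> = f \<otimes>\<^sub>a ev"
    using f ev by (simp only: whisker_exchange)
  finally have "f \<cdot> (Idt \<C> X \<otimes>\<^sub>a ev) = f \<otimes>\<^sub>a ev" .
  then show "pairing_transf V ev Y \<cdot> fmap (tensor_right \<C> V) f = fmap (RHom \<C> W) f \<cdot> pairing_transf V ev X"
    using f XY ev assms(1)
    by - (rule flat_eqD[of Y], simp_all add: flat_Comp[of "pairing_transf V ev Y"] flat_fmap
        TensArr_Idt whisker_exchange)
qed

text \<open>\<open>F\<close> and \<open>G\<close> are constrained only where \<open>hsquare\<close>
  looks at them, which serves monad and comonad records alike. After one transposition, interchange
  moves \<open>ev\<close> on the inner pair in front of the component at \<open>X\<close>; the
  second transposition applies \<open>ev\<close> to the outer pair.\<close>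

lemma flat2_hsquare:
  assumes V: "V \<in> Obj \<C>" and ev: "ev \<in> Hom \<C> (V \<otimes>\<^sub>o W) (UnitObj \<C>)" and X: "X \<in> Obj \<C>"
    and F: "fmap F = fmap (tensor_right \<C> V)" and G: "fobj G = fobj (RHom \<C> W)"
  shows "hsquare \<C> F G (pairing_transf V ev) X \<in>
      Hom \<C> (X \<otimes>\<^sub>o (V \<otimes>\<^sub>o V)) (fobj (RHom \<C> W) (fobj (RHom \<C> W) X))"
    and "flat2 X (hsquare \<C> F G (pairing_transf V ev) X) = Idt \<C> X \<otimes>\<^sub>a ev_square \<C> V W ev"
proof -
  have ev': "ev \<in> Arr \<C>" "Dom \<C> ev = V \<otimes>\<^sub>o W" "Cod \<C> ev = UnitObj \<C>"
    using ev by simp_all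
  let ?p = "pairing_transf V ev"
  have eq: "hsquare \<C> F G ?p X = ?p (fobj (RHom \<C> W) X) \<cdot> (?p X \<otimes>\<^sub>a Idt \<C> V)"
    by (simp add: hsquare_def F G)
  show "hsquare \<C> F G ?p X \<in>
      Hom \<C> (X \<otimes>\<^sub>o (V \<otimes>\<^sub>o V)) (fobj (RHom \<C> W) (fobj (RHom \<C> W) X))"
    unfolding eq using V ev' X by simp
  have "flat (fobj (RHom \<C> W) X) (hsquare \<C> F G ?p X) =
      (Idt \<C> (fobj (RHom \<C> W) X) \<otimes>\<^sub>a ev) \<cdot> (?p X \<otimes>\<^sub>a Idt \<C> (V \<otimes>\<^sub>o W))"
    unfolding eq using V ev' X by (simp add: flat_Comp TensArr_Idt)
  also have "\<dots> = (?p X \<otimes>\<^sub>a Idt \<C> (UnitObj \<C>)) \<cdot> (Idt \<C> (X \<otimes>\<^sub>o V) \<otimes>\<^sub>a ev)"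
    using V ev' X by (simp only: whisker_exchange pairing_transf_simps)
  also have "\<dots> = ?p X \<cdot> (Idt \<C> X \<otimes>\<^sub>a (Idt \<C> V \<otimes>\<^sub>a ev))"
    using V ev' X by (simp add: under_under)
  finally have "flat2 X (hsquare \<C> F G ?p X) =
      (Idt \<C> X \<otimes>\<^sub>a ev) \<cdot> (Idt \<C> X \<otimes>\<^sub>a (Idt \<C> V \<otimes>\<^sub>a (ev \<otimes>\<^sub>a Idt \<C> W)))"
    using V ev' X by (simp add: flat2_def flat_Comp)
  also have "\<dots> = Idt \<C> X \<otimes>\<^sub>a ev_square \<C> V W ev"
    using V ev' X by (simp add: under_Comp ev_square_def)
  finally show "flat2 X (hsquare \<C> F G ?p X) = Idt \<C> X \<otimes>\<^sub>a ev_square \<C> V W ev" .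
qed

text \<open>Take \<open>X\<close> to be the unit object, where strictness removes the extra
  factor.\<close>

lemma under_all_iff:
  assumes "f \<in> Arr \<C>" "g \<in> Arr \<C>"
  shows "(\<forall>X\<in>Obj \<C>. Idt \<C> X \<otimes>\<^sub>a f = Idt \<C> X \<otimes>\<^sub>a g) \<longleftrightarrow> f = g"
  using assms TensArr_unit(1) UnitObj_Obj by metis

text \<open>At each \<open>X\<close> the two morphism equations transpose to the duality equations
  tensored with \<open>X\<close>, and over all \<open>X\<close> these amount to the duality
  equations. The forward direction shows that a pairing recovered from a morphism is a
  duality.\<close>

lemma pairing_transf_in_LieMonadHom_iff:
  assumes alg: "yb_lie_algebra \<C> V l b" and coalg: "yb_lie_coalgebra (reverse \<C>) W g u"
    and ev: "ev \<in> Hom \<C> (V \<otimes>\<^sub>o W) (UnitObj \<C>)"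
  shows "pairing_transf V ev \<in> LieMonadHom \<C> (Mnd \<C> V l b) (Mnd' \<C> W g u) \<longleftrightarrow>
    ev \<in> Dual \<C> V l b W g u"
proof -
  let ?p = "pairing_transf V ev" and ?M = "Mnd \<C> V l b" and ?M' = "Mnd' \<C> W g u"
  let ?sq = "hsquare \<C> ?M ?M' ?p"
  have V: "V \<in> Obj \<C>"
    and l: "l \<in> Arr \<C>" "Dom \<C> l = V \<otimes>\<^sub>o V" "Cod \<C> l = V \<otimes>\<^sub>o V"
    and b: "b \<in> Arr \<C>" "Dom \<C> b = V \<otimes>\<^sub>o V" "Cod \<C> b = V"
    using alg by (simp_all add: yb_lie_algebra_def symmetric_yb_operator_def)
  have g: "g \<in> Hom \<C> (W \<otimes>\<^sub>o W) (W \<otimes>\<^sub>o W)" and u: "u \<in> Hom \<C> W (W \<otimes>\<^sub>o W)"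
    using coalg by (simp_all add: yb_lie_coalgebra_def symmetric_yb_operator_def)
  have z: "Zero \<C> (W \<otimes>\<^sub>o W) W \<in> Hom \<C> (W \<otimes>\<^sub>o W) W" by simp
  have ev': "ev \<in> Arr \<C>" "Dom \<C> ev = V \<otimes>\<^sub>o W" "Cod \<C> ev = UnitObj \<C>"
    using ev by simp_all
  have sq: "?sq X \<in> Hom \<C> (X \<otimes>\<^sub>o (V \<otimes>\<^sub>o V)) (fobj (RHom \<C> W) (fobj (RHom \<C> W) X))"
    "flat2 X (?sq X) = Idt \<C> X \<otimes>\<^sub>a ev_square \<C> V W ev" if "X \<in> Obj \<C>" for X
    using flat2_hsquare[OF V ev that, of ?M ?M'] by (simp_all add: fun_eq_iff)
  have ev2: "ev_square \<C> V W ev \<in> Arr \<C>" "Dom \<C> (ev_square \<C> V W ev) = V \<otimes>\<^sub>o (V \<otimes>\<^sub>o (W \<otimes>\<^sub>o W))"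
    "Cod \<C> (ev_square \<C> V W ev) = UnitObj \<C>"
    using ev_square_Hom[OF V W ev] by simp_all
  have M': "lie_monad \<C> ?M'" by (rule lie_monad_Mnd'[OF coalg])
  have tw: "twist ?M' X \<in> Hom \<C> (fobj (RHom \<C> W) (fobj (RHom \<C> W) X)) (fobj (RHom \<C> W) (fobj (RHom \<C> W) X))"
    and br: "bracket ?M' X \<in> Hom \<C> (fobj (RHom \<C> W) (fobj (RHom \<C> W) X)) (fobj (RHom \<C> W) X)"
    if "X \<in> Obj \<C>" for X
    unfolding Mnd'_structure by (rule RContra_RPi_mates(1,2)[OF that g u z])+
  \<comment> \<open>Both sides end in \<open>H(W, X)\<close>, so a single transposition is
    enough.\<close>
  have bracket: "bracket ?M' X \<cdot> ?sq X = ?p X \<cdot> bracket ?M X \<longleftrightarrow>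
      Idt \<C> X \<otimes>\<^sub>a (ev_square \<C> V W ev \<cdot> (Idt \<C> V \<otimes>\<^sub>a (Idt \<C> V \<otimes>\<^sub>a u))) =
      Idt \<C> X \<otimes>\<^sub>a (ev \<cdot> (b \<otimes>\<^sub>a Idt \<C> W))" if X: "X \<in> Obj \<C>" for X
  proof -
    have "flat X (bracket ?M' X \<cdot> ?sq X) =
        (Idt \<C> X \<otimes>\<^sub>a ev_square \<C> V W ev) \<cdot> (Idt \<C> (X \<otimes>\<^sub>o (V \<otimes>\<^sub>o V)) \<otimes>\<^sub>a u)"
      unfolding Mnd'_structure(2)
      using sq[OF X] X V ev' by (subst RContra_RPi_mates(5)[OF X g u z]) simp_all
    also have "\<dots> = Idt \<C> X \<otimes>\<^sub>a (ev_square \<C> V W ev \<cdot> (Idt \<C> V \<otimes>\<^sub>a (Idt \<C> V \<otimes>\<^sub>a u)))"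
      using V X u ev2 by (simp add: under_under under_Comp)
    finally have 1: "flat X (bracket ?M' X \<cdot> ?sq X) =
      Idt \<C> X \<otimes>\<^sub>a (ev_square \<C> V W ev \<cdot> (Idt \<C> V \<otimes>\<^sub>a (Idt \<C> V \<otimes>\<^sub>a u)))" .
    have 2: "flat X (?p X \<cdot> bracket ?M X) = Idt \<C> X \<otimes>\<^sub>a (ev \<cdot> (b \<otimes>\<^sub>a Idt \<C> W))"
      using V X b ev' by (simp add: flat_Comp under_Comp)
    show ?thesis
      unfolding 1[symmetric] 2[symmetric]
      using flat_eqD[of X "bracket ?M' X \<cdot> ?sq X" "?p X \<cdot> bracket ?M X"] br[OF X] sq(1)[OF X] X V b ev'
      by auto
  qed
  \<comment> \<open>Both sides end in \<open>H(W, H(W, X))\<close>, which takes two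
    transpositions.\<close>
  have twist: "twist ?M' X \<cdot> ?sq X = ?sq X \<cdot> twist ?M X \<longleftrightarrow>
      Idt \<C> X \<otimes>\<^sub>a (ev_square \<C> V W ev \<cdot> (l \<otimes>\<^sub>a (Idt \<C> W \<otimes>\<^sub>a Idt \<C> W))) =
      Idt \<C> X \<otimes>\<^sub>a (ev_square \<C> V W ev \<cdot> (Idt \<C> V \<otimes>\<^sub>a (Idt \<C> V \<otimes>\<^sub>a g)))" if X: "X \<in> Obj \<C>" for X
  proof -
    have "flat2 X (twist ?M' X \<cdot> ?sq X) =
        (Idt \<C> X \<otimes>\<^sub>a ev_square \<C> V W ev) \<cdot> (Idt \<C> (X \<otimes>\<^sub>o (V \<otimes>\<^sub>o V)) \<otimes>\<^sub>a g)"
      unfolding Mnd'_structure(1)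
      using sq[OF X] X V ev' by (subst RContra_RPi_mates(4)[OF X g u z]) simp_all
    also have "\<dots> = Idt \<C> X \<otimes>\<^sub>a (ev_square \<C> V W ev \<cdot> (Idt \<C> V \<otimes>\<^sub>a (Idt \<C> V \<otimes>\<^sub>a g)))"
      using V X g ev2 by (simp add: under_under under_Comp)
    finally have 1: "flat2 X (twist ?M' X \<cdot> ?sq X) =
      Idt \<C> X \<otimes>\<^sub>a (ev_square \<C> V W ev \<cdot> (Idt \<C> V \<otimes>\<^sub>a (Idt \<C> V \<otimes>\<^sub>a g)))" .
    have 2: "flat2 X (?sq X \<cdot> twist ?M X) =
        Idt \<C> X \<otimes>\<^sub>a (ev_square \<C> V W ev \<cdot> (l \<otimes>\<^sub>a (Idt \<C> W \<otimes>\<^sub>a Idt \<C> W)))"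
      using V X l ev2 sq[OF X] by (simp add: flat2_Comp under_Comp)
    show ?thesis
      unfolding 1[symmetric] 2[symmetric]
      using flat2_eqD[of X "twist ?M' X \<cdot> ?sq X" "?sq X \<cdot> twist ?M X"] tw[OF X] sq(1)[OF X] X V l
      by auto
  qed
  have "nat_transf \<C> ?M ?M' ?p"
    using nat_transf_pairing_transf[OF V ev] by (simp add: nat_transf_def)
  then have "?p \<in> LieMonadHom \<C> ?M ?M' \<longleftrightarrow>
      (\<forall>X\<in>Obj \<C>. bracket ?M' X \<cdot> ?sq X = ?p X \<cdot> bracket ?M X) \<and>
      (\<forall>X\<in>Obj \<C>. twist ?M' X \<cdot> ?sq X = ?sq X \<cdot> twist ?M X)"
    using lie_monad_Mnd[OF alg] M' by (auto simp: LieMonadHom_def pairing_transf_def)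
  also have "\<dots> \<longleftrightarrow> ev_square \<C> V W ev \<cdot> (Idt \<C> V \<otimes>\<^sub>a (Idt \<C> V \<otimes>\<^sub>a u)) = ev \<cdot> (b \<otimes>\<^sub>a Idt \<C> W) \<and>
      ev_square \<C> V W ev \<cdot> (l \<otimes>\<^sub>a (Idt \<C> W \<otimes>\<^sub>a Idt \<C> W)) =
      ev_square \<C> V W ev \<cdot> (Idt \<C> V \<otimes>\<^sub>a (Idt \<C> V \<otimes>\<^sub>a g))"
    using V l b g u ev' ev2
    by (simp only: bracket twist cong: ball_cong) (simp add: under_all_iff)
  also have "\<dots> \<longleftrightarrow> ev \<in> Dual \<C> V l b W g u"
    using V l b g u ev' ev2 by (auto simp: Dual_def)
  finally show ?thesis .
qed

text \<open>Meant for the reversed category, with \<open>V\<close> the coalgebra and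
  \<open>W\<close> the algebra. The domain \<open>V \<otimes> W\<close> of \<open>ev\<close> is the
  reversed product of \<open>W\<close> and \<open>V\<close>, hence the dualities in
  \<open>reverse \<C>\<close>.\<close>

lemma pairing_transf_in_LieComonadHom_iff:
  assumes alg: "yb_lie_algebra \<C> W l b" and coalg: "yb_lie_coalgebra (reverse \<C>) V g u"
    and ev: "ev \<in> Hom \<C> (V \<otimes>\<^sub>o W) (UnitObj \<C>)"
  shows "pairing_transf V ev \<in> LieComonadHom \<C> (RCMnd \<C> V g u) (RCMnd' \<C> W l b) \<longleftrightarrow>
    ev \<in> Dual (reverse \<C>) W l b V g u"
proof -
  let ?p = "pairing_transf V ev" and ?D = "RCMnd \<C> V g u" and ?D' = "RCMnd' \<C> W l b"
  let ?sq = "hsquare \<C> ?D ?D' ?p"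
  have V: "V \<in> Obj \<C>"
    and g: "g \<in> Arr \<C>" "Dom \<C> g = V \<otimes>\<^sub>o V" "Cod \<C> g = V \<otimes>\<^sub>o V"
    and u: "u \<in> Arr \<C>" "Dom \<C> u = V" "Cod \<C> u = V \<otimes>\<^sub>o V"
    using coalg by (simp_all add: yb_lie_coalgebra_def symmetric_yb_operator_def)
  have l: "l \<in> Hom \<C> (W \<otimes>\<^sub>o W) (W \<otimes>\<^sub>o W)" and b: "b \<in> Hom \<C> (W \<otimes>\<^sub>o W) W"
    using alg by (simp_all add: yb_lie_algebra_def symmetric_yb_operator_def)
  have z: "Zero \<C> W (W \<otimes>\<^sub>o W) \<in> Hom \<C> W (W \<otimes>\<^sub>o W)" by simp
  have ev': "ev \<in> Arr \<C>" "Dom \<C> ev = V \<otimes>\<^sub>o W" "Cod \<C> ev = UnitObj \<C>"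
    using ev by simp_all
  have sq: "?sq X \<in> Hom \<C> (X \<otimes>\<^sub>o (V \<otimes>\<^sub>o V)) (fobj (RHom \<C> W) (fobj (RHom \<C> W) X))"
    "flat2 X (?sq X) = Idt \<C> X \<otimes>\<^sub>a ev_square \<C> V W ev" if "X \<in> Obj \<C>" for X
    using flat2_hsquare[OF V ev that, of ?D ?D'] by (simp_all add: RCMnd_eq RCMnd'_eq)
  have ev2: "ev_square \<C> V W ev \<in> Arr \<C>" "Dom \<C> (ev_square \<C> V W ev) = V \<otimes>\<^sub>o (V \<otimes>\<^sub>o (W \<otimes>\<^sub>o W))"
    "Cod \<C> (ev_square \<C> V W ev) = UnitObj \<C>"
    using ev_square_Hom[OF V W ev] by simp_all
  have D': "lie_comonad \<C> ?D'" by (rule lie_comonad_RCMnd'[OF alg])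
  have tw: "cotwist ?D' X \<in> Hom \<C> (fobj (RHom \<C> W) (fobj (RHom \<C> W) X)) (fobj (RHom \<C> W) (fobj (RHom \<C> W) X))"
    and br: "cobracket ?D' X \<in> Hom \<C> (fobj (RHom \<C> W) X) (fobj (RHom \<C> W) (fobj (RHom \<C> W) X))"
    if "X \<in> Obj \<C>" for X
    unfolding RCMnd'_structure by (rule RContra_RPi_mates(1,3)[OF that l z b])+
  have cobracket: "cobracket ?D' X \<cdot> ?p X = ?sq X \<cdot> cobracket ?D X \<longleftrightarrow>
      Idt \<C> X \<otimes>\<^sub>a (ev \<cdot> (Idt \<C> V \<otimes>\<^sub>a b)) =
      Idt \<C> X \<otimes>\<^sub>a (ev_square \<C> V W ev \<cdot> (u \<otimes>\<^sub>a (Idt \<C> W \<otimes>\<^sub>a Idt \<C> W)))" if X: "X \<in> Obj \<C>" for X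
  proof -
    have "flat2 X (cobracket ?D' X \<cdot> ?p X) = (Idt \<C> X \<otimes>\<^sub>a ev) \<cdot> (Idt \<C> (X \<otimes>\<^sub>o V) \<otimes>\<^sub>a b)"
      unfolding RCMnd'_structure(2)
      using sq[OF X] X V ev' by (subst RContra_RPi_mates(6)[OF X l z b]) simp_all
    also have "\<dots> = Idt \<C> X \<otimes>\<^sub>a (ev \<cdot> (Idt \<C> V \<otimes>\<^sub>a b))"
      using V X b ev' by (simp add: under_under under_Comp)
    finally have 1: "flat2 X (cobracket ?D' X \<cdot> ?p X) = Idt \<C> X \<otimes>\<^sub>a (ev \<cdot> (Idt \<C> V \<otimes>\<^sub>a b))" .
    have 2: "flat2 X (?sq X \<cdot> cobracket ?D X) =
        Idt \<C> X \<otimes>\<^sub>a (ev_square \<C> V W ev \<cdot> (u \<otimes>\<^sub>a (Idt \<C> W \<otimes>\<^sub>a Idt \<C> W)))"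
      using V X u ev2 sq[OF X] by (simp add: flat2_Comp under_Comp RCMnd_eq)
    show ?thesis
      unfolding 1[symmetric] 2[symmetric]
      using flat2_eqD[of X "cobracket ?D' X \<cdot> ?p X" "?sq X \<cdot> cobracket ?D X"] br[OF X] sq(1)[OF X] X V u ev'
      by (auto simp: RCMnd_eq)
  qed
  have cotwist: "cotwist ?D' X \<cdot> ?sq X = ?sq X \<cdot> cotwist ?D X \<longleftrightarrow>
      Idt \<C> X \<otimes>\<^sub>a (ev_square \<C> V W ev \<cdot> (Idt \<C> V \<otimes>\<^sub>a (Idt \<C> V \<otimes>\<^sub>a l))) =
      Idt \<C> X \<otimes>\<^sub>a (ev_square \<C> V W ev \<cdot> (g \<otimes>\<^sub>a (Idt \<C> W \<otimes>\<^sub>a Idt \<C> W)))" if X: "X \<in> Obj \<C>" for X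
  proof -
    have "flat2 X (cotwist ?D' X \<cdot> ?sq X) =
        (Idt \<C> X \<otimes>\<^sub>a ev_square \<C> V W ev) \<cdot> (Idt \<C> (X \<otimes>\<^sub>o (V \<otimes>\<^sub>o V)) \<otimes>\<^sub>a l)"
      unfolding RCMnd'_structure(1)
      using sq[OF X] X V ev' by (subst RContra_RPi_mates(4)[OF X l z b]) simp_all
    also have "\<dots> = Idt \<C> X \<otimes>\<^sub>a (ev_square \<C> V W ev \<cdot> (Idt \<C> V \<otimes>\<^sub>a (Idt \<C> V \<otimes>\<^sub>a l)))"
      using V X l ev2 by (simp add: under_under under_Comp)
    finally have 1: "flat2 X (cotwist ?D' X \<cdot> ?sq X) =
      Idt \<C> X \<otimes>\<^sub>a (ev_square \<C> V W ev \<cdot> (Idt \<C> V \<otimes>\<^sub>a (Idt \<C> V \<otimes>\<^sub>a l)))" .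
    have 2: "flat2 X (?sq X \<cdot> cotwist ?D X) =
        Idt \<C> X \<otimes>\<^sub>a (ev_square \<C> V W ev \<cdot> (g \<otimes>\<^sub>a (Idt \<C> W \<otimes>\<^sub>a Idt \<C> W)))"
      using V X g ev2 sq[OF X] by (simp add: flat2_Comp under_Comp RCMnd_eq)
    show ?thesis
      unfolding 1[symmetric] 2[symmetric]
      using flat2_eqD[of X "cotwist ?D' X \<cdot> ?sq X" "?sq X \<cdot> cotwist ?D X"] tw[OF X] sq(1)[OF X] X V g
      by (auto simp: RCMnd_eq)
  qed
  have "nat_transf \<C> ?D ?D' ?p"
    using nat_transf_pairing_transf[OF V ev] by (simp add: nat_transf_def RCMnd_eq RCMnd'_eq)
  then have "?p \<in> LieComonadHom \<C> ?D ?D' \<longleftrightarrow>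
      (\<forall>X\<in>Obj \<C>. cobracket ?D' X \<cdot> ?p X = ?sq X \<cdot> cobracket ?D X) \<and>
      (\<forall>X\<in>Obj \<C>. cotwist ?D' X \<cdot> ?sq X = ?sq X \<cdot> cotwist ?D X)"
    using lie_comonad_RCMnd[OF coalg] D' by (auto simp: LieComonadHom_def pairing_transf_def)
  also have "\<dots> \<longleftrightarrow> ev \<cdot> (Idt \<C> V \<otimes>\<^sub>a b) = ev_square \<C> V W ev \<cdot> (u \<otimes>\<^sub>a (Idt \<C> W \<otimes>\<^sub>a Idt \<C> W)) \<and>
      ev_square \<C> V W ev \<cdot> (Idt \<C> V \<otimes>\<^sub>a (Idt \<C> V \<otimes>\<^sub>a l)) =
      ev_square \<C> V W ev \<cdot> (g \<otimes>\<^sub>a (Idt \<C> W \<otimes>\<^sub>a Idt \<C> W))"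
    using V l b g u ev' ev2 by (simp add: cobracket cotwist under_all_iff)
  also have "\<dots> \<longleftrightarrow> ev \<in> Dual (reverse \<C>) W l b V g u"
    using V l b g u ev' ev2 by (auto simp: Dual_def ev_square_def)
  finally show ?thesis .
qed

text \<open>Naturality along \<open>f\<close> from \<open>I\<close> to \<open>X\<close> determines
  the transpose of \<open>\<zeta> X\<close>, after \<open>f \<otimes> V \<otimes> W\<close>, from
  the component at \<open>I\<close>; such morphisms are jointly epic.\<close>

lemma nat_transf_eq_pairing_transf:
  assumes gen: "regular_generator \<C> (UnitObj \<C>)" and V: "V \<in> Obj \<C>"
    and nat: "nat_transf \<C> (tensor_right \<C> V) (RHom \<C> W) \<zeta>" and ext: "\<zeta> \<in> extensional (Obj \<C>)"
  shows "flat (UnitObj \<C>) (\<zeta> (UnitObj \<C>)) \<in> Hom \<C> (V \<otimes>\<^sub>o W) (UnitObj \<C>)"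
    and "\<zeta> = pairing_transf V (flat (UnitObj \<C>) (\<zeta> (UnitObj \<C>)))"
proof -
  let ?I = "UnitObj \<C>"
  define ev where "ev = flat ?I (\<zeta> ?I)"
  have \<zeta>: "\<zeta> X \<in> Arr \<C>" "Dom \<C> (\<zeta> X) = X \<otimes>\<^sub>o V" "Cod \<C> (\<zeta> X) = fobj (RHom \<C> W) X"
    if "X \<in> Obj \<C>" for X
    using nat that by (auto simp: nat_transf_def)
  have ev: "ev \<in> Arr \<C>" "Dom \<C> ev = V \<otimes>\<^sub>o W" "Cod \<C> ev = ?I"
    using \<zeta>[OF UnitObj_Obj] V by (simp_all add: ev_def)
  then show "flat ?I (\<zeta> ?I) \<in> Hom \<C> (V \<otimes>\<^sub>o W) ?I"
    by (simp add: ev_def)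
  have p: "nat_transf \<C> (tensor_right \<C> V) (RHom \<C> W) (pairing_transf V ev)"
    using ev V by (intro nat_transf_pairing_transf) simp_all
  show "\<zeta> = pairing_transf V (flat ?I (\<zeta> ?I))"
    unfolding ev_def[symmetric]
  proof (rule extensionalityI[OF ext])
    show "pairing_transf V ev \<in> extensional (Obj \<C>)"
      by (simp add: pairing_transf_def)
    fix X assume X: "X \<in> Obj \<C>"
    \<comment> \<open>Stated for any \<open>\<xi>\<close>, as it is applied to
      \<open>\<zeta>\<close> and to the transformation of \<open>ev\<close>; both have transpose
      \<open>ev\<close> at \<open>I\<close>.\<close>
    have \<zeta>_f: "flat X (\<xi> X) \<cdot> (f \<otimes>\<^sub>a Idt \<C> (V \<otimes>\<^sub>o W)) = f \<cdot> flat ?I (\<xi> ?I)"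
      if \<xi>: "nat_transf \<C> (tensor_right \<C> V) (RHom \<C> W) \<xi>"
        and f: "f \<in> Arr \<C>" "Dom \<C> f = ?I" "Cod \<C> f = X" for \<xi> f
    proof -
      have Hom: "\<xi> Y \<in> Arr \<C>" "Dom \<C> (\<xi> Y) = Y \<otimes>\<^sub>o V" "Cod \<C> (\<xi> Y) = fobj (RHom \<C> W) Y"
        if "Y \<in> Obj \<C>" for Y
        using \<xi> that by (auto simp: nat_transf_def)
      have "\<xi> X \<cdot> (f \<otimes>\<^sub>a Idt \<C> V) = fmap (RHom \<C> W) f \<cdot> \<xi> ?I"
        using \<xi> f by (auto simp: nat_transf_def)
      then have "flat X (\<xi> X \<cdot> (f \<otimes>\<^sub>a Idt \<C> V)) = flat X (fmap (RHom \<C> W) f \<cdot> \<xi> ?I)"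
        by simp
      then show ?thesis
        using f X V Hom[OF X] Hom[OF UnitObj_Obj] flat_fmap[of "\<xi> ?I" f X]
        by (simp add: flat_Comp[of "\<xi> X"] TensArr_Idt)
    qed
    have "flat ?I (pairing_transf V ev ?I) = ev"
      using ev V by simp
    then have "flat X (\<zeta> X) \<cdot> (f \<otimes>\<^sub>a Idt \<C> (V \<otimes>\<^sub>o W)) =
        flat X (pairing_transf V ev X) \<cdot> (f \<otimes>\<^sub>a Idt \<C> (V \<otimes>\<^sub>o W))"
      if "f \<in> Arr \<C>" "Dom \<C> f = ?I" "Cod \<C> f = X" for f
      using \<zeta>_f[OF nat that] \<zeta>_f[OF p that] by (simp only: ev_def)
    then have "flat X (\<zeta> X) = flat X (pairing_transf V ev X)"
      using \<zeta>[OF X] ev V X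
      by - (rule generator_jointly_epi[OF gen X, of "V \<otimes>\<^sub>o W" _ X], simp_all)
    then show "\<zeta> X = pairing_transf V ev X"
      using \<zeta>[OF X] ev V X by - (rule flat_eqD[of X], simp_all)
  qed
qed

text \<open>The argument common to both halves: \<open>D\<close> stands for the dualities,
  \<open>S\<close> for the Lie monad or comonad morphisms.\<close>

lemma retraction_onto_dualities:
  assumes V: "V \<in> Obj \<C>" and D: "D \<subseteq> Hom \<C> (V \<otimes>\<^sub>o W) (UnitObj \<C>)" and z: "z \<in> D"
    and iff: "\<And>ev. ev \<in> Hom \<C> (V \<otimes>\<^sub>o W) (UnitObj \<C>) \<Longrightarrow> pairing_transf V ev \<in> S \<longleftrightarrow> ev \<in> D"
    and S: "\<And>\<zeta>. \<zeta> \<in> S \<Longrightarrow> \<zeta> \<in> extensional (Obj \<C>)"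
      "\<And>\<zeta>. \<zeta> \<in> S \<Longrightarrow> nat_transf \<C> (tensor_right \<C> V) (RHom \<C> W) \<zeta>"
  shows "\<exists>\<alpha> \<beta>. \<alpha> \<in> D \<rightarrow> S \<and> \<beta> \<in> S \<rightarrow> D \<and> (\<forall>ev\<in>D. \<beta> (\<alpha> ev) = ev) \<and>
    (regular_generator \<C> (UnitObj \<C>) \<longrightarrow> (\<forall>\<zeta>\<in>S. \<alpha> (\<beta> \<zeta>) = \<zeta>))"
proof -
  text \<open>Unless \<open>I\<close> is a generator, the pairing read off from a morphism need not be a duality;
    the zero pairing serves as a default.\<close>
  define \<beta> where "\<beta> \<zeta> = (let ev = flat (UnitObj \<C>) (\<zeta> (UnitObj \<C>)) in if ev \<in> D then ev else z)" for \<zeta>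
  have "pairing_transf V \<in> D \<rightarrow> S"
    using D iff by auto
  moreover have "\<beta> \<in> S \<rightarrow> D"
    using z by (auto simp: \<beta>_def Let_def)
  moreover have "\<beta> (pairing_transf V ev) = ev" if "ev \<in> D" for ev
  proof -
    have "ev \<in> Hom \<C> (V \<otimes>\<^sub>o W) (UnitObj \<C>)"
      using D that by blast
    then have "flat (UnitObj \<C>) (pairing_transf V ev (UnitObj \<C>)) = ev"
      using V by simp
    then show ?thesis
      using that by (simp add: \<beta>_def)
  qed
  moreover have "pairing_transf V (\<beta> \<zeta>) = \<zeta>"
    if gen: "regular_generator \<C> (UnitObj \<C>)" and \<zeta>: "\<zeta> \<in> S" for \<zeta>
  proof -
    let ?ev = "flat (UnitObj \<C>) (\<zeta> (UnitObj \<C>))"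
    \<comment> \<open>Here \<open>\<zeta>\<close> is the transformation of \<open>?ev\<close>, so
      \<open>iff\<close> puts \<open>?ev\<close> in \<open>D\<close> and the default is not
      taken.\<close>
    note eq = nat_transf_eq_pairing_transf[OF gen V S(2,1)[OF \<zeta>]]
    then have "?ev \<in> D"
      using iff[of ?ev] \<zeta> by simp
    then show ?thesis
      using eq(2) by (simp add: \<beta>_def)
  qed
  ultimately show ?thesis
    by blast
qed

end

section \<open>Assembling the monad and the comonad correspondence\<close>

theorem proposition5p2:
  fixes \<C> :: "('o, 'a, 'x) closed_category_data_scheme"
    and L C :: 'o and lam \<Lambda> \<gamma> \<Upsilon> :: 'a
  assumes "additive_closed_strict_monoidal_category \<C>"
    and "yb_lie_algebra \<C> L lam \<Lambda>"
    and "yb_lie_coalgebra \<C> C \<gamma> \<Upsilon>"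
  shows
    "(\<exists>\<alpha> \<beta>.
        \<alpha> \<in> Dual \<C> L lam \<Lambda> C \<gamma> \<Upsilon> \<rightarrow> LieMonadHom \<C> (Mnd \<C> L lam \<Lambda>) (Mnd' \<C> C \<gamma> \<Upsilon>) \<and>
        \<beta> \<in> LieMonadHom \<C> (Mnd \<C> L lam \<Lambda>) (Mnd' \<C> C \<gamma> \<Upsilon>) \<rightarrow> Dual \<C> L lam \<Lambda> C \<gamma> \<Upsilon> \<and>
        (\<forall>ev \<in> Dual \<C> L lam \<Lambda> C \<gamma> \<Upsilon>. \<beta> (\<alpha> ev) = ev) \<and>
        (regular_generator \<C> (UnitObj \<C>) \<longrightarrow>
          (\<forall>\<zeta> \<in> LieMonadHom \<C> (Mnd \<C> L lam \<Lambda>) (Mnd' \<C> C \<gamma> \<Upsilon>). \<alpha> (\<beta> \<zeta>) = \<zeta>))) \<and>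
     (\<exists>\<alpha>' \<beta>'.
        \<alpha>' \<in> Dual \<C> L lam \<Lambda> C \<gamma> \<Upsilon> \<rightarrow> LieComonadHom \<C> (CMnd \<C> C \<gamma> \<Upsilon>) (CMnd' \<C> L lam \<Lambda>) \<and>
        \<beta>' \<in> LieComonadHom \<C> (CMnd \<C> C \<gamma> \<Upsilon>) (CMnd' \<C> L lam \<Lambda>) \<rightarrow> Dual \<C> L lam \<Lambda> C \<gamma> \<Upsilon> \<and>
        (\<forall>ev \<in> Dual \<C> L lam \<Lambda> C \<gamma> \<Upsilon>. \<beta>' (\<alpha>' ev) = ev) \<and>
        (regular_generator \<C> (UnitObj \<C>) \<longrightarrow>
          (\<forall>\<theta> \<in> LieComonadHom \<C> (CMnd \<C> C \<gamma> \<Upsilon>) (CMnd' \<C> L lam \<Lambda>). \<alpha>' (\<beta>' \<theta>) = \<theta>)))"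
proof -
  let ?R = "reverse \<C>"
  interpret C: additive_closed_strict_monoidal_category \<C> by fact
  interpret R: additive_closed_strict_monoidal_category ?R by (rule C.closed_reverse)
  have L: "L \<in> Obj \<C>" and C: "C \<in> Obj \<C>"
    using assms(2,3) by (simp_all add: yb_lie_algebra_def yb_lie_coalgebra_def symmetric_yb_operator_def)
  interpret right: right_hom \<C> C using C by (rule C.right_hom)
  \<comment> \<open>In the reversed category the hom functor with exponent \<open>L\<close> is
    \<open>H'(L,-)\<close>, so the comonad half is again about a right hom.\<close>
  interpret left: right_hom ?R L using L by (intro R.right_hom) simp
  have Dual_Hom: "Dual \<C> L lam \<Lambda> C \<gamma> \<Upsilon> \<subseteq> Hom \<C> (L \<otimes>\<^sub>o\<^bsub>\<C>\<^esub> C) (UnitObj \<C>)"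
    by (auto simp: Dual_def)
  note zero = C.Zero_in_Dual[OF assms(2,3)]
  have monad: "\<zeta> \<in> extensional (Obj \<C>)" "nat_transf \<C> (tensor_right \<C> L) (RHom \<C> C) \<zeta>"
    if "\<zeta> \<in> LieMonadHom \<C> (Mnd \<C> L lam \<Lambda>) (Mnd' \<C> C \<gamma> \<Upsilon>)" for \<zeta>
    using that by (auto simp: LieMonadHom_def nat_transf_def)
  have comonad: "\<theta> \<in> extensional (Obj ?R)" "nat_transf ?R (tensor_right ?R C) (RHom ?R L) \<theta>"
    if "\<theta> \<in> LieComonadHom \<C> (CMnd \<C> C \<gamma> \<Upsilon>) (CMnd' \<C> L lam \<Lambda>)" for \<theta>
    using that
    by (auto simp: LieComonadHom_def nat_transf_def reverse_additive_notions CMnd_def CMnd'_def)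
  \<comment> \<open>Reversing twice restores \<open>\<C>\<close>: here the algebra enters reversed
    and the coalgebra as given, opposite to the monad half.\<close>
  have comonad_iff: "left.pairing_transf C ev \<in> LieComonadHom \<C> (CMnd \<C> C \<gamma> \<Upsilon>) (CMnd' \<C> L lam \<Lambda>) \<longleftrightarrow>
      ev \<in> Dual \<C> L lam \<Lambda> C \<gamma> \<Upsilon>" if "ev \<in> Hom ?R (C \<otimes>\<^sub>o\<^bsub>?R\<^esub> L) (UnitObj ?R)" for ev
    using left.pairing_transf_in_LieComonadHom_iff[OF C.yb_lie_algebra_reverse[OF assms(2)] _ that,
        of \<gamma> \<Upsilon>] assms(3)
    by (simp add: RCMnd_def RCMnd'_def reverse_LieComonadHom)
  show ?thesis
    using right.retraction_onto_dualities[OF L Dual_Hom zero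
        right.pairing_transf_in_LieMonadHom_iff[OF assms(2) C.yb_lie_coalgebra_reverse[OF assms(3)]]
        monad]
      left.retraction_onto_dualities[of C "Dual \<C> L lam \<Lambda> C \<gamma> \<Upsilon>", OF _ _ zero comonad_iff comonad]
      C Dual_Hom
    by (simp add: reverse_additive_notions)
qed

end
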